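(* If $n \leq 5$, then the tropical pure spinor space $\operatorname{TSpin}^{\pm}(n)$ equals the $\Delta$-Dressian $\operatorname{DDr}(n)$, i.e. the Wick relations form a tropical basis of the ideal they generate. If $n \geq 7$, then $\operatorname{TSpin}^{\pm}(n)$ is strictly contained in $\operatorname{DDr}(n)$; in fact, there is a vector $p$ in the even $\Delta$-Dressian $\operatorname{DDr}^+(n)$ whose support consists of all even-sized subsets of $[n]$ and which is not in the tropical spinor variety $\operatorname{TSpin}^+(n)$.
   Context: Let $\mathbb{T} = \mathbb{R} \cup \{\infty\}$ with tropical operations $x \oplus y = \min(x,y)$, $x \odot y = x+y$. Let $K = \mathbb{C}\{\{t\}\}$ be the field of Puiseux series with its valuation $\operatorname{val}$ (least exponent, $\operatorname{val}(0)=\infty$). For a polynomial $P = \sum_a f_a X^a \in K[X_1,\dots,X_N]$, its tropicalization is $\operatorname{trop}(P)(x) = \min_a (\operatorname{val}(f_a) + a\cdot x)$, and its tropical hypersurface $\operatorname{Trop}(\operatorname{trop}(P)) \subseteq \mathbb{T}^N$ is the set of $x$ at which this minimum is attained at least twice or equals $\infty$. For an ideal $I$, its tropical variety is $\bigcap_{P \in I} \operatorname{Trop}(\operatorname{trop}(P))$. A generating set $S$ of $I$ is a tropical basis if $\bigcap_{P\in S}\operatorname{Trop}(\operatorname{trop}(P))$ equals the tropical variety of $I$. Let $\mathcal{P}([n])$ be the set of subsets of $[n]=\{1,\dots,n\}$; write $S\Delta i$ for $S \Delta \{i\}$. Wick relations: use variables $w_S$, $S \in \mathcal{P}([n])$,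 and for a sequence $\rho$ of elements of $[n]$ let $w_\rho = 0$ if $\rho$ has a repeated entry and otherwise $w_\rho = \operatorname{sign}(\pi) w_{\{\rho\}}$, where $\pi$ is the permutation sorting $\rho$ increasingly. For sequences $\sigma=(\sigma_1,\dots,\sigma_r)$, $\tau=(\tau_1,\dots,\tau_s)$ of elements of $[n]$, the Wick relation is $\sum_{i=1}^s (-1)^i w_{\tau_i \sigma_1\cdots\sigma_r} w_{\tau_1\cdots\widehat{\tau_i}\cdots\tau_s} + \sum_{j=1}^r (-1)^j w_{\sigma_1\cdots\widehat{\sigma_j}\cdots\sigma_r} w_{\sigma_j\tau_1\cdots\tau_s}$. The space of pure spinors $\operatorname{Spin}^{\pm}(n) \subseteq \mathbb{P}^{2^n-1}(K)$ is the zero set of all Wick relations (equivalently, the set of Wick coordinate vectors of $n$-dimensional totally isotropic subspaces of $K^{2n}$ for the form $\sum_i x_i y_{i^*} + x_{i^*} y_i$). The tropical pure spinor space $\operatorname{TSpin}^{\pm}(n) \subseteq \mathbb{T}^{\mathcal{P}([n])}$ is the tropical variety of the ideal generated by all Wick relations. The spinor variety $\operatorname{Spin}^+(n)$ is the set of points of $\operatorname{Spin}^{\pm}(n)$ whose support $\{S : w_S \neq 0\}$ consists of even-sized sets, and the tropical spinor variety $\operatorname{TSpin}^+(n)$ is the tropical variety of the ideal of polynomials vanishing on $\operatorname{Spin}^+(n)$. A vector $p \in \mathbb{T}^{\mathcal{P}([n])}$ is a tropical Wick vector if for all $S,T \in \mathcal{P}([n])$ the minimum $\min_{i \in S\Delta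 T}(p_{S\Delta i} + p_{T \Delta i})$ is attained at least twice or equals $\infty$. Its support is $\operatorname{supp}(p)=\{S : p_S \ne \infty\}$. The $\Delta$-Dressian $\operatorname{DDr}(n)$ is the set of all tropical Wick vectors, and the even $\Delta$-Dressian $\operatorname{DDr}^+(n)$ is the set of tropical Wick vectors whose support consists only of even-sized subsets. *)

theory Defs
  imports Complex_Main "HOL-Library.Function_Algebras" "HOL-Library.Extended_Real"
begin

text \<open>A Puiseux series is represented by its coefficient function q |-> coefficient of t^q.
  Addition and zero are pointwise (Function_Algebras); multiplication is the Cauchy product.\<close>

type_synonym puis = "rat \<Rightarrow> complex"

definition puiseux :: "puis set" where
  "puiseux = {f. \<exists>N::nat. N > 0 \<and> (\<exists>m::int. \<forall>q. f q \<noteq> 0 \<longrightarrow>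
                 (\<exists>k::int. k \<ge> m \<and> q = of_int k / of_nat N))}"

definition pconst :: "complex \<Rightarrow> puis" where
  "pconst c = (\<lambda>q. if q = 0 then c else 0)"

definition pmul :: "puis \<Rightarrow> puis \<Rightarrow> puis" where
  "pmul f g = (\<lambda>q. \<Sum>a\<in>{a. f a \<noteq> 0 \<and> g (q - a) \<noteq> 0}. f a * g (q - a))"

fun ppow :: "puis \<Rightarrow> nat \<Rightarrow> puis" where
  "ppow f 0 = pconst 1"
| "ppow f (Suc k) = pmul f (ppow f k)"

definition val :: "puis \<Rightarrow> ereal" where
  "val f = (if f = 0 then \<infinity> else ereal (real_of_rat (LEAST q. f q \<noteq> 0)))"

type_synonym mono = "nat set \<Rightarrow> nat"
type_synonym kpoly = "mono \<Rightarrow> puis"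

definition polys :: "nat \<Rightarrow> kpoly set" where
  "polys n = {P. finite {a. P a \<noteq> 0} \<and> (\<forall>a. P a \<in> puiseux) \<and>
                 (\<forall>a. P a \<noteq> 0 \<longrightarrow> (\<forall>S. a S \<noteq> 0 \<longrightarrow> S \<subseteq> {1..n}))}"

definition pmult :: "kpoly \<Rightarrow> kpoly \<Rightarrow> kpoly" where
  "pmult P Q = (\<lambda>c. \<Sum>(a,b)\<in>{(a,b). P a \<noteq> 0 \<and> Q b \<noteq> 0 \<and> (\<forall>S. a S + b S = c S)}.
                      pmul (P a) (Q b))"

definition gen_ideal :: "nat \<Rightarrow> kpoly set \<Rightarrow> kpoly set" where
  "gen_ideal n G = {(\<Sum>i<k. pmult (C i) (g i)) | (k::nat) C g. \<forall>i<k. C i \<in> polys n \<and> g i \<in> G}"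

definition subsets_list :: "nat \<Rightarrow> nat set list" where
  "subsets_list n = map set (subseqs [1..<Suc n])"

definition mono_eval :: "nat \<Rightarrow> mono \<Rightarrow> (nat set \<Rightarrow> puis) \<Rightarrow> puis" where
  "mono_eval n a w = foldr (\<lambda>S acc. pmul (ppow (w S) (a S)) acc) (subsets_list n) (pconst 1)"

definition peval :: "nat \<Rightarrow> kpoly \<Rightarrow> (nat set \<Rightarrow> puis) \<Rightarrow> puis" where
  "peval n P w = (\<Sum>a\<in>{a. P a \<noteq> 0}. pmul (P a) (mono_eval n a w))"

text \<open>T = R with infinity, vectors indexed by P([n]); coordinates outside P([n]) are fixed to infinity.\<close>
definition tvec :: "nat \<Rightarrow> (nat set \<Rightarrow> ereal) set" where
  "tvec n = {p. (\<forall>S. S \<subseteq> {1..n} \<longrightarrow> p S \<noteq> -\<infinity>) \<and> (\<forall>S. \<not> S \<subseteq> {1..n} \<longrightarrow> p S = \<infinity>)}"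

definition trop_term :: "nat \<Rightarrow> kpoly \<Rightarrow> (nat set \<Rightarrow> ereal) \<Rightarrow> mono \<Rightarrow> ereal" where
  "trop_term n P x a = val (P a) + (\<Sum>S\<in>Pow {1..n}. ereal (of_nat (a S)) * x S)"

definition trop_hyp :: "nat \<Rightarrow> kpoly \<Rightarrow> (nat set \<Rightarrow> ereal) set" where
  "trop_hyp n P = {x \<in> tvec n.
      (\<forall>a. P a \<noteq> 0 \<longrightarrow> trop_term n P x a = \<infinity>) \<or>
      (\<exists>a b. a \<noteq> b \<and> P a \<noteq> 0 \<and> P b \<noteq> 0 \<and> trop_term n P x a = trop_term n P x b \<and>
             (\<forall>c. P c \<noteq> 0 \<longrightarrow> trop_term n P x a \<le> trop_term n P x c))}"

definition trop_var :: "nat \<Rightarrow> kpoly set \<Rightarrow> (nat set \<Rightarrow> ereal) set" where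
  "trop_var n I = {x \<in> tvec n. \<forall>P\<in>I. x \<in> trop_hyp n P}"

definition seq_sign :: "nat list \<Rightarrow> int" where
  "seq_sign \<rho> = (-1) ^ card {(i,j). i < j \<and> j < length \<rho> \<and> \<rho> ! i > \<rho> ! j}"

definition mono2 :: "nat set \<Rightarrow> nat set \<Rightarrow> mono" where
  "mono2 A B = (\<lambda>S. (if S = A then 1 else 0) + (if S = B then 1 else 0))"

text \<open>The polynomial c * w_rho1 * w_rho2 (w_rho = 0 if rho has a repeated entry).\<close>
definition wterm :: "int \<Rightarrow> nat list \<Rightarrow> nat list \<Rightarrow> kpoly" where
  "wterm c \<rho>1 \<rho>2 = (if distinct \<rho>1 \<and> distinct \<rho>2
      then (\<lambda>a. if a = mono2 (set \<rho>1) (set \<rho>2)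
                 then pconst (of_int (c * seq_sign \<rho>1 * seq_sign \<rho>2)) else 0)
      else 0)"

definition del :: "nat \<Rightarrow> nat list \<Rightarrow> nat list" where
  "del i xs = take i xs @ drop (Suc i) xs"

definition wick :: "nat list \<Rightarrow> nat list \<Rightarrow> kpoly" where
  "wick \<sigma> \<tau> =
     (\<Sum>i<length \<tau>. wterm ((-1) ^ (i + 1)) ((\<tau> ! i) # \<sigma>) (del i \<tau>)) +
     (\<Sum>j<length \<sigma>. wterm ((-1) ^ (j + 1)) (del j \<sigma>) ((\<sigma> ! j) # \<tau>))"

definition wick_rels :: "nat \<Rightarrow> kpoly set" where
  "wick_rels n = {wick \<sigma> \<tau> | \<sigma> \<tau>. set \<sigma> \<subseteq> {1..n} \<and> set \<tau> \<subseteq> {1..n}}"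

text \<open>Spin^{pm}(n), as the set of nonzero representatives (affine cone minus 0) of its points.\<close>
definition Spin_pm :: "nat \<Rightarrow> (nat set \<Rightarrow> puis) set" where
  "Spin_pm n = {w. (\<forall>S. w S \<in> puiseux) \<and> (\<forall>S. \<not> S \<subseteq> {1..n} \<longrightarrow> w S = 0) \<and>
                   (\<exists>S. w S \<noteq> 0) \<and> (\<forall>P\<in>wick_rels n. peval n P w = 0)}"

definition Spin_plus :: "nat \<Rightarrow> (nat set \<Rightarrow> puis) set" where
  "Spin_plus n = {w \<in> Spin_pm n. \<forall>S. w S \<noteq> 0 \<longrightarrow> even (card S)}"

definition vanish_ideal :: "nat \<Rightarrow> (nat set \<Rightarrow> puis) set \<Rightarrow> kpoly set" where
  "vanish_ideal n X = {P \<in> polys n. \<forall>w\<in>X. peval n P w = 0}"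

definition TSpin_pm :: "nat \<Rightarrow> (nat set \<Rightarrow> ereal) set" where
  "TSpin_pm n = trop_var n (gen_ideal n (wick_rels n))"

definition TSpin_plus :: "nat \<Rightarrow> (nat set \<Rightarrow> ereal) set" where
  "TSpin_plus n = trop_var n (vanish_ideal n (Spin_plus n))"

definition symd :: "nat set \<Rightarrow> nat set \<Rightarrow> nat set" where
  "symd A B = (A - B) \<union> (B - A)"

definition min_twice :: "(nat \<Rightarrow> ereal) \<Rightarrow> nat set \<Rightarrow> bool" where
  "min_twice f A = ((\<forall>i\<in>A. f i = \<infinity>) \<or>
      (\<exists>i\<in>A. \<exists>j\<in>A. i \<noteq> j \<and> f i = f j \<and> (\<forall>k\<in>A. f i \<le> f k)))"

definition DDr :: "nat \<Rightarrow> (nat set \<Rightarrow> ereal) set" where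
  "DDr n = {p \<in> tvec n. \<forall>S T. S \<subseteq> {1..n} \<longrightarrow> T \<subseteq> {1..n} \<longrightarrow>
       min_twice (\<lambda>i. p (symd S {i}) + p (symd T {i})) (symd S T)}"

definition tsupp :: "(nat set \<Rightarrow> ereal) \<Rightarrow> nat set set" where
  "tsupp p = {S. p S \<noteq> \<infinity>}"

definition DDr_plus :: "nat \<Rightarrow> (nat set \<Rightarrow> ereal) set" where
  "DDr_plus n = {p \<in> DDr n. \<forall>S\<in>tsupp p. even (card S)}"

end

theory Submission
  imports Defs "HOL-Library.Multiset"
begin

text \<open>Inclusion: every Wick relation is a generator, and its monomials are distinct unless
  \<open>|S \<Delta> T| = 2\<close>, when the tropical condition is trivial. Conversely, if \<open>p\<close> is the coordinatewise
  valuation of a solution of the Wick relations over a valued ring containing the Puiseux series,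
  then no polynomial of the ideal has a unique minimal term at \<open>p\<close>. So for \<open>n \<le> 5\<close> one lifts a
  tropical Wick vector \<open>p\<close> to series with real exponents. The Wick relations are invariant under
  \<open>S \<mapsto> S \<Delta> X\<close>, so any \<open>X\<close> in the support may play the role of the empty set; then a lift is the
  vector of sub-Pfaffians of a skew \<open>5 \<times> 5\<close> matrix. For generic entries each \<open>4 \<times> 4\<close> Pfaffian has
  the least valuation its three terms allow, and it must cancel only if \<open>p\<close> is not minimal there.
  In each facet of the 5-cube at least half of the support attains the minimum, so some \<open>X\<close> needs at
  most two cancelling Pfaffians. These two are dot products \<open>u \<cdot> v\<close> and \<open>u \<cdot> w\<close>, linear in the free
  vectors \<open>v\<close> and \<open>w\<close>, while the other three are the coordinates of \<open>s u - v \<times> w\<close>.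

  For \<open>n \<ge> 7\<close>, perturbing a convex function of \<open>|S|\<close> on the complements of the Fano lines gives a
  tropical Wick vector. Modulo the perturbed variables, four Wick relations become binomials that
  combine to twice a monomial, which reflects that the Fano plane is not representable over a
  field of characteristic 0.\<close>

section \<open>The ring of generalized power series with real exponents\<close>

text \<open>Coordinates of a tropical vector are arbitrary reals, while Puiseux exponents are
  rational, so a lift over \<open>K\<close> itself need not exist. Membership in the tropical
  variety only asks that no polynomial of the ideal has a unique minimal term, hence any larger ring
  with a multiplicative valuation may carry the lift. Series with finitely many terms below each
  bound suffice: products are finite sums, Puiseux series embed, and the only divisions needed are
  by monomials. The obstacle to the lift is that the equations for \<open>u . v\<close> and
  \<open>u . w\<close> may force the leading parts of two coordinates of \<open>v\<close> and
  \<open>w\<close> to be proportional, so that a minor of \<open>v\<close> and \<open>w\<close> gets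
  too large a valuation. With suitable coefficients this happens only if both cancellations take
  place between the same two terms; then either \<open>s u\<close> has the required valuation
  anyway, or a further tropical Wick relation is violated. A third cancelling Pfaffian would be a
  quadratic condition on \<open>v\<close> and \<open>w\<close>; it is avoided because a support
  vertex has on average at most 5/2 bad facets, hence some vertex has fewer than three.\<close>

definition left_finite :: "(real \<Rightarrow> complex) \<Rightarrow> bool" where
  "left_finite f \<longleftrightarrow> (\<forall>c. finite {x. x \<le> c \<and> f x \<noteq> 0})"

lemma left_finiteD: "left_finite f \<Longrightarrow> finite {x. x \<le> c \<and> f x \<noteq> 0}"
  by (simp add: left_finite_def)

lemma left_finite_zero: "left_finite (\<lambda>_. 0)"
  by (simp add: left_finite_def)

lemma left_finite_add:
  assumes "left_finite f" "left_finite g" shows "left_finite (\<lambda>x. f x + g x)"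
  unfolding left_finite_def
proof
  fix c show "finite {x. x \<le> c \<and> f x + g x \<noteq> 0}"
    by (rule finite_subset[OF _ finite_UnI[OF left_finiteD[OF assms(1)] left_finiteD[OF assms(2)]]]) auto
qed

lemma left_finite_uminus: "left_finite f \<Longrightarrow> left_finite (\<lambda>x. - f x)"
  by (simp add: left_finite_def)

lemma left_finite_bounded_below:
  assumes "left_finite f" shows "\<exists>m. \<forall>x. f x \<noteq> 0 \<longrightarrow> m \<le> x"
proof (cases "\<exists>c. f c \<noteq> 0")
  case True
  then obtain c where c: "f c \<noteq> 0" by blast
  let ?A = "{x. x \<le> c \<and> f x \<noteq> 0}"
  have fin: "finite ?A" by (rule left_finiteD[OF assms])
  have "Min ?A \<le> x" if "f x \<noteq> 0" for x
  proof (cases "x \<le> c")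
    case False
    have "Min ?A \<le> c" using c fin by (intro Min_le) auto
    with False show ?thesis by simp
  qed (use that fin in \<open>auto intro!: Min_le\<close>)
  then show ?thesis by blast
qed auto

definition conv :: "(real \<Rightarrow> complex) \<Rightarrow> (real \<Rightarrow> complex) \<Rightarrow> real \<Rightarrow> complex" where
  "conv f g x = (\<Sum>a\<in>{a. f a \<noteq> 0 \<and> g (x - a) \<noteq> 0}. f a * g (x - a))"

text \<open>If both supports lie above \<open>m\<close>, then \<open>a + b = y\<close> bounds both
  summands by \<open>y - m\<close>, so the convolution is read off a finite grid. Larger grids are
  allowed, so one grid serves many \<open>y\<close>; this turns associativity into an exchange of
  finite sums.\<close>

lemma conv_double_sum:
  assumes "\<And>a. f a \<noteq> 0 \<Longrightarrow> m \<le> a" "\<And>b. g b \<noteq> 0 \<Longrightarrow> m \<le> b"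
    and "finite F" "finite G" "\<And>a. a \<le> y - m \<Longrightarrow> f a \<noteq> 0 \<Longrightarrow> a \<in> F"
    and "\<And>b. b \<le> y - m \<Longrightarrow> g b \<noteq> 0 \<Longrightarrow> b \<in> G"
  shows "conv f g y = (\<Sum>a\<in>F. \<Sum>b\<in>G. if a + b = y then f a * g b else 0)"
proof -
  have sub: "{a. f a \<noteq> 0 \<and> g (y - a) \<noteq> 0} \<subseteq> F"
    using assms(2) assms(5) by force
  have "conv f g y = (\<Sum>a\<in>F. f a * g (y - a))"
    unfolding conv_def by (rule sum.mono_neutral_left) (use assms sub in auto)
  also have "\<dots> = (\<Sum>a\<in>F. \<Sum>b\<in>G. if a + b = y then f a * g b else 0)"
  proof (rule sum.cong)
    fix a assume "a \<in> F"
    have "(\<Sum>b\<in>G. if a + b = y then f a * g b else 0) = (\<Sum>b\<in>G. if b = y - a then f a * g b else 0)"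
      by (rule sum.cong) auto
    also have "\<dots> = f a * g (y - a)"
    proof (cases "y - a \<in> G \<or> f a = 0")
      case False
      then have "f a \<noteq> 0" "y - a \<notin> G" by auto
      with assms(1)[of a] assms(6)[of "y - a"] have "g (y - a) = 0" by force
      with False assms(4) show ?thesis by simp
    qed (use assms(4) in auto)
    finally show "f a * g (y - a) = (\<Sum>b\<in>G. if a + b = y then f a * g b else 0)" by simp
  qed simp
  finally show ?thesis .
qed

lemma common_bound:
  assumes "left_finite f" "left_finite g" "left_finite h"
  shows "\<exists>m. \<forall>a. f a \<noteq> 0 \<or> g a \<noteq> 0 \<or> h a \<noteq> 0 \<longrightarrow> m \<le> a"
proof -
  obtain m1 m2 m3 where m: "\<forall>a. f a \<noteq> 0 \<longrightarrow> m1 \<le> a" "\<forall>a. g a \<noteq> 0 \<longrightarrow> m2 \<le> a" "\<forall>a. h a \<noteq> 0 \<longrightarrow> m3 \<le> a"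
    using assms[THEN left_finite_bounded_below] by blast
  have "\<forall>a. f a \<noteq> 0 \<or> g a \<noteq> 0 \<or> h a \<noteq> 0 \<longrightarrow> min m1 (min m2 m3) \<le> a"
    using m by (simp add: min_le_iff_disj) blast
  then show ?thesis ..
qed

lemma conv_nonzeroD: "conv f g x \<noteq> 0 \<Longrightarrow> \<exists>a. f a \<noteq> 0 \<and> g (x - a) \<noteq> 0"
  by (rule ccontr) (auto simp: conv_def intro!: sum.neutral)

lemma left_finite_conv:
  assumes "left_finite f" "left_finite g" shows "left_finite (conv f g)"
  unfolding left_finite_def
proof
  fix c
  obtain m where m: "\<And>a. f a \<noteq> 0 \<Longrightarrow> m \<le> a" "\<And>a. g a \<noteq> 0 \<Longrightarrow> m \<le> a"
    using common_bound[OF assms assms(1)] by (auto simp: imp_disjL)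
  have "{x. x \<le> c \<and> conv f g x \<noteq> 0} \<subseteq> (\<lambda>(a, b). a + b) `
     ({a. a \<le> c - m \<and> f a \<noteq> 0} \<times> {b. b \<le> c - m \<and> g b \<noteq> 0})"
  proof
    fix x assume x: "x \<in> {x. x \<le> c \<and> conv f g x \<noteq> 0}"
    then obtain a where a: "f a \<noteq> 0" "g (x - a) \<noteq> 0" using conv_nonzeroD by blast
    with m(1)[OF a(1)] m(2)[OF a(2)] x
    show "x \<in> (\<lambda>(a, b). a + b) ` ({a. a \<le> c - m \<and> f a \<noteq> 0} \<times> {b. b \<le> c - m \<and> g b \<noteq> 0})"
      by (intro image_eqI[of _ _ "(a, x - a)"]) auto
  qed
  then show "finite {x. x \<le> c \<and> conv f g x \<noteq> 0}"
    by (rule finite_subset) (intro finite_imageI finite_cartesian_product left_finiteD assms)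
qed

lemma conv_commute: "conv f g = conv g f"
proof
  fix x
  show "conv f g x = conv g f x"
    unfolding conv_def
    by (rule sum.reindex_bij_witness[of _ "\<lambda>a. x - a" "\<lambda>a. x - a"]) auto
qed

lemma conv_assoc:
  assumes "left_finite f" "left_finite g" "left_finite h"
  shows "conv (conv f g) h = conv f (conv g h)"
proof
  fix x
  obtain m0 where m0: "\<And>a. f a \<noteq> 0 \<Longrightarrow> m0 \<le> a" "\<And>a. g a \<noteq> 0 \<Longrightarrow> m0 \<le> a" "\<And>a. h a \<noteq> 0 \<Longrightarrow> m0 \<le> a"
    using common_bound[OF assms] by auto
  define m where "m = min m0 0"
  have m: "\<And>a. f a \<noteq> 0 \<Longrightarrow> m \<le> a" "\<And>a. g a \<noteq> 0 \<Longrightarrow> m \<le> a" "\<And>a. h a \<noteq> 0 \<Longrightarrow> m \<le> a" "m \<le> 0"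
    using m0 by (force simp: m_def)+
  \<comment> \<open>Three summands with sum \<open>x\<close>, each at least \<open>m\<close>, are
    each at most \<open>x - 2 * m\<close>; one cutoff serves all inner and outer sums.\<close>
  define F where "F = {a. a \<le> x - 2 * m \<and> f a \<noteq> 0}"
  define G where "G = {a. a \<le> x - 2 * m \<and> g a \<noteq> 0}"
  define H where "H = {a. a \<le> x - 2 * m \<and> h a \<noteq> 0}"
  have fin: "finite F" "finite G" "finite H"
    using assms by (auto simp: F_def G_def H_def left_finiteD)
  have fg: "conv f g y = (\<Sum>a\<in>F. \<Sum>b\<in>G. if a + b = y then f a * g b else 0)" if "y \<le> x - m" for y
    by (rule conv_double_sum[where m = m]) (use m fin that in \<open>auto simp: F_def G_def\<close>)
  have gh: "conv g h y = (\<Sum>a\<in>G. \<Sum>b\<in>H. if a + b = y then g a * h b else 0)" if "y \<le> x - m" for y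
    by (rule conv_double_sum[where m = m]) (use m fin that in \<open>auto simp: G_def H_def\<close>)
  have one: "conv u v x = (\<Sum>d\<in>D. u (x - d) * v d)"
    if "finite D" "\<And>d. v d \<noteq> 0 \<Longrightarrow> u (x - d) \<noteq> 0 \<Longrightarrow> d \<in> D" for u v D
  proof -
    have "conv u v x = (\<Sum>d\<in>{d. v d \<noteq> 0 \<and> u (x - d) \<noteq> 0}. u (x - d) * v d)"
      unfolding conv_def
      by (rule sum.reindex_bij_witness[of _ "\<lambda>a. x - a" "\<lambda>a. x - a"]) auto
    also have "\<dots> = (\<Sum>d\<in>D. u (x - d) * v d)"
      by (rule sum.mono_neutral_left) (use that in auto)
    finally show ?thesis .
  qed
  have lb: "2 * m \<le> y" if "conv u v y \<noteq> 0" "\<And>a. u a \<noteq> 0 \<Longrightarrow> m \<le> a" "\<And>a. v a \<noteq> 0 \<Longrightarrow> m \<le> a" for u v y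
    using conv_nonzeroD[OF that(1)] that(2,3) by force
  have "conv (conv f g) h x = (\<Sum>d\<in>H. conv f g (x - d) * h d)"
  proof (rule one[OF fin(3)])
    fix d assume "h d \<noteq> 0" "conv f g (x - d) \<noteq> 0"
    with lb[of f g "x - d"] m show "d \<in> H" by (auto simp: H_def)
  qed
  also have "\<dots> = (\<Sum>d\<in>H. (\<Sum>a\<in>F. \<Sum>b\<in>G. if a + b = x - d then f a * g b else 0) * h d)"
  proof (rule sum.cong)
    fix d assume "d \<in> H"
    then have "x - d \<le> x - m" using m(3)[of d] by (auto simp: H_def)
    from fg[OF this] show "conv f g (x - d) * h d = (\<Sum>a\<in>F. \<Sum>b\<in>G. if a + b = x - d then f a * g b else 0) * h d" by simp
  qed simp
  also have "\<dots> = (\<Sum>d\<in>H. \<Sum>a\<in>F. \<Sum>b\<in>G. if a + b + d = x then f a * g b * h d else 0)"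
    by (auto simp: sum_distrib_right intro!: sum.cong)
  also have "\<dots> = (\<Sum>a\<in>F. \<Sum>d\<in>H. \<Sum>b\<in>G. if a + b + d = x then f a * g b * h d else 0)"
    by (rule sum.swap)
  also have "\<dots> = (\<Sum>a\<in>F. \<Sum>b\<in>G. \<Sum>d\<in>H. if a + b + d = x then f a * g b * h d else 0)"
    by (rule sum.cong[OF refl]) (rule sum.swap)
  also have "\<dots> = (\<Sum>a\<in>F. (\<Sum>b\<in>G. \<Sum>d\<in>H. if b + d = x - a then g b * h d else 0) * f a)"
    by (auto simp: sum_distrib_right intro!: sum.cong)
  also have "\<dots> = (\<Sum>a\<in>F. conv g h (x - a) * f a)"
  proof (rule sum.cong)
    fix a assume "a \<in> F"
    then have "x - a \<le> x - m" using m(1)[of a] by (auto simp: F_def)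
    from gh[OF this] show "(\<Sum>b\<in>G. \<Sum>d\<in>H. if b + d = x - a then g b * h d else 0) * f a = conv g h (x - a) * f a" by simp
  qed simp
  also have "\<dots> = conv (conv g h) f x"
  proof (rule one[OF fin(1), symmetric])
    fix d assume "f d \<noteq> 0" "conv g h (x - d) \<noteq> 0"
    with lb[of g h "x - d"] m show "d \<in> F" by (auto simp: F_def)
  qed
  also have "\<dots> = conv f (conv g h) x"
    by (simp add: conv_commute left_finite_conv assms)
  finally show "conv (conv f g) h x = conv f (conv g h) x" .
qed

lemma conv_add:
  assumes "left_finite f" "left_finite g" "left_finite h"
  shows "conv (\<lambda>x. f x + g x) h = (\<lambda>x. conv f h x + conv g h x)"
proof
  fix x
  obtain m where m: "\<And>a. f a \<noteq> 0 \<Longrightarrow> m \<le> a" "\<And>a. g a \<noteq> 0 \<Longrightarrow> m \<le> a" "\<And>a. h a \<noteq> 0 \<Longrightarrow> m \<le> a"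
    using common_bound[OF assms] by auto
  define A where "A = {a. a \<le> x - m \<and> f a \<noteq> 0} \<union> {a. a \<le> x - m \<and> g a \<noteq> 0}"
  have fin: "finite A" using assms by (auto simp: A_def left_finiteD)
  have mem: "a \<in> A" if "h (x - a) \<noteq> 0" "f a \<noteq> 0 \<or> g a \<noteq> 0" for a
    using m(3)[OF that(1)] that(2) by (auto simp: A_def)
  have "conv u h x = (\<Sum>a\<in>A. u a * h (x - a))" if "\<And>a. u a \<noteq> 0 \<Longrightarrow> f a \<noteq> 0 \<or> g a \<noteq> 0" for u
    unfolding conv_def by (rule sum.mono_neutral_left) (use fin mem that in auto)
  note * = this
  have "conv (\<lambda>x. f x + g x) h x = (\<Sum>a\<in>A. (f a + g a) * h (x - a))" by (rule *) auto
  also have "\<dots> = conv f h x + conv g h x"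
    by (simp add: * sum.distrib distrib_right)
  finally show "conv (\<lambda>x. f x + g x) h x = conv f h x + conv g h x" .
qed

definition delta :: "real \<Rightarrow> complex \<Rightarrow> real \<Rightarrow> complex" where
  "delta r c = (\<lambda>x. if x = r then c else 0)"

lemma left_finite_delta: "left_finite (delta r c)"
  by (auto simp: left_finite_def delta_def)

lemma conv_delta: "conv (delta r c) f x = c * f (x - r)"
proof -
  have "conv (delta r c) f x = (\<Sum>a\<in>{r}. delta r c a * f (x - a))"
    unfolding conv_def by (rule sum.mono_neutral_left) (auto simp: delta_def)
  then show ?thesis by (simp add: delta_def)
qed

text \<open>Known as the Novikov ring with real exponents and complex coefficients.\<close>

typedef nov = "{f. left_finite f}" morphisms coef Abs_nov
  using left_finite_zero by blast

lemma left_finite_coef [simp]: "left_finite (coef f)"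
  using coef[of f] by simp

lemma coef_Abs: "left_finite f \<Longrightarrow> coef (Abs_nov f) = f"
  by (simp add: Abs_nov_inverse)

instantiation nov :: comm_ring_1
begin
definition "0 = Abs_nov (\<lambda>_. 0)"
definition "1 = Abs_nov (delta 0 1)"
definition "f + g = Abs_nov (\<lambda>x. coef f x + coef g x)"
definition "- f = Abs_nov (\<lambda>x. - coef f x)"
definition "f - g = f + - (g::nov)"
definition "f * g = Abs_nov (conv (coef f) (coef g))"

lemma coef_simps [simp]:
  "coef 0 x = 0" "coef (f + g) x = coef f x + coef g x" "coef (- f) x = - coef f x"
  "coef (f - g) x = coef f x - coef g x"
  by (simp_all add: zero_nov_def plus_nov_def uminus_nov_def minus_nov_def coef_Abs
      left_finite_zero left_finite_add left_finite_uminus left_finite_add[OF _ left_finite_uminus, simplified])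

lemma coef_one: "coef 1 = delta 0 1"
  by (simp add: one_nov_def coef_Abs left_finite_delta)

lemma coef_mult: "coef (f * g) = conv (coef f) (coef g)"
  by (simp add: times_nov_def coef_Abs left_finite_conv)

lemma nov_eqI: "(\<And>x. coef f x = coef g x) \<Longrightarrow> f = g"
  by (metis coef_inject ext)

instance
proof
  fix a b c :: nov
  show "a * b * c = a * (b * c)"
    by (rule nov_eqI) (simp add: coef_mult conv_assoc)
  show "a * b = b * a"
    by (rule nov_eqI) (simp add: coef_mult conv_commute)
  show "1 * a = a"
    by (rule nov_eqI) (simp add: coef_mult coef_one conv_delta)
  have "coef (a + b) = (\<lambda>x. coef a x + coef b x)" by auto
  then show "(a + b) * c = a * c + b * c"
    by (intro nov_eqI) (simp add: coef_mult conv_add)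
  show "(0::nov) \<noteq> 1"
  proof
    assume "(0::nov) = 1"
    then have "coef 0 0 = coef 1 0" by simp
    then show False by (simp add: coef_one delta_def)
  qed
qed (rule nov_eqI, simp)+

end

lemma coef_sum [simp]: "coef (\<Sum>i\<in>A. f i) x = (\<Sum>i\<in>A. coef (f i) x)"
  by (induction A rule: infinite_finite_induct) auto

definition tmono :: "real \<Rightarrow> complex \<Rightarrow> nov" where
  "tmono r c = Abs_nov (delta r c)"

lemma coef_tmono: "coef (tmono r c) = delta r c"
  by (simp add: tmono_def coef_Abs left_finite_delta)

lemma coef_tmono_mult: "coef (tmono r c * f) x = c * coef f (x - r)"
  by (simp add: coef_mult coef_tmono conv_delta)

lemma tmono_mult: "tmono r c * tmono s d = tmono (r + s) (c * d)"
  by (rule nov_eqI) (auto simp: coef_tmono_mult coef_tmono delta_def)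

lemma tmono_0_1: "tmono 0 1 = 1"
  by (rule nov_eqI) (simp add: coef_tmono coef_one)

section \<open>Evaluation of Puiseux polynomials\<close>

lemma sum_fun_apply: "(\<Sum>i\<in>A. f i) x = (\<Sum>i\<in>A. f i x)"
  by (induction A rule: infinite_finite_induct) auto

section \<open>Closure properties and supports of Puiseux series\<close>

lemma puiseuxI:
  assumes "N > 0" "\<And>q. f q \<noteq> 0 \<Longrightarrow> \<exists>k::int. k \<ge> m \<and> q = of_int k / of_nat N"
  shows "f \<in> puiseux"
  unfolding puiseux_def using assms by blast

lemma puiseuxE:
  assumes "f \<in> puiseux"
  obtains N :: nat and m :: int where "N > 0"
    "\<And>q. f q \<noteq> 0 \<Longrightarrow> \<exists>k::int. k \<ge> m \<and> q = of_int k / of_nat N"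
  using assms unfolding puiseux_def by blast

lemma puiseux_common_denominator:
  assumes "f \<in> puiseux" "g \<in> puiseux"
  obtains N :: nat and m :: int where "N > 0"
    "\<And>q. f q \<noteq> 0 \<Longrightarrow> \<exists>k::int. k \<ge> m \<and> q = of_int k / of_nat N"
    "\<And>q. g q \<noteq> 0 \<Longrightarrow> \<exists>k::int. k \<ge> m \<and> q = of_int k / of_nat N"
proof -
  obtain N1 m1 where 1: "N1 > 0" "\<And>q. f q \<noteq> 0 \<Longrightarrow> \<exists>k::int. k \<ge> m1 \<and> q = of_int k / of_nat N1"
    using puiseuxE[OF assms(1)] by metis
  obtain N2 m2 where 2: "N2 > 0" "\<And>q. g q \<noteq> 0 \<Longrightarrow> \<exists>k::int. k \<ge> m2 \<and> q = of_int k / of_nat N2"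
    using puiseuxE[OF assms(2)] by metis
  define m where "m = min (m1 * int N2) (m2 * int N1)"
  show ?thesis
  proof (rule that[of "N1 * N2" m])
    show "N1 * N2 > 0" using 1 2 by simp
  next
    fix q assume "f q \<noteq> 0"
    then obtain k where k: "k \<ge> m1" "q = of_int k / of_nat N1" using 1(2) by blast
    have "k * int N2 \<ge> m" using k(1) by (simp add: m_def min_le_iff_disj mult_right_mono)
    moreover have "q = of_int (k * int N2) / of_nat (N1 * N2)" using k(2) 2(1) by simp
    ultimately show "\<exists>k::int. k \<ge> m \<and> q = of_int k / of_nat (N1 * N2)" by blast
  next
    fix q assume "g q \<noteq> 0"
    then obtain k where k: "k \<ge> m2" "q = of_int k / of_nat N2" using 2(2) by blast
    have "k * int N1 \<ge> m" using k(1) by (simp add: m_def min_le_iff_disj mult_right_mono)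
    moreover have "q = of_int (k * int N1) / of_nat (N1 * N2)" using k(2) 1(1) by simp
    ultimately show "\<exists>k::int. k \<ge> m \<and> q = of_int k / of_nat (N1 * N2)" by blast
  qed
qed

lemma puiseux_pconst: "pconst c \<in> puiseux"
  by (rule puiseuxI[of 1 _ 0]) (auto simp: pconst_def split: if_splits)

lemma puiseux_zero: "0 \<in> puiseux"
  by (rule puiseuxI[of 1 _ 0]) auto

lemma puiseux_add:
  assumes "f \<in> puiseux" "g \<in> puiseux" shows "f + g \<in> puiseux"
proof -
  obtain N m where "N > 0"
    "\<And>q. f q \<noteq> 0 \<Longrightarrow> \<exists>k::int. k \<ge> m \<and> q = of_int k / of_nat N"
    "\<And>q. g q \<noteq> 0 \<Longrightarrow> \<exists>k::int. k \<ge> m \<and> q = of_int k / of_nat N"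
    using puiseux_common_denominator[OF assms] by metis
  then show ?thesis by (intro puiseuxI[of N _ m]) (auto, metis add_0)
qed

lemma puiseux_sum: "(\<And>i. i \<in> A \<Longrightarrow> f i \<in> puiseux) \<Longrightarrow> (\<Sum>i\<in>A. f i) \<in> puiseux"
  by (induction A rule: infinite_finite_induct) (auto simp: puiseux_zero puiseux_add)

lemma puiseux_pmul:
  assumes "f \<in> puiseux" "g \<in> puiseux" shows "pmul f g \<in> puiseux"
proof -
  obtain N m where N: "N > 0"
    "\<And>q. f q \<noteq> 0 \<Longrightarrow> \<exists>k::int. k \<ge> m \<and> q = of_int k / of_nat N"
    "\<And>q. g q \<noteq> 0 \<Longrightarrow> \<exists>k::int. k \<ge> m \<and> q = of_int k / of_nat N"
    using puiseux_common_denominator[OF assms] by metis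
  show ?thesis
  proof (rule puiseuxI[of N _ "m + m"])
    fix q assume "pmul f g q \<noteq> 0"
    then have "\<exists>a. f a \<noteq> 0 \<and> g (q - a) \<noteq> 0"
      by (rule contrapos_np) (auto simp: pmul_def intro!: sum.neutral)
    then obtain a where a: "f a \<noteq> 0" "g (q - a) \<noteq> 0" by blast
    obtain k l where "k \<ge> m" "a = of_int k / of_nat N" "l \<ge> m" "q - a = of_int l / of_nat N"
      using N(2)[OF a(1)] N(3)[OF a(2)] by blast
    then have "k + l \<ge> m + m \<and> q = of_int (k + l) / of_nat N"
      by (simp add: add_divide_distrib algebra_simps)
    then show "\<exists>k::int. k \<ge> m + m \<and> q = of_int k / of_nat N" by blast
  qed (use N in simp)
qed

lemma puiseux_ppow: "f \<in> puiseux \<Longrightarrow> ppow f k \<in> puiseux"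
  by (induction k) (auto simp: puiseux_pconst puiseux_pmul)

lemma puiseux_finite_below:
  assumes "f \<in> puiseux" shows "finite {q. real_of_rat q \<le> c \<and> f q \<noteq> 0}"
proof -
  obtain N m where N: "N > 0" "\<And>q. f q \<noteq> 0 \<Longrightarrow> \<exists>k::int. k \<ge> m \<and> q = of_int k / of_nat N"
    using puiseuxE[OF assms] by metis
  have "{q. real_of_rat q \<le> c \<and> f q \<noteq> 0} \<subseteq> (\<lambda>k. of_int k / of_nat N) ` {m..\<lfloor>c * N\<rfloor>}"
  proof
    fix q assume "q \<in> {q. real_of_rat q \<le> c \<and> f q \<noteq> 0}"
    then have q: "real_of_rat q \<le> c" "f q \<noteq> 0" by auto
    then obtain k where k: "k \<ge> m" "q = of_int k / of_nat N" using N(2) by blast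
    have "real_of_rat q = of_int k / of_nat N"
      by (simp add: k(2) of_rat_divide)
    then have "of_int k / real N \<le> c" using q(1) by simp
    then have "of_int k \<le> c * N" using N(1) by (simp add: divide_le_eq)
    then have "k \<le> \<lfloor>c * N\<rfloor>" by (simp add: le_floor_iff)
    with k show "q \<in> (\<lambda>k. of_int k / of_nat N) ` {m..\<lfloor>c * N\<rfloor>}" by auto
  qed
  then show ?thesis by (rule finite_subset) simp
qed

section \<open>The embedding of Puiseux series into \<open>nov\<close>\<close>

definition rext :: "puis \<Rightarrow> real \<Rightarrow> complex" where
  "rext f x = (if x \<in> range real_of_rat then f (inv real_of_rat x) else 0)"

lemma inj_real_of_rat: "inj real_of_rat"
  by (simp add: inj_on_def)

lemma rext_of_rat [simp]: "rext f (real_of_rat q) = f q"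
  by (simp add: rext_def inv_f_f inj_real_of_rat)

lemma rext_nonzeroE:
  assumes "rext f x \<noteq> 0" obtains q where "x = real_of_rat q" "f q \<noteq> 0"
  using assms by (metis rext_def rext_of_rat rangeE)

lemma left_finite_rext:
  assumes "f \<in> puiseux" shows "left_finite (rext f)"
  unfolding left_finite_def
proof
  fix c
  have "{x. x \<le> c \<and> rext f x \<noteq> 0} \<subseteq> real_of_rat ` {q. real_of_rat q \<le> c \<and> f q \<noteq> 0}"
    by (auto elim!: rext_nonzeroE)
  then show "finite {x. x \<le> c \<and> rext f x \<noteq> 0}"
    by (rule finite_subset) (intro finite_imageI puiseux_finite_below assms)
qed

definition iota :: "puis \<Rightarrow> nov" where
  "iota f = Abs_nov (rext f)"

lemma coef_iota: "f \<in> puiseux \<Longrightarrow> coef (iota f) = rext f"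
  by (simp add: iota_def coef_Abs left_finite_rext)

lemma iota_pconst: "iota (pconst c) = tmono 0 c"
proof -
  have "rext (pconst c) = delta 0 c"
  proof
    fix x
    show "rext (pconst c) x = delta 0 c x"
    proof (cases "x \<in> range real_of_rat")
      case True
      then obtain q where "x = real_of_rat q" by blast
      then show ?thesis by (simp add: delta_def pconst_def)
    next
      case False
      then have "x \<noteq> 0" using rangeI[of real_of_rat 0] by auto
      with False show ?thesis by (simp add: delta_def rext_def)
    qed
  qed
  then show ?thesis by (simp add: iota_def tmono_def)
qed

lemma iota_zero [simp]: "iota 0 = 0"
  by (rule nov_eqI) (auto simp: coef_iota puiseux_zero rext_def)

lemma iota_eq_0_iff: "f \<in> puiseux \<Longrightarrow> iota f = 0 \<longleftrightarrow> f = 0"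
proof
  assume f: "f \<in> puiseux" "iota f = 0"
  have "f q = 0" for q
    using arg_cong[OF f(2), of "\<lambda>z. coef z (real_of_rat q)"] by (simp add: coef_iota f(1))
  then show "f = 0" by auto
qed simp

lemma iota_add: "f \<in> puiseux \<Longrightarrow> g \<in> puiseux \<Longrightarrow> iota (f + g) = iota f + iota g"
  by (rule nov_eqI) (auto simp: coef_iota puiseux_add rext_def)

lemma iota_sum: "(\<And>i. i \<in> A \<Longrightarrow> f i \<in> puiseux) \<Longrightarrow> iota (\<Sum>i\<in>A. f i) = (\<Sum>i\<in>A. iota (f i))"
  by (induction A rule: infinite_finite_induct) (auto simp: iota_add puiseux_sum)

text \<open>At a rational exponent the two convolutions agree term by term; at an irrational one the
  real convolution vanishes, as a sum of two rationals is rational.\<close>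

lemma iota_pmul:
  assumes "f \<in> puiseux" "g \<in> puiseux" shows "iota (pmul f g) = iota f * iota g"
proof (rule nov_eqI)
  fix x
  have "rext (pmul f g) x = conv (rext f) (rext g) x"
  proof (cases "x \<in> range real_of_rat")
    case True
    then obtain q where q: "x = real_of_rat q" by auto
    have "conv (rext f) (rext g) x = (\<Sum>a\<in>{a. f a \<noteq> 0 \<and> g (q - a) \<noteq> 0}. f a * g (q - a))"
      unfolding conv_def
    proof (rule sum.reindex_bij_witness[of _ real_of_rat "inv real_of_rat"])
      fix a assume "a \<in> {a. rext f a \<noteq> 0 \<and> rext g (x - a) \<noteq> 0}"
      then obtain b where b: "a = real_of_rat b" "f b \<noteq> 0" "rext g (x - a) \<noteq> 0" by (auto elim: rext_nonzeroE)
      have "x - a = real_of_rat (q - b)" by (simp add: b q of_rat_diff)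
      then show "real_of_rat (inv real_of_rat a) = a" "inv real_of_rat a \<in> {a. f a \<noteq> 0 \<and> g (q - a) \<noteq> 0}"
        "f (inv real_of_rat a) * g (q - inv real_of_rat a) = rext f a * rext g (x - a)"
        using b by (simp_all add: inv_f_f inj_real_of_rat)
    qed (auto simp: inv_f_f inj_real_of_rat q of_rat_diff[symmetric])
    then show ?thesis by (simp add: q pmul_def)
  next
    case False
    have "conv (rext f) (rext g) x = 0"
    proof (rule ccontr)
      assume "conv (rext f) (rext g) x \<noteq> 0"
      then obtain a where "rext f a \<noteq> 0" "rext g (x - a) \<noteq> 0" using conv_nonzeroD by blast
      then obtain b c where "a = real_of_rat b" "x - a = real_of_rat c" by (metis rext_nonzeroE)
      then have "x = real_of_rat (b + c)" by (simp add: of_rat_add)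
      with False show False by blast
    qed
    then show ?thesis using False by (simp add: rext_def)
  qed
  then show "coef (iota (pmul f g)) x = coef (iota f * iota g) x"
    by (simp add: coef_iota coef_mult puiseux_pmul assms)
qed

lemma iota_ppow: "f \<in> puiseux \<Longrightarrow> iota (ppow f k) = iota f ^ k"
  by (induction k) (auto simp: iota_pmul puiseux_ppow iota_pconst tmono_0_1)

section \<open>Evaluation of polynomials in \<open>nov\<close>\<close>

definition mon :: "nat \<Rightarrow> mono \<Rightarrow> (nat set \<Rightarrow> nov) \<Rightarrow> nov" where
  "mon n a W = (\<Prod>S\<in>Pow {1..n}. W S ^ a S)"

definition nov_eval :: "nat \<Rightarrow> kpoly \<Rightarrow> (nat set \<Rightarrow> nov) \<Rightarrow> nov" where
  "nov_eval n P W = (\<Sum>a\<in>{a. P a \<noteq> 0}. iota (P a) * mon n a W)"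

lemma subsets_list: "distinct (subsets_list n)" "set (subsets_list n) = Pow {1..n}"
proof -
  show "distinct (subsets_list n)"
    unfolding subsets_list_def by (rule distinct_set_subseqs) simp
  have "{1..<Suc n} = {1..n}" by auto
  then show "set (subsets_list n) = Pow {1..n}"
    by (simp add: subsets_list_def subseqs_powset del: upt_Suc)
qed

lemma mono_eval_puiseux: "(\<And>S. w S \<in> puiseux) \<Longrightarrow> mono_eval n a w \<in> puiseux"
proof -
  assume w: "\<And>S. w S \<in> puiseux"
  have "foldr (\<lambda>S acc. pmul (ppow (w S) (a S)) acc) xs (pconst 1) \<in> puiseux" for xs
    by (induction xs) (auto simp: puiseux_pconst puiseux_pmul puiseux_ppow w)
  then show ?thesis by (simp add: mono_eval_def)
qed

lemma iota_mono_eval: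
  assumes w: "\<And>S. w S \<in> puiseux"
  shows "iota (mono_eval n a w) = mon n a (\<lambda>S. iota (w S))"
proof -
  have pu: "foldr (\<lambda>S acc. pmul (ppow (w S) (a S)) acc) xs (pconst 1) \<in> puiseux" for xs
    by (induction xs) (auto simp: puiseux_pconst puiseux_pmul puiseux_ppow w)
  have "iota (foldr (\<lambda>S acc. pmul (ppow (w S) (a S)) acc) xs (pconst 1)) = (\<Prod>S\<leftarrow>xs. iota (w S) ^ a S)" for xs
    by (induction xs) (auto simp: iota_pconst tmono_0_1 iota_pmul puiseux_ppow w iota_ppow pu)
  then have "iota (mono_eval n a w) = (\<Prod>S\<leftarrow>subsets_list n. iota (w S) ^ a S)"
    by (simp add: mono_eval_def)
  also have "\<dots> = mon n a (\<lambda>S. iota (w S))"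
    unfolding mon_def subsets_list(2)[symmetric] by (rule prod.distinct_set_conv_list[OF subsets_list(1), symmetric])
  finally show ?thesis .
qed

lemma mon_add: "mon n (\<lambda>S. a S + b S) W = mon n a W * mon n b W"
  by (simp add: mon_def power_add prod.distrib)

lemma polysD:
  assumes "P \<in> polys n"
  shows "finite {a. P a \<noteq> 0}" "P a \<in> puiseux" "P a \<noteq> 0 \<Longrightarrow> a S \<noteq> 0 \<Longrightarrow> S \<subseteq> {1..n}"
  using assms by (auto simp: polys_def)

lemma polys_zero: "0 \<in> polys n"
  by (simp add: polys_def puiseux_zero)

lemma polys_add: "P \<in> polys n \<Longrightarrow> Q \<in> polys n \<Longrightarrow> P + Q \<in> polys n"
proof -
  assume P: "P \<in> polys n" and Q: "Q \<in> polys n"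
  have "{a. (P + Q) a \<noteq> 0} \<subseteq> {a. P a \<noteq> 0} \<union> {a. Q a \<noteq> 0}"
    by (auto simp del: plus_fun_apply) (metis add_0 plus_fun_apply)
  then have "finite {a. (P + Q) a \<noteq> 0}"
    by (rule finite_subset) (simp add: polysD(1)[OF P] polysD(1)[OF Q])
  moreover have "(P + Q) a \<in> puiseux" for a
    using P Q puiseux_add[of "P a" "Q a"] by (simp add: polysD(2) plus_fun_def)
  moreover have "S \<subseteq> {1..n}" if "(P + Q) a \<noteq> 0" "a S \<noteq> 0" for a S
  proof -
    have "P a \<noteq> 0 \<or> Q a \<noteq> 0" using that(1) by (metis add_0 plus_fun_apply)
    then show ?thesis using polysD(3)[OF P, of a S] polysD(3)[OF Q, of a S] that(2) by blast
  qed
  ultimately show ?thesis unfolding polys_def by blast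
qed

lemma polys_sum: "(\<And>i. i \<in> A \<Longrightarrow> P i \<in> polys n) \<Longrightarrow> (\<Sum>i\<in>A. P i) \<in> polys n"
  by (induction A rule: infinite_finite_induct) (simp_all add: polys_zero polys_add)

lemma nov_eval_superset:
  assumes "finite A" "\<And>a. P a \<noteq> 0 \<Longrightarrow> a \<in> A"
  shows "nov_eval n P W = (\<Sum>a\<in>A. iota (P a) * mon n a W)"
  unfolding nov_eval_def by (rule sum.mono_neutral_left) (use assms in auto)

lemma nov_eval_zero [simp]: "nov_eval n 0 W = 0"
  by (simp add: nov_eval_def)

lemma nov_eval_add:
  assumes "P \<in> polys n" "Q \<in> polys n"
  shows "nov_eval n (P + Q) W = nov_eval n P W + nov_eval n Q W"
proof -
  let ?A = "{a. P a \<noteq> 0} \<union> {a. Q a \<noteq> 0}"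
  have fin: "finite ?A" by (simp add: polysD(1)[OF assms(1)] polysD(1)[OF assms(2)])
  have "nov_eval n (P + Q) W = (\<Sum>a\<in>?A. iota (P a + Q a) * mon n a W)"
    by (subst nov_eval_superset[OF fin]) (auto simp: plus_fun_def)
  also have "\<dots> = (\<Sum>a\<in>?A. iota (P a) * mon n a W) + (\<Sum>a\<in>?A. iota (Q a) * mon n a W)"
    by (simp add: iota_add polysD(2)[OF assms(1)] polysD(2)[OF assms(2)] distrib_right sum.distrib)
  also have "\<dots> = nov_eval n P W + nov_eval n Q W"
    using fin by (simp add: nov_eval_superset[of ?A])
  finally show ?thesis .
qed

lemma nov_eval_sum:
  "(\<And>i. i \<in> A \<Longrightarrow> P i \<in> polys n) \<Longrightarrow> nov_eval n (\<Sum>i\<in>A. P i) W = (\<Sum>i\<in>A. nov_eval n (P i) W)"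
  by (induction A rule: infinite_finite_induct) (simp_all add: nov_eval_add polys_sum)

lemma pmult_support:
  assumes "pmult P Q c \<noteq> 0"
  obtains a b where "P a \<noteq> 0" "Q b \<noteq> 0" "c = (\<lambda>S. a S + b S)"
proof -
  let ?X = "{(a,b). P a \<noteq> 0 \<and> Q b \<noteq> 0 \<and> (\<forall>S. a S + b S = c S)}"
  have "pmult P Q c = 0" if "?X = {}"
    unfolding pmult_def that by (rule sum.empty)
  with assms obtain x where "x \<in> ?X" by blast
  then obtain a b where "P a \<noteq> 0" "Q b \<noteq> 0" "\<forall>S. a S + b S = c S" by blast
  then show ?thesis by (intro that[of a b]) auto
qed

lemma polys_pmult:
  assumes "P \<in> polys n" "Q \<in> polys n" shows "pmult P Q \<in> polys n"
proof -
  have "{c. pmult P Q c \<noteq> 0} \<subseteq> (\<lambda>(a, b) S. a S + b S) ` ({a. P a \<noteq> 0} \<times> {b. Q b \<noteq> 0})"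
    by (rule subsetI, drule CollectD, erule pmult_support) auto
  then have "finite {c. pmult P Q c \<noteq> 0}"
    by (rule finite_subset) (simp add: polysD(1)[OF assms(1)] polysD(1)[OF assms(2)])
  moreover have "pmult P Q c \<in> puiseux" for c
    unfolding pmult_def
    by (rule puiseux_sum) (auto intro: puiseux_pmul polysD(2)[OF assms(1)] polysD(2)[OF assms(2)])
  moreover have "S \<subseteq> {1..n}" if "pmult P Q c \<noteq> 0" "c S \<noteq> 0" for c S
  proof -
    from that(1) obtain a b where ab: "P a \<noteq> 0" "Q b \<noteq> 0" "c = (\<lambda>S. a S + b S)" by (rule pmult_support)
    then have "a S \<noteq> 0 \<or> b S \<noteq> 0" using that(2) by simp
    then show ?thesis using polysD(3)[OF assms(1) ab(1)] polysD(3)[OF assms(2) ab(2)] by blast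
  qed
  ultimately show ?thesis unfolding polys_def by blast
qed

text \<open>The product of the two evaluations is a sum over pairs of exponents; grouping the pairs
  by their sum gives the coefficients of \<open>pmult\<close>.\<close>

lemma nov_eval_pmult:
  assumes P: "P \<in> polys n" and Q: "Q \<in> polys n"
  shows "nov_eval n (pmult P Q) W = nov_eval n P W * nov_eval n Q W"
proof -
  let ?A = "{a. P a \<noteq> 0}" and ?B = "{b. Q b \<noteq> 0}"
  let ?h = "\<lambda>(a, b) S. a S + b S :: nat"
  let ?t = "\<lambda>(a, b). iota (P a) * iota (Q b) * mon n (?h (a, b)) W"
  have fin: "finite (?A \<times> ?B)" by (simp add: polysD(1)[OF P] polysD(1)[OF Q])
  have "nov_eval n P W * nov_eval n Q W = (\<Sum>x\<in>?A \<times> ?B. ?t x)"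
    unfolding nov_eval_def sum_product sum.cartesian_product
    by (rule sum.cong) (auto simp: mon_add mult_ac)
  also have "\<dots> = (\<Sum>c\<in>?h ` (?A \<times> ?B). \<Sum>x\<in>{x. x \<in> ?A \<times> ?B \<and> ?h x = c}. ?t x)"
    by (rule sum.image_gen[OF fin])
  also have "\<dots> = (\<Sum>c\<in>?h ` (?A \<times> ?B). iota (pmult P Q c) * mon n c W)"
  proof (rule sum.cong)
    fix c assume "c \<in> ?h ` (?A \<times> ?B)"
    have eq: "{x. x \<in> ?A \<times> ?B \<and> ?h x = c} = {(a,b). P a \<noteq> 0 \<and> Q b \<noteq> 0 \<and> (\<forall>S. a S + b S = c S)}"
      by auto
    have "iota (pmult P Q c) = (\<Sum>(a, b)\<in>{x. x \<in> ?A \<times> ?B \<and> ?h x = c}. iota (P a) * iota (Q b))"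
      unfolding pmult_def eq
      by (subst iota_sum) (auto simp: puiseux_pmul iota_pmul polysD(2)[OF P] polysD(2)[OF Q] intro!: sum.cong)
    then show "(\<Sum>x\<in>{x. x \<in> ?A \<times> ?B \<and> ?h x = c}. ?t x) = iota (pmult P Q c) * mon n c W"
      by (auto simp: sum_distrib_right intro!: sum.cong)
  qed simp
  also have "\<dots> = nov_eval n (pmult P Q) W"
  proof (rule nov_eval_superset[symmetric])
    show "c \<in> ?h ` (?A \<times> ?B)" if "pmult P Q c \<noteq> 0" for c
      by (rule pmult_support[OF that]) auto
  qed (use fin in simp)
  finally show ?thesis ..
qed

lemma iota_peval:
  assumes "P \<in> polys n" "\<And>S. w S \<in> puiseux"
  shows "iota (peval n P w) = nov_eval n P (\<lambda>S. iota (w S))" "peval n P w \<in> puiseux"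
  unfolding peval_def nov_eval_def
  by (subst iota_sum)
    (auto simp: puiseux_pmul puiseux_sum iota_pmul iota_mono_eval mono_eval_puiseux polysD(2)[OF assms(1)] assms(2))

section \<open>Wick relations\<close>

definition lt_count :: "nat \<Rightarrow> nat list \<Rightarrow> nat" where
  "lt_count x xs = length (filter (\<lambda>y. y < x) xs)"

lemma seq_sign_Nil: "seq_sign [] = 1"
  by (simp add: seq_sign_def)

text \<open>Inversions of \<open>x # xs\<close> either involve position 0, one for each smaller
  entry of \<open>xs\<close>, or are inversions of \<open>xs\<close> shifted by one.\<close>

lemma seq_sign_Cons: "seq_sign (x # xs) = (-1) ^ lt_count x xs * seq_sign xs"
proof -
  let ?A = "{k. k < length xs \<and> xs ! k < x}"
  let ?B = "{(i,j). i < j \<and> j < length xs \<and> xs ! i > xs ! j}"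
  have eq: "{(i,j). i < j \<and> j < length (x # xs) \<and> (x # xs) ! i > (x # xs) ! j}
     = (\<lambda>k. (0, Suc k)) ` ?A \<union> (\<lambda>(i, j). (Suc i, Suc j)) ` ?B" (is "?C = ?D")
  proof
    show "?C \<subseteq> ?D"
    proof
      fix p assume "p \<in> ?C"
      then obtain i j where p: "p = (i, Suc j)" "i < Suc j" "j < length xs" "(x # xs) ! i > xs ! j"
        by (auto elim: less_natE)
      show "p \<in> ?D" using p by (cases i) auto
    qed
  qed auto
  have finB: "finite ?B"
    by (rule finite_subset[of _ "{..<length xs} \<times> {..<length xs}"]) auto
  have "card ?C = card ?A + card ?B"
    unfolding eq using finB
    by (subst card_Un_disjoint) (auto simp: card_image inj_on_def)
  moreover have "card ?A = lt_count x xs"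
    by (simp add: lt_count_def length_filter_conv_card)
  ultimately show ?thesis by (simp add: seq_sign_def power_add)
qed

lemma seq_sign_cases: "seq_sign xs = 1 \<or> seq_sign xs = -1"
  by (simp add: seq_sign_def minus_one_power_iff)

lemma del_0 [simp]: "del 0 (x # xs) = xs"
  and del_Suc [simp]: "del (Suc j) (x # xs) = x # del j xs"
  by (simp_all add: del_def)

lemma mset_del: "j < length xs \<Longrightarrow> add_mset (xs ! j) (mset (del j xs)) = mset xs"
  unfolding del_def using id_take_nth_drop[of j xs]
  by (metis mset.simps(2) mset_append union_mset_add_mset_right)

lemma lt_count_del:
  "j < length xs \<Longrightarrow> lt_count x xs = lt_count x (del j xs) + (if xs ! j < x then 1 else 0)"
proof (induction xs arbitrary: j)
  case (Cons y ys)
  then show ?case by (cases j) (auto simp: lt_count_def)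
qed simp

text \<open>Strict inversions are counted, so for a repeated entry the sign also records how often
  it occurs before position \<open>j\<close>; this is what makes the Wick relation of a sequence with
  repetitions cancel.\<close>
lemma seq_sign_del:
  assumes "j < length xs"
  shows "(-1) ^ j * seq_sign (del j xs) =
    seq_sign xs * (-1) ^ (lt_count (xs ! j) xs + length (filter (\<lambda>y. y = xs ! j) (take j xs)))"
  using assms
proof (induction xs arbitrary: j)
  case (Cons x xs)
  show ?case
  proof (cases j)
    case 0
    have "lt_count x (x # xs) = lt_count x xs" by (simp add: lt_count_def)
    then show ?thesis by (simp add: 0 seq_sign_Cons mult.assoc[symmetric] flip: power_add)
  next
    case (Suc i)
    then have i: "i < length xs" using Cons.prems by simp
    let ?y = "xs ! i"
    let ?e = "length (filter (\<lambda>z. z = ?y) (take i xs))"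
    have "(-1) ^ j * seq_sign (del j (x # xs))
      = - ((-1) ^ lt_count x (del i xs)) * ((-1) ^ i * seq_sign (del i xs))"
      by (simp add: Suc seq_sign_Cons)
    also have "\<dots> = - ((-1) ^ lt_count x (del i xs)) * (seq_sign xs * (-1) ^ (lt_count ?y xs + ?e))"
      by (simp add: Cons.IH[OF i])
    also have "- ((-1) ^ lt_count x (del i xs)) = (-1) ^ lt_count x xs * (if x < ?y \<or> x = ?y then -1 else (1::int))"
      by (auto simp: lt_count_del[OF i])
    finally show ?thesis
      by (auto simp: Suc seq_sign_Cons lt_count_def)
  qed
qed simp

section \<open>Single terms and sequences with repeated entries\<close>

definition pterm :: "mono \<Rightarrow> int \<Rightarrow> kpoly" where
  "pterm m z = (\<lambda>a. if a = m then pconst (of_int z) else 0)"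

lemma pconst_zero [simp]: "pconst 0 = 0"
  by (auto simp: pconst_def)

lemma pconst_eq_0_iff [simp]: "pconst c = 0 \<longleftrightarrow> c = 0"
proof
  assume "pconst c = 0"
  then have "pconst c 0 = 0" by (simp del: zero_fun_apply add: zero_fun_def)
  then show "c = 0" by (simp add: pconst_def)
qed simp

lemma pconst_add: "pconst a + pconst b = pconst (a + b)"
  by (auto simp: pconst_def)

lemma pterm_zero [simp]: "pterm m 0 = 0"
  by (auto simp: pterm_def)

lemma pterm_add: "pterm m a + pterm m b = pterm m (a + b)"
  by (rule ext) (simp add: pterm_def pconst_add)

lemma mono2_commute: "mono2 A B = mono2 B A"
  by (auto simp: mono2_def)

lemma wterm_pterm:
  "wterm c \<rho> \<rho>' = (if distinct \<rho> \<and> distinct \<rho>'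
     then pterm (mono2 (set \<rho>) (set \<rho>')) (c * seq_sign \<rho> * seq_sign \<rho>') else 0)"
  by (simp add: wterm_def pterm_def)

lemma wterm_commute: "wterm c \<rho> \<rho>' = wterm c \<rho>' \<rho>"
  by (simp add: wterm_pterm mono2_commute mult_ac)

lemma wick_commute: "wick \<sigma> \<tau> = wick \<tau> \<sigma>"
  by (simp add: wick_def add.commute wterm_commute)

lemma not_distinct_del:
  assumes "a < b" "b < length xs" "xs ! a = xs ! b" "j \<noteq> a" "j \<noteq> b" "j < length xs"
  shows "\<not> distinct (del j xs)"
proof
  assume d: "distinct (del j xs)"
  let ?f = "\<lambda>i. if i < j then i else i - 1"
  have nth: "del j xs ! ?f i = xs ! i" if "i < length xs" "i \<noteq> j" for i
    using that assms(6) by (auto simp: del_def nth_append)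
  have len: "length (del j xs) = length xs - 1" using assms(6) by (simp add: del_def)
  have "?f a < length (del j xs)" "?f b < length (del j xs)" "?f a \<noteq> ?f b"
    using assms len by auto
  moreover have "del j xs ! ?f a = del j xs ! ?f b" using assms nth[of a] nth[of b] by simp
  ultimately show False using d nth_eq_iff_index_eq by blast
qed

text \<open>Let an entry of \<open>\<sigma>\<close> recur at positions \<open>a < b\<close>. The
  terms that prepend to \<open>\<sigma>\<close> vanish, and so do the deletions at other positions.
  The deletions at \<open>a\<close> and \<open>b\<close> give the same monomial with opposite
  signs.\<close>

lemma wick_not_distinct_left:
  assumes "\<not> distinct \<sigma>" shows "wick \<sigma> \<tau> = 0"
proof -
  obtain a b where ab: "a < b" "b < length \<sigma>" "\<sigma> ! a = \<sigma> ! b"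
    using assms by (metis distinct_conv_nth nat_neq_iff)
  let ?t = "\<lambda>j. wterm ((-1) ^ (j + 1)) (del j \<sigma>) ((\<sigma> ! j) # \<tau>)"
  have "(\<Sum>j<length \<sigma>. ?t j) = (\<Sum>j\<in>{a, b}. ?t j)"
    by (rule sum.mono_neutral_right) (use ab not_distinct_del[OF ab] in \<open>auto simp: wterm_pterm\<close>)
  also have "\<dots> = ?t a + ?t b" using ab by simp
  also have "\<dots> = 0"
  proof -
    have ms: "mset (del a \<sigma>) = mset (del b \<sigma>)"
      using mset_del[of a \<sigma>] mset_del[of b \<sigma>] ab by (metis add_mset_add_single add_right_cancel order.strict_trans)
    have st: "set (del a \<sigma>) = set (del b \<sigma>)" using ms by (metis set_mset_mset)
    have dd: "distinct (del a \<sigma>) = distinct (del b \<sigma>)" using ms by (metis mset_eq_imp_distinct_iff)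
    show ?thesis
    proof (cases "distinct (del b \<sigma>) \<and> distinct ((\<sigma> ! b) # \<tau>)")
      case True
      then have d: "distinct (take b \<sigma>)" by (simp add: del_def)
      \<comment> \<open>Before \<open>b\<close> the repeated entry occurs only at \<open>a\<close>,
        so the two signs given by \<open>seq_sign_del\<close> differ by exactly one factor
        \<open>-1\<close>.\<close>
      have tb: "take b \<sigma> = take a \<sigma> @ \<sigma> ! b # drop (Suc a) (take b \<sigma>)"
        using id_take_nth_drop[of a "take b \<sigma>"] ab by simp
      have "\<sigma> ! b \<notin> set (take a \<sigma>)" "\<sigma> ! b \<notin> set (drop (Suc a) (take b \<sigma>))"
        using d by (subst (asm) tb, auto)+
      then have e1: "filter (\<lambda>y. y = \<sigma> ! b) (take a \<sigma>) = []"
        and e2: "filter (\<lambda>y. y = \<sigma> ! b) (drop (Suc a) (take b \<sigma>)) = []"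
        by (auto simp: filter_empty_conv)
      have "filter (\<lambda>y. y = \<sigma> ! b) (take b \<sigma>) = [\<sigma> ! b]"
        by (subst tb) (simp add: e1 e2)
      note e = e1 this
      have "(-1) ^ a * seq_sign (del a \<sigma>) = - ((-1) ^ b * seq_sign (del b \<sigma>))"
        using seq_sign_del[of a \<sigma>] seq_sign_del[of b \<sigma>] ab e by simp
      then have "- ((-1) ^ a * seq_sign (del a \<sigma>) * seq_sign ((\<sigma> ! b) # \<tau>))
         - (-1) ^ b * seq_sign (del b \<sigma>) * seq_sign ((\<sigma> ! b) # \<tau>) = 0" by simp
      then show ?thesis using True ab by (simp add: wterm_pterm dd st pterm_add)
    qed (use ab dd in \<open>auto simp: wterm_pterm\<close>)
  qed
  finally have "(\<Sum>j<length \<sigma>. ?t j) = 0" .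
  moreover have "(\<Sum>i<length \<tau>. wterm ((-1) ^ (i + 1)) ((\<tau> ! i) # \<sigma>) (del i \<tau>)) = 0"
    using assms by (simp add: wterm_pterm)
  ultimately show ?thesis by (simp add: wick_def)
qed

lemma wick_not_distinct: "\<not> (distinct \<sigma> \<and> distinct \<tau>) \<Longrightarrow> wick \<sigma> \<tau> = 0"
  using wick_not_distinct_left wick_commute by metis

section \<open>Wick relations indexed by pairs of sets\<close>

lemma symd_simps:
  "x \<in> symd A B \<longleftrightarrow> (x \<in> A \<longleftrightarrow> x \<notin> B)"
  by (auto simp: symd_def)

lemma finite_symd [simp]: "finite A \<Longrightarrow> finite B \<Longrightarrow> finite (symd A B)"
  by (simp add: symd_def)

lemma card_split: "finite A \<Longrightarrow> card A = card (A - B) + card (A \<inter> B)"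
  by (subst card_Un_disjoint[symmetric]) (auto intro!: arg_cong[where f = card])

lemma card_symd_parity:
  assumes "finite A" "finite B" shows "even (card (symd A B)) \<longleftrightarrow> even (card A + card B)"
proof -
  have "card (symd A B) = card (A - B) + card (B - A)"
    unfolding symd_def by (rule card_Un_disjoint) (use assms in auto)
  moreover have "card A = card (A - B) + card (A \<inter> B)" "card B = card (B - A) + card (A \<inter> B)"
    using card_split[OF assms(1), of B] card_split[OF assms(2), of A] by (simp_all only: Int_commute)
  ultimately show ?thesis by presburger
qed

text \<open>Replaces the signs of sequences, up to a factor common to all terms of a relation. It
  depends on \<open>S\<close> and \<open>T\<close> only through \<open>symd S T\<close>, which makes
  the relations invariant under a common twist of both sets.\<close>

definition wick_coeff :: "nat set \<Rightarrow> nat set \<Rightarrow> nat \<Rightarrow> int" where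
  "wick_coeff S T i = (-1) ^ card {j \<in> symd S T. j < i}"

lemma lt_count_distinct: "distinct xs \<Longrightarrow> lt_count x xs = card {y \<in> set xs. y < x}"
  unfolding lt_count_def by (metis distinct_card distinct_filter set_filter)

lemma wick_coeff_lt_count:
  assumes "distinct \<sigma>" "distinct \<tau>"
  shows "wick_coeff (set \<sigma>) (set \<tau>) i = (-1) ^ (lt_count i \<sigma> + lt_count i \<tau>)"
proof -
  have "{j \<in> symd (set \<sigma>) (set \<tau>). j < i} = symd {j \<in> set \<sigma>. j < i} {j \<in> set \<tau>. j < i}"
    by (auto simp: symd_def)
  then show ?thesis
    using card_symd_parity[of "{j \<in> set \<sigma>. j < i}" "{j \<in> set \<tau>. j < i}"] assms
    by (simp add: wick_coeff_def lt_count_distinct minus_one_power_iff)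
qed

definition wick_poly :: "int \<Rightarrow> nat set \<Rightarrow> nat set \<Rightarrow> kpoly" where
  "wick_poly c S T = (\<Sum>i\<in>symd S T. pterm (mono2 (symd S {i}) (symd T {i})) (c * wick_coeff S T i))"

lemma set_del:
  assumes "distinct xs" "j < length xs" shows "set (del j xs) = set xs - {xs ! j}" "distinct (del j xs)"
proof -
  have xs: "xs = take j xs @ xs ! j # drop (Suc j) xs" using assms(2) by (rule id_take_nth_drop)
  have "distinct (take j xs @ xs ! j # drop (Suc j) xs)" using assms(1) xs by simp
  then show "distinct (del j xs)" "set (del j xs) = set xs - {xs ! j}"
    unfolding del_def by (auto simp: arg_cong[OF xs, of set])
qed

text \<open>Entries of \<open>\<tau>\<close> that also lie in \<open>\<sigma>\<close> create a
  repetition and drop out. For the others, moving \<open>i\<close> from \<open>\<tau>\<close> to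
  \<open>\<sigma>\<close> counts the smaller elements of both sequences; modulo 2 these are the
  smaller elements of the symmetric difference. The other half of the relation follows by exchanging
  the sequences.\<close>

lemma wick_half:
  assumes "distinct \<sigma>" "distinct \<tau>"
  shows "(\<Sum>i<length \<tau>. wterm ((-1) ^ (i + 1)) ((\<tau> ! i) # \<sigma>) (del i \<tau>)) =
    (\<Sum>i\<in>set \<tau> - set \<sigma>. pterm (mono2 (symd (set \<sigma>) {i}) (symd (set \<tau>) {i}))
        (- (seq_sign \<sigma> * seq_sign \<tau>) * wick_coeff (set \<sigma>) (set \<tau>) i))" (is "_ = (\<Sum>i\<in>_. ?g i)")
proof -
  have "(\<Sum>i<length \<tau>. wterm ((-1) ^ (i + 1)) ((\<tau> ! i) # \<sigma>) (del i \<tau>)) =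
    (\<Sum>i<length \<tau>. if \<tau> ! i \<in> set \<sigma> then 0 else ?g (\<tau> ! i))"
  proof (rule sum.cong)
    fix i assume "i \<in> {..<length \<tau>}"
    then have i: "i < length \<tau>" by simp
    show "wterm ((-1) ^ (i + 1)) ((\<tau> ! i) # \<sigma>) (del i \<tau>) = (if \<tau> ! i \<in> set \<sigma> then 0 else ?g (\<tau> ! i))"
    proof (cases "\<tau> ! i \<in> set \<sigma>")
      case False
      have "\<tau> ! i \<notin> set (take i \<tau>)"
        using i assms(2) by (metis distinct_take id_take_nth_drop not_distinct_conv_prefix)
      then have "filter (\<lambda>y. y = \<tau> ! i) (take i \<tau>) = []" by (auto simp: filter_empty_conv)
      with seq_sign_del[OF i] have "(-1) ^ i * seq_sign (del i \<tau>) = seq_sign \<tau> * (-1) ^ lt_count (\<tau> ! i) \<tau>"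
        by simp
      then have "(-1) ^ (i + 1) * seq_sign ((\<tau> ! i) # \<sigma>) * seq_sign (del i \<tau>) =
         - (seq_sign \<sigma> * seq_sign \<tau>) * wick_coeff (set \<sigma>) (set \<tau>) (\<tau> ! i)"
        by (simp add: wick_coeff_lt_count assms seq_sign_Cons power_add mult_ac)
      moreover have "set ((\<tau> ! i) # \<sigma>) = symd (set \<sigma>) {\<tau> ! i}" "set (del i \<tau>) = symd (set \<tau>) {\<tau> ! i}"
        using False i by (auto simp: symd_def set_del[OF assms(2) i])
      ultimately show ?thesis using False assms by (simp add: wterm_pterm set_del[OF assms(2) i])
    qed (simp add: wterm_pterm)
  qed simp
  also have "\<dots> = (\<Sum>i\<in>set \<tau>. if i \<in> set \<sigma> then 0 else ?g i)"
    by (rule sum.reindex_bij_betw) (use assms(2) in \<open>auto intro!: bij_betw_nth\<close>)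
  also have "\<dots> = (\<Sum>i\<in>set \<tau> - set \<sigma>. ?g i)"
    by (rule sum.mono_neutral_cong_right) auto
  finally show ?thesis .
qed

lemma wick_distinct:
  assumes "distinct \<sigma>" "distinct \<tau>"
  shows "wick \<sigma> \<tau> = wick_poly (- (seq_sign \<sigma> * seq_sign \<tau>)) (set \<sigma>) (set \<tau>)"
proof -
  have sym: "wick_coeff S T = wick_coeff T S" for S T
    by (auto simp: wick_coeff_def symd_def Un_commute)
  have eq: "symd (set \<sigma>) (set \<tau>) = (set \<tau> - set \<sigma>) \<union> (set \<sigma> - set \<tau>)" by (auto simp: symd_def)
  have "(\<Sum>j<length \<sigma>. wterm ((-1) ^ (j + 1)) (del j \<sigma>) ((\<sigma> ! j) # \<tau>)) =
     (\<Sum>i\<in>set \<sigma> - set \<tau>. pterm (mono2 (symd (set \<sigma>) {i}) (symd (set \<tau>) {i}))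
        (- (seq_sign \<sigma> * seq_sign \<tau>) * wick_coeff (set \<sigma>) (set \<tau>) i))"
    using wick_half[OF assms(2,1)] by (simp add: wterm_commute mono2_commute mult_ac sym)
  then show ?thesis
    unfolding wick_def wick_poly_def eq using wick_half[OF assms]
    by (subst sum.union_disjoint) auto
qed

lemma polys_pterm: "(\<And>S. m S \<noteq> 0 \<Longrightarrow> S \<subseteq> {1..n}) \<Longrightarrow> pterm m z \<in> polys n"
proof -
  assume m: "\<And>S. m S \<noteq> 0 \<Longrightarrow> S \<subseteq> {1..n}"
  have "finite {a. pterm m z a \<noteq> 0}" by (rule finite_subset[of _ "{m}"]) (auto simp: pterm_def)
  then show ?thesis using m by (auto simp: polys_def pterm_def puiseux_pconst puiseux_zero split: if_splits)
qed

lemma polys_pterm_mono2: "A \<subseteq> {1..n} \<Longrightarrow> B \<subseteq> {1..n} \<Longrightarrow> pterm (mono2 A B) z \<in> polys n"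
  by (rule polys_pterm) (auto simp: mono2_def split: if_splits)

lemma symd_subset: "S \<subseteq> U \<Longrightarrow> T \<subseteq> U \<Longrightarrow> symd S T \<subseteq> U"
  by (auto simp: symd_def)

lemma polys_wick_poly:
  assumes "S \<subseteq> {1..n}" "T \<subseteq> {1..n}" shows "wick_poly c S T \<in> polys n"
  unfolding wick_poly_def
  by (intro polys_sum polys_pterm_mono2 symd_subset assms) (use assms in \<open>auto simp: symd_def\<close>)

lemma wick_relsE:
  assumes "P \<in> wick_rels n"
  obtains "P = 0" | c S T where "S \<subseteq> {1..n}" "T \<subseteq> {1..n}" "P = wick_poly c S T"
proof -
  obtain \<sigma> \<tau> where st: "P = wick \<sigma> \<tau>" "set \<sigma> \<subseteq> {1..n}" "set \<tau> \<subseteq> {1..n}"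
    using assms by (auto simp: wick_rels_def)
  show ?thesis
  proof (cases "distinct \<sigma> \<and> distinct \<tau>")
    case True
    then show ?thesis using that(2)[of "set \<sigma>" "set \<tau>"] st wick_distinct[of \<sigma> \<tau>] by simp
  next
    case False
    then show ?thesis using st wick_not_distinct that(1) by blast
  qed
qed

lemma polys_wick_rels: "P \<in> wick_rels n \<Longrightarrow> P \<in> polys n"
  by (erule wick_relsE) (auto simp: polys_zero polys_wick_poly)

lemma gen_idealE:
  assumes "P \<in> gen_ideal n G"
  obtains k :: nat and C g where "P = (\<Sum>i<k. pmult (C i) (g i))" "\<And>i. i < k \<Longrightarrow> C i \<in> polys n"
    "\<And>i. i < k \<Longrightarrow> g i \<in> G"
  using assms unfolding gen_ideal_def by blast

lemma gen_ideal_polys: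
  assumes "P \<in> gen_ideal n (wick_rels n)" shows "P \<in> polys n"
  using assms by (rule gen_idealE) (auto intro!: polys_sum polys_pmult intro: polys_wick_rels)

lemma gen_ideal_nov_eval:
  assumes "P \<in> gen_ideal n (wick_rels n)" "\<And>g. g \<in> wick_rels n \<Longrightarrow> nov_eval n g W = 0"
  shows "nov_eval n P W = 0"
  using assms(1)
proof (rule gen_idealE)
  fix k :: nat and C g
  assume *: "P = (\<Sum>i<k. pmult (C i) (g i))" "\<And>i. i < k \<Longrightarrow> C i \<in> polys n"
    "\<And>i. i < k \<Longrightarrow> g i \<in> wick_rels n"
  then have "nov_eval n P W = (\<Sum>i<k. nov_eval n (C i) W * nov_eval n (g i) W)"
    by (subst *(1), subst nov_eval_sum)
      (auto simp: nov_eval_pmult polys_pmult polys_wick_rels intro!: sum.cong)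
  also have "\<dots> = 0" using * assms(2) by simp
  finally show ?thesis .
qed

text \<open>On arbitrary functions \<open>pmul\<close> is no ring multiplication, so vanishing is
  proved in \<open>nov\<close> and pulled back along \<open>iota\<close>, which is injective at 0 on
  Puiseux series.\<close>

lemma gen_ideal_vanishes_Spin_pm:
  assumes "P \<in> gen_ideal n (wick_rels n)" "w \<in> Spin_pm n"
  shows "peval n P w = 0"
proof -
  have w: "\<And>S. w S \<in> puiseux" using assms(2) by (simp add: Spin_pm_def)
  have "nov_eval n P (\<lambda>S. iota (w S)) = 0"
    using assms(1)
  proof (rule gen_ideal_nov_eval)
    fix g assume g: "g \<in> wick_rels n"
    then have "peval n g w = 0" using assms(2) by (simp add: Spin_pm_def)
    then show "nov_eval n g (\<lambda>S. iota (w S)) = 0"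
      using iota_peval(1)[OF polys_wick_rels[OF g], of w] w by simp
  qed
  then show ?thesis
    using iota_peval[OF gen_ideal_polys[OF assms(1)], of w] w by (simp add: iota_eq_0_iff)
qed

text \<open>Lets one polynomial of the Wick ideal exclude a vector from both \<open>TSpin_pm\<close>
  and \<open>TSpin_plus\<close>.\<close>

lemma gen_ideal_subset_vanish_ideal: "gen_ideal n (wick_rels n) \<subseteq> vanish_ideal n (Spin_plus n)"
  using gen_ideal_polys gen_ideal_vanishes_Spin_pm
  by (auto simp: vanish_ideal_def Spin_plus_def)

lemma tmono_0_of_int: "tmono 0 (of_int z) = of_int z"
proof -
  have nat: "tmono 0 (of_nat k) = of_nat k" for k
  proof (induction k)
    case 0 show ?case by (rule nov_eqI) (simp add: coef_tmono delta_def)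
  next
    case (Suc k)
    have "tmono 0 (of_nat (Suc k)) = tmono 0 1 + tmono 0 (of_nat k)"
      by (rule nov_eqI) (simp add: coef_tmono delta_def)
    then show ?case by (simp add: Suc tmono_0_1)
  qed
  have "tmono 0 (- of_nat k) = - tmono 0 (of_nat k)" for k
    by (rule nov_eqI) (simp add: coef_tmono delta_def)
  then show ?thesis using nat by (cases z rule: int_cases2) (simp_all)
qed

lemma nov_eval_pterm: "nov_eval n (pterm m z) W = of_int z * mon n m W"
  by (subst nov_eval_superset[of "{m}"]) (auto simp: pterm_def iota_pconst tmono_0_of_int)

lemma mon_mono2:
  assumes "A \<subseteq> {1..n}" "B \<subseteq> {1..n}" shows "mon n (mono2 A B) W = W A * W B"
proof -
  have "mon n (mono2 A B) W = (\<Prod>S\<in>Pow {1..n}. (if S = A then W S else 1) * (if S = B then W S else 1))"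
    unfolding mon_def by (rule prod.cong) (auto simp: mono2_def)
  also have "\<dots> = W A * W B" using assms by (simp add: prod.distrib)
  finally show ?thesis .
qed

section \<open>Lifts over \<open>nov\<close> and their valuations\<close>

definition set_wick :: "nat \<Rightarrow> (nat set \<Rightarrow> nov) \<Rightarrow> bool" where
  "set_wick n W \<longleftrightarrow> (\<forall>S T. S \<subseteq> {1..n} \<longrightarrow> T \<subseteq> {1..n} \<longrightarrow>
     (\<Sum>i\<in>symd S T. of_int (wick_coeff S T i) * (W (symd S {i}) * W (symd T {i}))) = 0)"

lemma nov_eval_wick_poly:
  assumes "S \<subseteq> {1..n}" "T \<subseteq> {1..n}"
  shows "nov_eval n (wick_poly c S T) W =
    of_int c * (\<Sum>i\<in>symd S T. of_int (wick_coeff S T i) * (W (symd S {i}) * W (symd T {i})))"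
proof -
  have sub: "symd S {i} \<subseteq> {1..n}" "symd T {i} \<subseteq> {1..n}" if "i \<in> symd S T" for i
    using that assms by (auto simp: symd_def)
  have "nov_eval n (wick_poly c S T) W =
      (\<Sum>i\<in>symd S T. nov_eval n (pterm (mono2 (symd S {i}) (symd T {i})) (c * wick_coeff S T i)) W)"
    unfolding wick_poly_def by (rule nov_eval_sum) (rule polys_pterm_mono2[OF sub])
  also have "\<dots> = (\<Sum>i\<in>symd S T. of_int c * (of_int (wick_coeff S T i) * (W (symd S {i}) * W (symd T {i}))))"
    by (rule sum.cong) (simp_all add: nov_eval_pterm mon_mono2[OF sub] mult.assoc del: One_nat_def)
  finally show ?thesis by (simp only: sum_distrib_left)
qed

lemma set_wick_nov_eval:
  assumes "set_wick n W" "P \<in> wick_rels n" shows "nov_eval n P W = 0"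
  using assms(2) by (rule wick_relsE) (use assms(1) in \<open>auto simp: nov_eval_wick_poly set_wick_def\<close>)

text \<open>A relation rather than a valuation function: lifts are built together with a prescribed
  valuation, and \<open>-\<infinity>\<close> is excluded by itself.\<close>

definition hasval :: "nov \<Rightarrow> ereal \<Rightarrow> bool" where
  "hasval f v \<longleftrightarrow> v = \<infinity> \<and> f = 0 \<or> (\<exists>r. v = ereal r \<and> coef f r \<noteq> 0 \<and> (\<forall>y<r. coef f y = 0))"

lemma hasval_infinity [simp]: "hasval f \<infinity> \<longleftrightarrow> f = 0"
  by (auto simp: hasval_def)

lemma hasval_ereal [simp]: "hasval f (ereal r) \<longleftrightarrow> coef f r \<noteq> 0 \<and> (\<forall>y<r. coef f y = 0)"
  by (auto simp: hasval_def)

lemma hasval_not_MInf [simp]: "\<not> hasval f (-\<infinity>)"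
  by (auto simp: hasval_def)

lemma coef_mult_lowest:
  assumes "\<forall>y<r. coef f y = 0" "\<forall>y<s. coef g y = 0"
  shows "coef (f * g) (r + s) = coef f r * coef g s" "\<forall>y<r + s. coef (f * g) y = 0"
proof -
  have ge: "r \<le> a" "s \<le> b" if "coef f a \<noteq> 0" "coef g b \<noteq> 0" for a b
    using that assms by (meson not_less)+
  have "coef (f * g) (r + s) = (\<Sum>a\<in>{r}. coef f a * coef g (r + s - a))"
    unfolding coef_mult conv_def by (rule sum.mono_neutral_left) (use ge in force)+
  then show "coef (f * g) (r + s) = coef f r * coef g s" by simp
  show "\<forall>y<r + s. coef (f * g) y = 0"
  proof (intro allI impI, rule ccontr)
    fix y assume "y < r + s" "coef (f * g) y \<noteq> 0"
    then obtain a where "coef f a \<noteq> 0" "coef g (y - a) \<noteq> 0"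
      using conv_nonzeroD[of "coef f" "coef g" y] by (auto simp: coef_mult)
    with ge[OF this] \<open>y < r + s\<close> show False by simp
  qed
qed

lemma hasval_mult:
  assumes "hasval f v" "hasval g w" shows "hasval (f * g) (v + w)"
proof (cases "v = \<infinity> \<or> w = \<infinity>")
  case True
  moreover have "v + w = \<infinity>" using calculation assms by (cases v; cases w) auto
  ultimately show ?thesis using assms by auto
next
  case False
  then obtain r s where "v = ereal r" "w = ereal s" using assms by (cases v; cases w) auto
  then show ?thesis using assms coef_mult_lowest[of r f s g] by simp
qed

lemma hasval_one: "hasval 1 0"
  unfolding zero_ereal_def by (simp add: coef_one delta_def)

text \<open>In \<open>ereal\<close>, \<open>0 * \<infinity> = 0\<close>, which matches
  \<open>f ^ 0 = 1\<close> for \<open>f = 0\<close>.\<close>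

lemma hasval_power: "hasval f v \<Longrightarrow> hasval (f ^ k) (ereal (of_nat k) * v)"
proof (induction k)
  case 0 show ?case by (simp add: hasval_one flip: zero_ereal_def)
next
  case (Suc k)
  have "ereal (of_nat (Suc k)) * v = v + ereal (of_nat k) * v"
    by (cases v) (auto simp: algebra_simps)
  then show ?case using hasval_mult[OF Suc.prems Suc.IH[OF Suc.prems]] by simp
qed

lemma hasval_prod:
  "(\<And>i. i \<in> A \<Longrightarrow> hasval (f i) (v i)) \<Longrightarrow> hasval (\<Prod>i\<in>A. f i) (\<Sum>i\<in>A. v i)"
  by (induction A rule: infinite_finite_induct) (auto simp: hasval_one hasval_mult)

text \<open>The rationals are not well-ordered, but the support below any of its points is finite,
  so the \<open>LEAST\<close> in \<open>val\<close> is attained.\<close>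

lemma hasval_iota:
  assumes "f \<in> puiseux" shows "hasval (iota f) (val f)"
proof (cases "f = 0")
  case True then show ?thesis by (simp add: val_def)
next
  case False
  then obtain q0 where q0: "f q0 \<noteq> 0" by (metis ext zero_fun_apply)
  let ?A = "{q. real_of_rat q \<le> real_of_rat q0 \<and> f q \<noteq> 0}"
  have fin: "finite ?A" by (rule puiseux_finite_below[OF assms])
  define m where "m = Min ?A"
  have mA: "m \<in> ?A" unfolding m_def by (rule Min_in) (use fin q0 in auto)
  have min: "m \<le> q" if "f q \<noteq> 0" for q
  proof (cases "q \<le> q0")
    case True
    then have "q \<in> ?A" using that by (simp add: of_rat_less_eq)
    then show ?thesis unfolding m_def using fin by (rule Min_le[rotated])
  next
    case False
    then show ?thesis using mA by (simp add: of_rat_less_eq)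
  qed
  have least: "(LEAST q. f q \<noteq> 0) = m"
    by (rule Least_equality) (use mA min in auto)
  have "rext f y = 0" if "y < real_of_rat m" for y
  proof (rule ccontr)
    assume "rext f y \<noteq> 0"
    then obtain q where "y = real_of_rat q" "f q \<noteq> 0" by (rule rext_nonzeroE)
    with min[of q] that show False by (simp add: of_rat_less)
  qed
  then show ?thesis using False mA by (simp add: val_def least coef_iota assms)
qed

text \<open>If a single term had the strictly smallest valuation \<open>r\<close>, its coefficient
  at \<open>r\<close> would survive in the sum. This is the easy half of the fundamental theorem of
  tropical geometry, over a larger ring.\<close>

lemma trop_hyp_of_lift:
  assumes P: "P \<in> polys n" and p: "p \<in> tvec n" and W: "\<And>S. S \<subseteq> {1..n} \<Longrightarrow> hasval (W S) (p S)"
    and zero: "nov_eval n P W = 0"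
  shows "p \<in> trop_hyp n P"
proof (rule ccontr)
  assume not: "p \<notin> trop_hyp n P"
  let ?A = "{a. P a \<noteq> 0}"
  let ?t = "trop_term n P p"
  let ?f = "\<lambda>a. iota (P a) * mon n a W"
  have val: "hasval (?f a) (?t a)" for a
    unfolding trop_term_def mon_def
    by (intro hasval_mult hasval_iota hasval_prod hasval_power W polysD(2)[OF P]) auto
  have fin: "finite ?A" by (rule polysD(1)[OF P])
  obtain a1 where a1: "P a1 \<noteq> 0" "?t a1 \<noteq> \<infinity>" using not p by (auto simp: trop_hyp_def)
  obtain a0 where a0: "a0 \<in> ?A" "\<And>a. a \<in> ?A \<Longrightarrow> ?t a0 \<le> ?t a"
    using ex_is_arg_min_if_finite[of ?A ?t] fin a1(1) unfolding is_arg_min_linorder by blast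
  have "?t a0 \<noteq> \<infinity>" using a0(2)[of a1] a1 by auto
  then obtain r where r: "?t a0 = ereal r" using val[of a0] by (cases "?t a0") auto
  have other: "coef (?f b) r = 0" if "b \<in> ?A" "b \<noteq> a0" for b
  proof -
    have "?t b \<noteq> ?t a0" using not p that a0 by (fastforce simp: trop_hyp_def)
    then have "ereal r < ?t b" using a0(2)[OF that(1)] r by simp
    then show ?thesis using val[of b] by (cases "?t b") auto
  qed
  have "coef (nov_eval n P W) r = (\<Sum>a\<in>?A. coef (?f a) r)"
    by (simp add: nov_eval_def)
  also have "\<dots> = coef (?f a0) r + (\<Sum>a\<in>?A - {a0}. coef (?f a) r)"
    by (rule sum.remove[OF fin a0(1)])
  also have "\<dots> = coef (?f a0) r" using other by simp
  finally show False using val[of a0] zero r by simp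
qed

lemma trop_var_of_lift:
  assumes "p \<in> tvec n" "\<And>S. S \<subseteq> {1..n} \<Longrightarrow> hasval (W S) (p S)" "set_wick n W"
  shows "p \<in> TSpin_pm n"
proof -
  have "p \<in> trop_hyp n P" if P: "P \<in> gen_ideal n (wick_rels n)" for P
    by (rule trop_hyp_of_lift[OF gen_ideal_polys[OF P] assms(1,2) gen_ideal_nov_eval[OF P]])
      (auto intro: set_wick_nov_eval assms(3))
  then show ?thesis using assms(1) by (simp add: TSpin_pm_def trop_var_def)
qed

section \<open>Tropical Wick vectors outside the tropical spinor variety\<close>

lemma pmul_pconst: "pmul (pconst c) f = (\<lambda>q. c * f q)"
proof
  fix q
  have "pmul (pconst c) f q = (\<Sum>a\<in>{0}. pconst c a * f (q - a))"
    unfolding pmul_def by (rule sum.mono_neutral_left) (auto simp: pconst_def)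
  then show "pmul (pconst c) f q = c * f q" by (simp add: pconst_def)
qed

lemma pmult_pterm:
  assumes "z \<noteq> 0"
  shows "pmult (pterm m z) P c =
    (if \<forall>S. m S \<le> c S then (\<lambda>q. of_int z * P (\<lambda>S. c S - m S) q) else 0)"
proof -
  let ?d = "\<lambda>S. c S - m S"
  have "pmult (pterm m z) P c = (\<Sum>(a, b)\<in>(if (\<forall>S. m S \<le> c S) \<and> P ?d \<noteq> 0 then {(m, ?d)} else {}). pmul (pterm m z a) (P b))"
    unfolding pmult_def
  proof (rule sum.cong)
    have "b = ?d" if "\<forall>S. m S + b S = c S" for b using that by (metis add_diff_cancel_left' ext)
    then show "{(a, b). pterm m z a \<noteq> 0 \<and> P b \<noteq> 0 \<and> (\<forall>S. a S + b S = c S)} =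
      (if (\<forall>S. m S \<le> c S) \<and> P ?d \<noteq> 0 then {(m, ?d)} else {})"
      using assms by (auto simp: pterm_def split: if_splits; metis le_add1)
  qed auto
  also have "\<dots> = (if \<forall>S. m S \<le> c S then (\<lambda>q. of_int z * P ?d q) else 0)"
    by (auto simp: pterm_def pmul_pconst)
  finally show ?thesis .
qed

lemma pmult_pterm_add: "z \<noteq> 0 \<Longrightarrow> pmult (pterm m z) (P + Q) = pmult (pterm m z) P + pmult (pterm m z) Q"
  by (rule ext, rule ext) (auto simp: pmult_pterm distrib_left)

lemma pmult_pterm_pterm:
  assumes "z \<noteq> 0" shows "pmult (pterm m z) (pterm m' z') = pterm (\<lambda>S. m S + m' S) (z * z')"
proof
  fix c
  have "(\<forall>S. m S \<le> c S) \<and> (\<lambda>S. c S - m S) = m' \<longleftrightarrow> c = (\<lambda>S. m S + m' S)"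
    by (auto simp: fun_eq_iff) (metis le_add_diff_inverse)
  then show "pmult (pterm m z) (pterm m' z') c = pterm (\<lambda>S. m S + m' S) (z * z') c"
    unfolding pmult_pterm[OF assms] by (auto simp: pterm_def pconst_def)
qed

lemma pmult_one: "pmult (pterm (\<lambda>_. 0) 1) P = P"
  by (rule ext) (simp add: pmult_pterm)

lemma wick_rels_subset_gen_ideal: "P \<in> wick_rels n \<Longrightarrow> P \<in> gen_ideal n (wick_rels n)"
proof -
  assume P: "P \<in> wick_rels n"
  have "P = (\<Sum>i<Suc 0. pmult ((\<lambda>_. pterm (\<lambda>_. 0) 1) i) ((\<lambda>_. P) i))" by (simp add: pmult_one)
  then show ?thesis
    unfolding gen_ideal_def using P
    by (intro CollectI exI[of _ "Suc 0"] exI[of _ "\<lambda>_. pterm (\<lambda>_. 0) 1"] exI[of _ "\<lambda>_. P"])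
      (auto intro: polys_pterm)
qed

lemma wick_poly_in_gen_ideal:
  assumes "S \<subseteq> {1..n}" "T \<subseteq> {1..n}"
  obtains c where "c \<noteq> 0" "wick_poly c S T \<in> gen_ideal n (wick_rels n)"
proof -
  have fin: "finite S" "finite T" using assms finite_subset by blast+
  let ?s = "sorted_list_of_set S" and ?t = "sorted_list_of_set T"
  have "wick ?s ?t = wick_poly (- (seq_sign ?s * seq_sign ?t)) S T"
    using wick_distinct[of ?s ?t] fin by simp
  moreover have "wick ?s ?t \<in> wick_rels n"
    unfolding wick_rels_def using assms fin by (intro CollectI exI[of _ ?s] exI[of _ ?t]) simp
  moreover have "- (seq_sign ?s * seq_sign ?t) \<noteq> 0"
    using seq_sign_cases[of ?s] seq_sign_cases[of ?t] by auto
  ultimately show ?thesis using that wick_rels_subset_gen_ideal by metis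
qed

lemma val_pconst: "val (pconst c) = (if c = 0 then \<infinity> else 0)"
proof (cases "c = 0")
  case False
  have "(LEAST q. pconst c q \<noteq> 0) = 0"
    by (rule Least_equality) (use False in \<open>auto simp: pconst_def split: if_splits\<close>)
  then show ?thesis using False by (simp add: val_def zero_ereal_def)
qed (simp add: val_def)

section \<open>Tropical values of monomials\<close>

definition trop_mon :: "nat \<Rightarrow> (nat set \<Rightarrow> ereal) \<Rightarrow> mono \<Rightarrow> ereal" where
  "trop_mon n p a = (\<Sum>S\<in>Pow {1..n}. ereal (of_nat (a S)) * p S)"

lemma trop_term_trop_mon: "trop_term n P p a = val (P a) + trop_mon n p a"
  by (simp add: trop_term_def trop_mon_def)

lemma trop_mon_add: "trop_mon n p (\<lambda>S. a S + b S) = trop_mon n p a + trop_mon n p b"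
  by (simp add: trop_mon_def sum.distrib[symmetric] ereal_left_distrib flip: plus_ereal.simps(1))

definition mono1 :: "nat set \<Rightarrow> mono" where
  "mono1 A = (\<lambda>S. if S = A then 1 else 0)"

lemma trop_mon_mono1: "A \<subseteq> {1..n} \<Longrightarrow> trop_mon n p (mono1 A) = p A"
proof -
  assume A: "A \<subseteq> {1..n}"
  have "trop_mon n p (mono1 A) = (\<Sum>S\<in>Pow {1..n}. if S = A then p A else 0)"
    unfolding trop_mon_def by (rule sum.cong) (auto simp: mono1_def zero_ereal_def[symmetric] one_ereal_def[symmetric])
  then show ?thesis using A by simp
qed

lemma mono2_mono1: "mono2 A B = (\<lambda>S. mono1 A S + mono1 B S)"
  by (simp add: mono1_def mono2_def)

lemma mono1_eq_iff: "mono1 A = mono1 B \<longleftrightarrow> A = B"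
  by (metis mono1_def zero_neq_one)

lemma mono2_cancel: "mono2 A B = mono2 A D \<Longrightarrow> B = D"
  by (simp add: mono2_mono1 fun_eq_iff flip: mono1_eq_iff)

lemma mono2_eq_iff: "mono2 A B = mono2 C D \<longleftrightarrow> (A = C \<and> B = D) \<or> (A = D \<and> B = C)"
proof
  assume eq: "mono2 A B = mono2 C D"
  have "mono2 A B A \<noteq> 0" by (simp add: mono2_def)
  then have "A = C \<or> A = D" unfolding eq by (auto simp: mono2_def split: if_splits)
  then show "(A = C \<and> B = D) \<or> (A = D \<and> B = C)"
  proof
    assume "A = C"
    then show ?thesis using eq mono2_cancel[of A B D] by simp
  next
    assume "A = D"
    then show ?thesis using eq mono2_cancel[of A B C] mono2_commute[of C D] by simp
  qed
qed (auto simp: mono2_commute)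

lemma trop_mon_mono2:
  "A \<subseteq> {1..n} \<Longrightarrow> B \<subseteq> {1..n} \<Longrightarrow> trop_mon n p (mono2 A B) = p A + p B"
  by (simp only: mono2_mono1 trop_mon_add trop_mon_mono1)

lemma wick_coeff_nonzero [simp]: "wick_coeff S T i \<noteq> 0"
  by (simp add: wick_coeff_def)

lemma symd_cancel: "symd S {i} = symd S {j} \<Longrightarrow> i = j"
  by (auto simp: symd_def set_eq_iff; metis)

text \<open>Two indices of a Wick relation can share a monomial only in this way, because
  \<open>symd S {i} = symd S {j}\<close> forces \<open>i = j\<close>.\<close>

lemma symd_swap: "symd S {i} = symd T {j} \<Longrightarrow> i \<noteq> j \<Longrightarrow> symd S T = {i, j}"
  by (auto simp: symd_def set_eq_iff; metis)

lemma TSpin_pm_subset_DDr: "TSpin_pm n \<subseteq> DDr n"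
proof
  fix p assume p: "p \<in> TSpin_pm n"
  then have tv: "p \<in> tvec n" by (simp add: TSpin_pm_def trop_var_def)
  show "p \<in> DDr n"
    unfolding DDr_def
  proof (intro CollectI conjI allI impI tv)
    fix S T assume S: "S \<subseteq> {1..n}" and T: "T \<subseteq> {1..n}"
    let ?D = "symd S T" and ?f = "\<lambda>i. p (symd S {i}) + p (symd T {i})"
    let ?m = "\<lambda>i. mono2 (symd S {i}) (symd T {i})"
    have finD: "finite ?D" using S T finite_subset[of _ "{1..n}"] by simp
    show "min_twice ?f ?D"
    proof (cases "\<exists>i\<in>?D. \<exists>j\<in>?D. i \<noteq> j \<and> symd S {i} = symd T {j}")
      case True
      then obtain i j where ij: "i \<in> ?D" "j \<in> ?D" "i \<noteq> j" "symd S {i} = symd T {j}" by blast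
      then have D: "?D = {i, j}" using symd_swap by blast
      moreover have "symd S {j} = symd T {i}" using ij(4) by (auto simp: symd_def set_eq_iff; metis)
      ultimately have "?f i = ?f j" using ij(4) by (simp add: add.commute)
      then show ?thesis using ij(3) by (auto simp: min_twice_def D)
    next
      case False
      then have inj: "i = j" if "i \<in> ?D" "j \<in> ?D" "?m i = ?m j" for i j
        using that by (auto simp: mono2_eq_iff dest: symd_cancel)
      obtain c where c: "c \<noteq> 0" "wick_poly c S T \<in> gen_ideal n (wick_rels n)"
        using wick_poly_in_gen_ideal[OF S T] .
      let ?P = "wick_poly c S T"
      have x: "p \<in> trop_hyp n ?P" using p c(2) by (simp add: TSpin_pm_def trop_var_def)
      have P1: "?P (?m i) = pconst (of_int (c * wick_coeff S T i))" if "i \<in> ?D" for i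
      proof -
        have "?P (?m i) = (\<Sum>j\<in>?D. if j = i then pconst (of_int (c * wick_coeff S T i)) else 0)"
          unfolding wick_poly_def
          by (subst sum_fun_apply, rule sum.cong) (use inj that in \<open>auto simp: pterm_def\<close>)
        then show ?thesis using that finD by simp
      qed
      have P2: "\<exists>i\<in>?D. a = ?m i" if "?P a \<noteq> 0" for a
      proof (rule ccontr)
        assume "\<not> (\<exists>i\<in>?D. a = ?m i)"
        then have "?P a = 0"
          unfolding wick_poly_def by (subst sum_fun_apply) (auto simp: pterm_def intro!: sum.neutral)
        with that show False by simp
      qed
      have nz: "?P (?m i) \<noteq> 0" if "i \<in> ?D" for i using P1[OF that] c(1) by simp
      have tt: "trop_term n ?P p (?m i) = ?f i" if "i \<in> ?D" for i
      proof -
        have sub: "symd S {i} \<subseteq> {1..n}" "symd T {i} \<subseteq> {1..n}"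
          using that S T by (auto simp: symd_def)
        have "trop_term n ?P p (?m i) = val (?P (?m i)) + trop_mon n p (?m i)"
          by (rule trop_term_trop_mon)
        then show ?thesis
          using c(1) by (simp add: P1[OF that] val_pconst trop_mon_mono2[OF sub])
      qed
      from x consider "\<forall>a. ?P a \<noteq> 0 \<longrightarrow> trop_term n ?P p a = \<infinity>"
        | a b where "a \<noteq> b" "?P a \<noteq> 0" "?P b \<noteq> 0" "trop_term n ?P p a = trop_term n ?P p b"
          "\<forall>c. ?P c \<noteq> 0 \<longrightarrow> trop_term n ?P p a \<le> trop_term n ?P p c"
        unfolding trop_hyp_def by blast
      then show ?thesis
      proof cases
        case 1
        then show ?thesis using nz tt by (auto simp: min_twice_def)
      next
        case 2
        obtain i j where "i \<in> ?D" "j \<in> ?D" "a = ?m i" "b = ?m j"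
          using P2[OF 2(2)] P2[OF 2(3)] by blast
        moreover from this 2 have "i \<noteq> j" "?f i = ?f j" "\<forall>k\<in>?D. ?f i \<le> ?f k"
          using tt nz by metis+
        ultimately show ?thesis unfolding min_twice_def by blast
      qed
    qed
  qed
qed

section \<open>Tropical Wick vectors of sparse paving type\<close>

lemma symd_card_in: "i \<in> S \<Longrightarrow> finite S \<Longrightarrow> card (symd S {i}) = card S - 1"
  and symd_card_notin: "i \<notin> S \<Longrightarrow> finite S \<Longrightarrow> card (symd S {i}) = card S + 1"
proof -
  show "i \<in> S \<Longrightarrow> finite S \<Longrightarrow> card (symd S {i}) = card S - 1"
    by (subgoal_tac "symd S {i} = S - {i}") (auto simp: symd_def)
  show "i \<notin> S \<Longrightarrow> finite S \<Longrightarrow> card (symd S {i}) = card S + 1"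
    by (subgoal_tac "symd S {i} = insert i S") (auto simp: symd_def)
qed

lemma min_twice_sym: "min_twice (\<lambda>i. p (symd S {i}) + p (symd T {i})) (symd S T) =
  min_twice (\<lambda>i. p (symd T {i}) + p (symd S {i})) (symd T S)"
proof -
  have "symd S T = symd T S" by (auto simp: symd_def)
  then show ?thesis by (simp add: add.commute)
qed

lemma two_elements:
  assumes "2 \<le> card A" obtains i j where "i \<in> A" "j \<in> A" "i \<noteq> j"
proof -
  have "finite A" using assms by (metis card.infinite not_numeral_le_zero)
  have "\<not> card A \<le> Suc 0" using assms by simp
  then show ?thesis using that \<open>finite A\<close> by (metis card_le_Suc0_iff_eq)
qed

text \<open>Modelled on sparse paving matroids: the square vanishes exactly on sets of size 4 and is
  at least 1 on the other even sizes; members of \<open>B\<close> are raised by 1. All even subsets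
  keep a finite value, so the support is full.\<close>

definition paving :: "nat \<Rightarrow> nat set set \<Rightarrow> nat set \<Rightarrow> ereal" where
  "paving n B S = (if S \<subseteq> {1..n} \<and> even (card S)
     then ereal ((real (card S) / 2 - 2)\<^sup>2 + (if S \<in> B then 1 else 0)) else \<infinity>)"

text \<open>The convex term \<open>(|S|/2 - 2)\<^sup>2\<close> makes exchanges that move the cardinalities of \<open>S\<close> and \<open>T\<close>
  apart too expensive to matter; what remains is the sparse paving condition on \<open>B\<close>.\<close>
lemma paving_in_DDr:
  assumes B: "\<And>X. X \<in> B \<Longrightarrow> card X = 4"
    and BB: "\<And>X Y. X \<in> B \<Longrightarrow> Y \<in> B \<Longrightarrow> X \<noteq> Y \<Longrightarrow> card (X \<inter> Y) \<le> 2"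
  shows "paving n B \<in> DDr n"
proof -
  let ?p = "paving n B"
  have tv: "?p \<in> tvec n" by (auto simp: tvec_def paving_def)
  \<comment> \<open>\<open>symd S {i}\<close> and \<open>symd S {j}\<close> differ in exactly
    \<open>i\<close> and \<open>j\<close>, so as two 4-sets they would share three elements.\<close>
  have uniq: "i = j" if "finite S" "symd S {i} \<in> B" "symd S {j} \<in> B" for S i j
  proof (rule ccontr)
    assume ne: "i \<noteq> j"
    let ?X = "symd S {i}" and ?Y = "symd S {j}"
    have fin: "finite ?X" "finite ?Y" using that(1) by simp_all
    have "symd ?X ?Y = {i, j}" using ne by (auto simp: symd_def)
    then have "card ((?X - ?Y) \<union> (?Y - ?X)) = 2" using ne by (simp add: symd_def)
    moreover have "card ((?X - ?Y) \<union> (?Y - ?X)) = card (?X - ?Y) + card (?Y - ?X)"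
      by (rule card_Un_disjoint) (use fin in auto)
    moreover note card_split[OF fin(1), of ?Y] card_split[OF fin(2), of ?X]
    moreover have "card (?X \<inter> ?Y) \<le> 2" using BB[OF that(2,3)] ne symd_cancel[of S i j] by blast
    ultimately show False using B[OF that(2)] B[OF that(3)] by (simp add: Int_commute)
  qed
  have main: "min_twice (\<lambda>i. ?p (symd S {i}) + ?p (symd T {i})) (symd S T)"
    if S: "S \<subseteq> {1..n}" and T: "T \<subseteq> {1..n}" and le: "card S \<le> card T" for S T
  proof -
    let ?D = "symd S T" and ?f = "\<lambda>i. ?p (symd S {i}) + ?p (symd T {i})"
    have fin: "finite S" "finite T" using S T finite_subset by blast+
    have sub: "symd S {i} \<subseteq> {1..n}" "symd T {i} \<subseteq> {1..n}" if "i \<in> ?D" for i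
      using that S T by (auto simp: symd_def)
    have par: "even (card (symd S {i})) \<longleftrightarrow> odd (card S)" "even (card (symd T {i})) \<longleftrightarrow> odd (card T)" for i
      using card_symd_parity[of S "{i}"] card_symd_parity[of T "{i}"] fin by auto
    show ?thesis
    proof (cases "odd (card S) \<and> odd (card T)")
      case False
      then have "?f i = \<infinity>" for i using par by (auto simp: paving_def)
      then show ?thesis by (simp add: min_twice_def)
    next
      case True
      then have oS: "odd (card S)" and oT: "odd (card T)" by auto
      define b where "b X = (if X \<in> B then 1 else 0 :: real)" for X
      define g where "g k = (real k / 2 - 2)\<^sup>2" for k :: nat
      define h where "h i = g (card (symd S {i})) + g (card (symd T {i})) + b (symd S {i}) + b (symd T {i})" for i
      have f: "?f i = ereal (h i)" if "i \<in> ?D" for i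
        using sub[OF that] par oS oT by (simp add: paving_def h_def g_def b_def)
      have b0: "b X \<ge> 0" for X by (simp add: b_def)
      \<comment> \<open>\<open>E\<close> collects exchanges with base value \<open>c\<close>: those
        that move an element from \<open>T\<close> to \<open>S\<close>, and all of them if the sizes
        agree. \<open>N\<close> consists of those raised by \<open>B\<close>.\<close>
      define c where "c = g (card S + 1) + g (card T - 1)"
      define E where "E = (if card S = card T then ?D else T - S)"
      define N where "N = {i \<in> E. symd S {i} \<in> B \<or> symd T {i} \<in> B}"
      have ED: "E \<subseteq> ?D" by (auto simp: E_def symd_def)
      have finE: "finite E" using fin by (auto simp: E_def)
      have S1: "card S \<ge> 1" "card T \<ge> 1" using oS oT by (auto simp: Suc_le_eq intro: Nat.gr0I)
      have hE: "h i = c + b (symd S {i}) + b (symd T {i})" if "i \<in> E" for i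
      proof (cases "i \<in> T")
        case True
        then have "i \<notin> S" using that ED by (auto simp: symd_def)
        then show ?thesis using True fin by (simp add: h_def c_def symd_card_in symd_card_notin)
      next
        case False
        then have "i \<in> S" "card S = card T" using that ED by (auto simp: symd_def E_def split: if_splits)
        then show ?thesis using False fin by (simp add: h_def c_def symd_card_in symd_card_notin)
      qed
      have hD: "h i \<ge> c" if "i \<in> ?D" for i
      proof (cases "i \<in> E")
        case True then show ?thesis using hE b0 by (simp add: add_nonneg_nonneg add.assoc)
      next
        case False
        then have i: "i \<in> S" "i \<notin> T" "card S \<noteq> card T" using that by (auto simp: E_def symd_def split: if_splits)
        have "h i \<ge> g (card S - 1) + g (card T + 1)"
          using i fin b0 by (simp add: h_def symd_card_in symd_card_notin add_nonneg_nonneg add.assoc)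
        \<comment> \<open>\<open>g\<close> is quadratic, so the difference to \<open>c\<close> is
          linear; it is nonnegative since \<open>card S \<le> card T\<close>.\<close>
        also have "g (card S - 1) + g (card T + 1) = c + (real (card T) - real (card S))"
          using S1 by (simp add: g_def c_def of_nat_diff power2_eq_square field_simps)
        finally show ?thesis using le by simp
      qed
      have goodE: "h i = c" if "i \<in> E - N" for i
        using that hE by (auto simp: N_def b_def)
      have N12: "N \<subseteq> {i \<in> E. symd S {i} \<in> B} \<union> {i \<in> E. symd T {i} \<in> B}" by (auto simp: N_def)
      have le1: "card {i \<in> E. symd S {i} \<in> B} \<le> Suc 0" "card {i \<in> E. symd T {i} \<in> B} \<le> Suc 0"
        using uniq fin finE by (auto simp: card_le_Suc0_iff_eq)
      have finN: "finite N" using finE by (simp add: N_def)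
      have cardN: "card N \<le> 2"
      proof -
        have "card N \<le> card ({i \<in> E. symd S {i} \<in> B} \<union> {i \<in> E. symd T {i} \<in> B})"
          using N12 finE by (intro card_mono) auto
        also have "\<dots> \<le> 2" using card_Un_le[of "{i \<in> E. symd S {i} \<in> B}" "{i \<in> E. symd T {i} \<in> B}"] le1 by simp
        finally show ?thesis .
      qed
      have evenD: "even (card ?D)" using card_symd_parity[OF fin] oS oT by simp
      have cTS: "card (T - S) + card S = card (S - T) + card T"
      proof -
        show ?thesis using card_split[OF fin(1), of T] card_split[OF fin(2), of S]
          by (simp add: Int_commute)
      qed
      have cD: "card ?D = card (S - T) + card (T - S)"
        unfolding symd_def by (rule card_Un_disjoint) (use fin in auto)
      have evs: "even (card S + card T)" using oS oT by simp
      consider "?D = {}" | "card ?D = 2" | "2 \<le> card (E - N)"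
      proof (cases "card ?D \<le> 2")
        case True
        then have "card ?D = 0 \<or> card ?D = 2" using evenD by presburger
        then show ?thesis using that fin by auto
      next
        case big: False
        show ?thesis
        proof (cases "card E \<ge> 4")
          case True
          then have "2 \<le> card (E - N)" using diff_card_le_card_Diff[OF finN, of E] cardN by simp
          then show ?thesis by (rule that(3))
        next
          case False
          have ne: "card S \<noteq> card T"
          proof
            assume "card S = card T"
            then have "card ?D < 4" using False by (simp add: E_def)
            with big evenD have "card ?D = 3" "even (card ?D)" by simp_all
            then show False by simp
          qed
          then have E: "E = T - S" by (simp add: E_def)
          \<comment> \<open>The sizes of \<open>S\<close> and \<open>T\<close> differ by an even
            number, \<open>card ?D\<close> is even and at least 4, and \<open>card (T - S)\<close>
            is at most 3; only one case remains.\<close>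
          have "card T = card S + 2" "card (S - T) = 1" "card (T - S) = 3"
            using False big cTS cD ne le evs unfolding E by presburger+
          note three = this
          \<comment> \<open>By \<open>uniq\<close>, two raised exchanges would consist of one with
            \<open>symd S {i}\<close> in \<open>B\<close> and one with \<open>symd T {j}\<close> in
            \<open>B\<close>. The element of \<open>S - T\<close> separates these 4-sets, yet they
            share \<open>i\<close> and the two elements of \<open>S \<inter> T\<close>.\<close>
          have "card N \<le> Suc 0"
          proof (rule ccontr)
            assume "\<not> card N \<le> Suc 0"
            then have "2 \<le> card N" by simp
            then obtain i j where ij: "i \<in> N" "j \<in> N" "i \<noteq> j" by (rule two_elements)
            have "\<exists>i j. i \<in> T - S \<and> j \<in> T - S \<and> i \<noteq> j \<and> symd S {i} \<in> B \<and> symd T {j} \<in> B"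
              using ij uniq[of S i j] uniq[of T i j] fin by (auto simp: N_def E)
            then obtain i j where ij: "i \<in> T - S" "j \<in> T - S" "i \<noteq> j" "symd S {i} \<in> B" "symd T {j} \<in> B" by blast
            obtain x where x: "S - T = {x}" using three(2) by (auto simp: card_1_singleton_iff)
            have "x \<in> symd S {i}" "x \<notin> symd T {j}" using x ij by (auto simp: symd_def)
            then have "card (symd S {i} \<inter> symd T {j}) \<le> 2" using BB[OF ij(4,5)] by blast
            moreover have "card (insert i (S \<inter> T)) \<le> card (symd S {i} \<inter> symd T {j})"
              by (rule card_mono) (use ij fin in \<open>auto simp: symd_def\<close>)
            moreover have "card (insert i (S \<inter> T)) = 1 + card (S \<inter> T)" using ij fin by simp
            moreover note card_split[OF fin(1), of T]
            moreover have "card S + 1 = 4" using B[OF ij(4)] ij(1) fin by (simp add: symd_card_notin)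
            ultimately show False using three by simp
          qed
          then have "2 \<le> card (E - N)"
            using diff_card_le_card_Diff[OF finN, of E] three(3) by (simp add: E)
          then show ?thesis by (rule that(3))
        qed
      qed
      then show ?thesis
      proof cases
        case 1 then show ?thesis by (simp add: min_twice_def)
      next
        case 2
        then obtain i j where D: "?D = {i, j}" "i \<noteq> j" by (meson card_2_iff)
        have mem: "x \<in> S \<longleftrightarrow> x \<notin> T \<longleftrightarrow> x = i \<or> x = j" for x
          using D(1) symd_simps[of x S T] by auto
        have "symd S {i} = symd T {j}" "symd S {j} = symd T {i}"
          using mem D(2) by (auto simp: set_eq_iff symd_simps)
        then have "?f i = ?f j" by (simp add: add.commute)
        then show ?thesis using D by (auto simp: min_twice_def)
      next
        case 3
        then obtain i j where ij: "i \<in> E - N" "j \<in> E - N" "i \<noteq> j" by (rule two_elements)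
        then have "i \<in> ?D" "j \<in> ?D" using ED by auto
        moreover have "?f i = ?f j" "\<forall>k\<in>?D. ?f i \<le> ?f k"
          using f calculation goodE ij hD by simp_all
        ultimately show ?thesis using ij(3) unfolding min_twice_def by blast
      qed
    qed
  qed
  have "min_twice (\<lambda>i. ?p (symd S {i}) + ?p (symd T {i})) (symd S T)"
    if "S \<subseteq> {1..n}" "T \<subseteq> {1..n}" for S T
    using main[OF that] main[OF that(2,1)] min_twice_sym[of ?p S T] by linarith
  then show ?thesis using tv by (simp add: DDr_def)
qed

section \<open>A polynomial of the Wick ideal with a unique minimal term\<close>

definition mono3 :: "nat set \<Rightarrow> nat set \<Rightarrow> nat set \<Rightarrow> mono" where
  "mono3 A B C = (\<lambda>S. mono1 A S + mono2 B C S)"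

lemma mono3_swap: "mono3 A B C = mono3 B A C" "mono3 A B C = mono3 A C B"
  by (auto simp: mono3_def mono1_def mono2_def)

lemma trop_mon_mono3:
  "A \<subseteq> {1..n} \<Longrightarrow> B \<subseteq> {1..n} \<Longrightarrow> C \<subseteq> {1..n} \<Longrightarrow> trop_mon n p (mono3 A B C) = p A + (p B + p C)"
  unfolding mono3_def by (simp only: trop_mon_add trop_mon_mono1 trop_mon_mono2)

lemma pmult_pterm_mono1_mono2:
  "z \<noteq> 0 \<Longrightarrow> pmult (pterm (mono1 A) z) (pterm (mono2 B C) z') = pterm (mono3 A B C) (z * z')"
  by (simp add: pmult_pterm_pterm mono3_def)

text \<open>A list, since terms may recur: in \<open>fano_poly\<close> one monomial is listed with
  coefficients 1 and -1.\<close>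

definition spoly :: "(mono \<times> int) list \<Rightarrow> kpoly" where
  "spoly L = (\<Sum>(m, z)\<leftarrow>L. pterm m z)"

lemma spoly_simps [simp]: "spoly [] = 0" "spoly ((m, z) # L) = pterm m z + spoly L"
  by (simp_all add: spoly_def)

lemma spoly_const: "\<exists>k::int. spoly L a = pconst (of_int k)"
proof (induction L)
  case Nil show ?case by (intro exI[of _ 0]) simp
next
  case (Cons x L)
  obtain m z where x: "x = (m, z)" by (cases x)
  obtain k where "spoly L a = pconst (of_int k)" using Cons by blast
  then have "spoly (x # L) a = pconst (of_int ((if a = m then z else 0) + k))"
    by (simp add: x pterm_def pconst_add)
  then show ?case by blast
qed

lemma spoly_support: "spoly L a \<noteq> 0 \<Longrightarrow> a \<in> fst ` set L"
proof (induction L)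
  case (Cons x L)
  obtain m z where x: "x = (m, z)" by (cases x)
  show ?case
  proof (cases "a = m")
    case False
    then have "spoly (x # L) a = spoly L a" by (simp add: x pterm_def)
    then show ?thesis using Cons by auto
  qed (simp add: x)
qed simp

text \<open>Nonzero integer constants have valuation 0 in \<open>K\<close>, so tropical terms are
  compared by their monomials alone. Terms of \<open>L\<close> may cancel among themselves without
  harm.\<close>

lemma unique_minimum_not_in_trop_hyp:
  assumes "z \<noteq> 0" "trop_mon n p m = 0" "\<And>a. a \<in> fst ` set L \<Longrightarrow> trop_mon n p a > 0"
  shows "p \<notin> trop_hyp n (pterm m z + spoly L)"
proof
  let ?P = "pterm m z + spoly L"
  assume p: "p \<in> trop_hyp n ?P"
  have m: "m \<notin> fst ` set L" using assms(2,3) by force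
  have Pm: "?P m = pconst (of_int z)"
    using spoly_support[of L m] m by (auto simp: pterm_def)
  have tpow: "trop_term n ?P p m = 0"
    using assms(1,2) by (simp add: trop_term_trop_mon Pm val_pconst del: plus_fun_apply)
  have other: "trop_term n ?P p a > 0" if "?P a \<noteq> 0" "a \<noteq> m" for a
  proof -
    have eq: "?P a = spoly L a" using that(2) by (simp add: pterm_def)
    obtain k :: int where k: "spoly L a = pconst (of_int k)" using spoly_const by blast
    have "a \<in> fst ` set L" using spoly_support[of L a] that(1) eq by simp
    then show ?thesis
      using assms(3)[of a] that(1) by (simp add: trop_term_trop_mon eq k val_pconst del: plus_fun_apply)
  qed
  have nz: "?P m \<noteq> 0" using assms(1) by (simp add: Pm del: plus_fun_apply)
  from p consider "\<forall>a. ?P a \<noteq> 0 \<longrightarrow> trop_term n ?P p a = \<infinity>"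
    | a b where "a \<noteq> b" "?P a \<noteq> 0" "?P b \<noteq> 0" "trop_term n ?P p a = trop_term n ?P p b"
      "\<forall>c. ?P c \<noteq> 0 \<longrightarrow> trop_term n ?P p a \<le> trop_term n ?P p c"
    unfolding trop_hyp_def by blast
  then show False
  proof cases
    case 1 then show False using nz tpow by force
  next
    case 2
    have "trop_term n ?P p a \<le> 0" using 2(5) nz tpow by metis
    then show False using other[of a] other[of b] 2 by (metis not_less)
  qed
qed

text \<open>The complements in \<open>{1..7}\<close> of the lines of the Fano plane.\<close>
definition fano :: "nat set set" where
  "fano = {{3,5,6,7}, {1,4,6,7}, {1,2,5,7}, {1,2,3,6}, {2,3,4,7}, {1,3,4,5}, {2,4,5,6}}"

text \<open>The lines are the translates of \<open>{1,2,4}\<close> modulo 7. Two lines meet in one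
  point, so their complements meet in \<open>7 - 3 - 3 + 1 = 2\<close> points.\<close>

lemma fano_inter: "X \<in> fano \<Longrightarrow> Y \<in> fano \<Longrightarrow> X \<noteq> Y \<Longrightarrow> card (X \<inter> Y) \<le> 2"
  unfolding fano_def by (elim insertE emptyE; simp)

lemma fano_card: "X \<in> fano \<Longrightarrow> card X = 4"
  unfolding fano_def by (elim insertE emptyE; simp)

lemma paving_fano_in_DDr: "paving n fano \<in> DDr n"
  by (rule paving_in_DDr) (auto intro: fano_card fano_inter)

text \<open>The signs alternate along the increasing enumeration of the symmetric difference.
  Keeping \<open>1\<close> as a numeral lets the listed sets match syntactically.\<close>

lemma wick_relation_1: "wick [3,4,5] [1,2,5,6,7] =
  pterm (mono2 {1,3,4,5} {2,5,6,7}) (-1) + pterm (mono2 {2,3,4,5} {1,5,6,7}) (1) + pterm (mono2 {4,5} {1,2,3,5,6,7}) (-1) + pterm (mono2 {3,5} {1,2,4,5,6,7}) (1) + pterm (mono2 {3,4,5,6} {1,2,5,7}) (-1) + pterm (mono2 {3,4,5,7} {1,2,5,6}) (1)"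
proof -
  have D: "symd {3,4,5} {1,2,5,6,7} = {1,2,3,4,6,7}" by (auto simp: symd_def)
  have s: "symd {3,4,5} {1} = {1,3,4,5}" "symd {1,2,5,6,7} {1} = {2,5,6,7}" "symd {3,4,5} {2} = {2,3,4,5}" "symd {1,2,5,6,7} {2} = {1,5,6,7}" "symd {3,4,5} {3} = {4,5}" "symd {1,2,5,6,7} {3} = {1,2,3,5,6,7}" "symd {3,4,5} {4} = {3,5}" "symd {1,2,5,6,7} {4} = {1,2,4,5,6,7}" "symd {3,4,5} {6} = {3,4,5,6}" "symd {1,2,5,6,7} {6} = {1,2,5,7}" "symd {3,4,5} {7} = {3,4,5,7}" "symd {1,2,5,6,7} {7} = {1,2,5,6}"
    by (auto simp: symd_def)
  have "{j \<in> {1,2,3,4,6,7} :: nat set. j < 1} = {}" by auto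
  then have c1: "wick_coeff {3,4,5} {1,2,5,6,7} 1 = 1" unfolding wick_coeff_def D by (simp only:) simp
  have "{j \<in> {1,2,3,4,6,7} :: nat set. j < 2} = {1}" by auto
  then have c2: "wick_coeff {3,4,5} {1,2,5,6,7} 2 = -1" unfolding wick_coeff_def D by (simp only:) simp
  have "{j \<in> {1,2,3,4,6,7} :: nat set. j < 3} = {1,2}" by auto
  then have c3: "wick_coeff {3,4,5} {1,2,5,6,7} 3 = 1" unfolding wick_coeff_def D by (simp only:) simp
  have "{j \<in> {1,2,3,4,6,7} :: nat set. j < 4} = {1,2,3}" by auto
  then have c4: "wick_coeff {3,4,5} {1,2,5,6,7} 4 = -1" unfolding wick_coeff_def D by (simp only:) simp
  have "{j \<in> {1,2,3,4,6,7} :: nat set. j < 6} = {1,2,3,4}" by auto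
  then have c6: "wick_coeff {3,4,5} {1,2,5,6,7} 6 = 1" unfolding wick_coeff_def D by (simp only:) simp
  have "{j \<in> {1,2,3,4,6,7} :: nat set. j < 7} = {1,2,3,4,6}" by auto
  then have c7: "wick_coeff {3,4,5} {1,2,5,6,7} 7 = -1" unfolding wick_coeff_def D by (simp only:) simp
  have "wick [3,4,5] [1,2,5,6,7] = wick_poly (-1) {3,4,5} {1,2,5,6,7}"
    by (subst wick_distinct) (simp_all add: seq_sign_Cons seq_sign_Nil lt_count_def)
  then show ?thesis unfolding wick_poly_def D by (simp add: s c1 c2 c3 c4 c6 c7 add.assoc del: One_nat_def)
qed

lemma wick_relation_2: "wick [3,5,7] [1,2,4,5,6] =
  pterm (mono2 {1,3,5,7} {2,4,5,6}) (-1) + pterm (mono2 {2,3,5,7} {1,4,5,6}) (1) + pterm (mono2 {5,7} {1,2,3,4,5,6}) (-1) + pterm (mono2 {3,4,5,7} {1,2,5,6}) (1) + pterm (mono2 {3,5,6,7} {1,2,4,5}) (-1) + pterm (mono2 {3,5} {1,2,4,5,6,7}) (1)"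
proof -
  have D: "symd {3,5,7} {1,2,4,5,6} = {1,2,3,4,6,7}" by (auto simp: symd_def)
  have s: "symd {3,5,7} {1} = {1,3,5,7}" "symd {1,2,4,5,6} {1} = {2,4,5,6}" "symd {3,5,7} {2} = {2,3,5,7}" "symd {1,2,4,5,6} {2} = {1,4,5,6}" "symd {3,5,7} {3} = {5,7}" "symd {1,2,4,5,6} {3} = {1,2,3,4,5,6}" "symd {3,5,7} {4} = {3,4,5,7}" "symd {1,2,4,5,6} {4} = {1,2,5,6}" "symd {3,5,7} {6} = {3,5,6,7}" "symd {1,2,4,5,6} {6} = {1,2,4,5}" "symd {3,5,7} {7} = {3,5}" "symd {1,2,4,5,6} {7} = {1,2,4,5,6,7}"
    by (auto simp: symd_def)
  have "{j \<in> {1,2,3,4,6,7} :: nat set. j < 1} = {}" by auto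
  then have c1: "wick_coeff {3,5,7} {1,2,4,5,6} 1 = 1" unfolding wick_coeff_def D by (simp only:) simp
  have "{j \<in> {1,2,3,4,6,7} :: nat set. j < 2} = {1}" by auto
  then have c2: "wick_coeff {3,5,7} {1,2,4,5,6} 2 = -1" unfolding wick_coeff_def D by (simp only:) simp
  have "{j \<in> {1,2,3,4,6,7} :: nat set. j < 3} = {1,2}" by auto
  then have c3: "wick_coeff {3,5,7} {1,2,4,5,6} 3 = 1" unfolding wick_coeff_def D by (simp only:) simp
  have "{j \<in> {1,2,3,4,6,7} :: nat set. j < 4} = {1,2,3}" by auto
  then have c4: "wick_coeff {3,5,7} {1,2,4,5,6} 4 = -1" unfolding wick_coeff_def D by (simp only:) simp
  have "{j \<in> {1,2,3,4,6,7} :: nat set. j < 6} = {1,2,3,4}" by auto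
  then have c6: "wick_coeff {3,5,7} {1,2,4,5,6} 6 = 1" unfolding wick_coeff_def D by (simp only:) simp
  have "{j \<in> {1,2,3,4,6,7} :: nat set. j < 7} = {1,2,3,4,6}" by auto
  then have c7: "wick_coeff {3,5,7} {1,2,4,5,6} 7 = -1" unfolding wick_coeff_def D by (simp only:) simp
  have "wick [3,5,7] [1,2,4,5,6] = wick_poly (-1) {3,5,7} {1,2,4,5,6}"
    by (subst wick_distinct) (simp_all add: seq_sign_Cons seq_sign_Nil lt_count_def)
  then show ?thesis unfolding wick_poly_def D by (simp add: s c1 c2 c3 c4 c6 c7 add.assoc del: One_nat_def)
qed

lemma wick_relation_3: "wick [1,2,3] [2,3,4,5,7] =
  pterm (mono2 {2,3} {1,2,3,4,5,7}) (-1) + pterm (mono2 {1,2,3,4} {2,3,5,7}) (1) + pterm (mono2 {1,2,3,5} {2,3,4,7}) (-1) + pterm (mono2 {1,2,3,7} {2,3,4,5}) (1)"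
proof -
  have D: "symd {1,2,3} {2,3,4,5,7} = {1,4,5,7}" by (auto simp: symd_def)
  have s: "symd {1,2,3} {1} = {2,3}" "symd {2,3,4,5,7} {1} = {1,2,3,4,5,7}" "symd {1,2,3} {4} = {1,2,3,4}" "symd {2,3,4,5,7} {4} = {2,3,5,7}" "symd {1,2,3} {5} = {1,2,3,5}" "symd {2,3,4,5,7} {5} = {2,3,4,7}" "symd {1,2,3} {7} = {1,2,3,7}" "symd {2,3,4,5,7} {7} = {2,3,4,5}"
    by (auto simp: symd_def)
  have "{j \<in> {1,4,5,7} :: nat set. j < 1} = {}" by auto
  then have c1: "wick_coeff {1,2,3} {2,3,4,5,7} 1 = 1" unfolding wick_coeff_def D by (simp only:) simp
  have "{j \<in> {1,4,5,7} :: nat set. j < 4} = {1}" by auto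
  then have c4: "wick_coeff {1,2,3} {2,3,4,5,7} 4 = -1" unfolding wick_coeff_def D by (simp only:) simp
  have "{j \<in> {1,4,5,7} :: nat set. j < 5} = {1,4}" by auto
  then have c5: "wick_coeff {1,2,3} {2,3,4,5,7} 5 = 1" unfolding wick_coeff_def D by (simp only:) simp
  have "{j \<in> {1,4,5,7} :: nat set. j < 7} = {1,4,5}" by auto
  then have c7: "wick_coeff {1,2,3} {2,3,4,5,7} 7 = -1" unfolding wick_coeff_def D by (simp only:) simp
  have "wick [1,2,3] [2,3,4,5,7] = wick_poly (-1) {1,2,3} {2,3,4,5,7}"
    by (subst wick_distinct) (simp_all add: seq_sign_Cons seq_sign_Nil lt_count_def)
  then show ?thesis unfolding wick_poly_def D by (simp add: s c1 c4 c5 c7 add.assoc del: One_nat_def)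
qed

lemma wick_relation_4: "wick [1,2,3] [1,4,5,6,7] =
  pterm (mono2 {1,3} {1,2,4,5,6,7}) (-1) + pterm (mono2 {1,2} {1,3,4,5,6,7}) (1) + pterm (mono2 {1,2,3,4} {1,5,6,7}) (-1) + pterm (mono2 {1,2,3,5} {1,4,6,7}) (1) + pterm (mono2 {1,2,3,6} {1,4,5,7}) (-1) + pterm (mono2 {1,2,3,7} {1,4,5,6}) (1)"
proof -
  have D: "symd {1,2,3} {1,4,5,6,7} = {2,3,4,5,6,7}" by (auto simp: symd_def)
  have s: "symd {1,2,3} {2} = {1,3}" "symd {1,4,5,6,7} {2} = {1,2,4,5,6,7}" "symd {1,2,3} {3} = {1,2}" "symd {1,4,5,6,7} {3} = {1,3,4,5,6,7}" "symd {1,2,3} {4} = {1,2,3,4}" "symd {1,4,5,6,7} {4} = {1,5,6,7}" "symd {1,2,3} {5} = {1,2,3,5}" "symd {1,4,5,6,7} {5} = {1,4,6,7}" "symd {1,2,3} {6} = {1,2,3,6}" "symd {1,4,5,6,7} {6} = {1,4,5,7}" "symd {1,2,3} {7} = {1,2,3,7}" "symd {1,4,5,6,7} {7} = {1,4,5,6}"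
    by (auto simp: symd_def)
  have "{j \<in> {2,3,4,5,6,7} :: nat set. j < 2} = {}" by auto
  then have c2: "wick_coeff {1,2,3} {1,4,5,6,7} 2 = 1" unfolding wick_coeff_def D by (simp only:) simp
  have "{j \<in> {2,3,4,5,6,7} :: nat set. j < 3} = {2}" by auto
  then have c3: "wick_coeff {1,2,3} {1,4,5,6,7} 3 = -1" unfolding wick_coeff_def D by (simp only:) simp
  have "{j \<in> {2,3,4,5,6,7} :: nat set. j < 4} = {2,3}" by auto
  then have c4: "wick_coeff {1,2,3} {1,4,5,6,7} 4 = 1" unfolding wick_coeff_def D by (simp only:) simp
  have "{j \<in> {2,3,4,5,6,7} :: nat set. j < 5} = {2,3,4}" by auto
  then have c5: "wick_coeff {1,2,3} {1,4,5,6,7} 5 = -1" unfolding wick_coeff_def D by (simp only:) simp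
  have "{j \<in> {2,3,4,5,6,7} :: nat set. j < 6} = {2,3,4,5}" by auto
  then have c6: "wick_coeff {1,2,3} {1,4,5,6,7} 6 = 1" unfolding wick_coeff_def D by (simp only:) simp
  have "{j \<in> {2,3,4,5,6,7} :: nat set. j < 7} = {2,3,4,5,6}" by auto
  then have c7: "wick_coeff {1,2,3} {1,4,5,6,7} 7 = -1" unfolding wick_coeff_def D by (simp only:) simp
  have "wick [1,2,3] [1,4,5,6,7] = wick_poly (-1) {1,2,3} {1,4,5,6,7}"
    by (subst wick_distinct) (simp_all add: seq_sign_Cons seq_sign_Nil lt_count_def)
  then show ?thesis unfolding wick_poly_def D by (simp add: s c2 c3 c4 c5 c6 c7 add.assoc del: One_nat_def)
qed

text \<open>A combination of four Wick relations, found by computer, in which the monomials in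
  unperturbed variables cancel up to one.\<close>
definition fano_poly :: kpoly where
  "fano_poly = pterm (mono3 {1,2,3,4} {1,5,6,7} {2,3,4,5}) 2 + spoly
   [(mono3 {1,2,3,4} {1,3,4,5} {2,5,6,7}, -1),
    (mono3 {1,2,3,4} {1,2,3,5,6,7} {4,5}, -1),
    (mono3 {1,2,3,4} {1,2,4,5,6,7} {3,5}, 1),
    (mono3 {1,2,3,4} {1,2,5,7} {3,4,5,6}, -1),
    (mono3 {1,2,3,4} {1,3,5,7} {2,4,5,6}, 1),
    (mono3 {1,2,3,4} {1,2,3,4,5,6} {5,7}, 1),
    (mono3 {1,2,3,4} {1,2,4,5} {3,5,6,7}, 1),
    (mono3 {1,2,3,4} {1,2,4,5,6,7} {3,5}, -1),
    (mono3 {1,2,3,4,5,7} {1,4,5,6} {2,3}, -1),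
    (mono3 {1,2,3,5} {1,4,5,6} {2,3,4,7}, -1),
    (mono3 {1,2,4,5,6,7} {1,3} {2,3,4,5}, 1),
    (mono3 {1,2} {1,3,4,5,6,7} {2,3,4,5}, -1),
    (mono3 {1,2,3,5} {1,4,6,7} {2,3,4,5}, -1),
    (mono3 {1,2,3,6} {1,4,5,7} {2,3,4,5}, 1)]"

text \<open>Modulo monomials with a factor in \<open>fano\<close> or of size other than 4, the
  relations read \<open>w_2345 w_1567 + w_3457 w_1256\<close>,
  \<open>w_2357 w_1456 + w_3457 w_1256\<close>, \<open>w_1234 w_2357 + w_1237 w_2345\<close> and
  \<open>w_1237 w_1456 - w_1234 w_1567\<close>. The multipliers cancel everything except
  \<open>w_1234 w_1567 w_2345\<close>, which arises once from the first and once from the last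
  relation. Its coefficient 2 would vanish in characteristic 2, where the Fano plane is
  representable.\<close>

lemma fano_poly_eq: "fano_poly =
  pmult (pterm (mono1 {1,2,3,4}) (1)) (wick [3,4,5] [1,2,5,6,7]) +
  pmult (pterm (mono1 {1,2,3,4}) (-1)) (wick [3,5,7] [1,2,4,5,6]) +
  pmult (pterm (mono1 {1,4,5,6}) (1)) (wick [1,2,3] [2,3,4,5,7]) +
  pmult (pterm (mono1 {2,3,4,5}) (-1)) (wick [1,2,3] [1,4,5,6,7])"
proof -
  \<comment> \<open>All coefficients are reduced to 1, so that equal monomials cancel by additive
    laws alone.\<close>
  have neg: "pterm m (- 1) = - pterm m 1" for m
    using pterm_add[of m 1 "-1"] by (simp add: eq_neg_iff_add_eq_0 add.commute)
  have two: "pterm m 2 = pterm m 1 + pterm m 1" for m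
    by (simp add: pterm_add)
  have e1: "pmult (pterm (mono1 {1,2,3,4}) (1)) (wick [3,4,5] [1,2,5,6,7]) =
    pterm (mono3 {1,2,3,4} {1,3,4,5} {2,5,6,7}) (-1) + pterm (mono3 {1,2,3,4} {2,3,4,5} {1,5,6,7}) (1) + pterm (mono3 {1,2,3,4} {4,5} {1,2,3,5,6,7}) (-1) + pterm (mono3 {1,2,3,4} {3,5} {1,2,4,5,6,7}) (1) + pterm (mono3 {1,2,3,4} {3,4,5,6} {1,2,5,7}) (-1) + pterm (mono3 {1,2,3,4} {3,4,5,7} {1,2,5,6}) (1)"
    by (simp add: wick_relation_1 pmult_pterm_add pmult_pterm_mono1_mono2 add.assoc del: One_nat_def)
  have e2: "pmult (pterm (mono1 {1,2,3,4}) (-1)) (wick [3,5,7] [1,2,4,5,6]) =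
    pterm (mono3 {1,2,3,4} {1,3,5,7} {2,4,5,6}) (1) + pterm (mono3 {1,2,3,4} {2,3,5,7} {1,4,5,6}) (-1) + pterm (mono3 {1,2,3,4} {5,7} {1,2,3,4,5,6}) (1) + pterm (mono3 {1,2,3,4} {3,4,5,7} {1,2,5,6}) (-1) + pterm (mono3 {1,2,3,4} {3,5,6,7} {1,2,4,5}) (1) + pterm (mono3 {1,2,3,4} {3,5} {1,2,4,5,6,7}) (-1)"
    by (simp add: wick_relation_2 pmult_pterm_add pmult_pterm_mono1_mono2 add.assoc del: One_nat_def)
  have e3: "pmult (pterm (mono1 {1,4,5,6}) (1)) (wick [1,2,3] [2,3,4,5,7]) =
    pterm (mono3 {1,4,5,6} {2,3} {1,2,3,4,5,7}) (-1) + pterm (mono3 {1,4,5,6} {1,2,3,4} {2,3,5,7}) (1) + pterm (mono3 {1,4,5,6} {1,2,3,5} {2,3,4,7}) (-1) + pterm (mono3 {1,4,5,6} {1,2,3,7} {2,3,4,5}) (1)"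
    by (simp add: wick_relation_3 pmult_pterm_add pmult_pterm_mono1_mono2 add.assoc del: One_nat_def)
  have e4: "pmult (pterm (mono1 {2,3,4,5}) (-1)) (wick [1,2,3] [1,4,5,6,7]) =
    pterm (mono3 {2,3,4,5} {1,3} {1,2,4,5,6,7}) (1) + pterm (mono3 {2,3,4,5} {1,2} {1,3,4,5,6,7}) (-1) + pterm (mono3 {2,3,4,5} {1,2,3,4} {1,5,6,7}) (1) + pterm (mono3 {2,3,4,5} {1,2,3,5} {1,4,6,7}) (-1) + pterm (mono3 {2,3,4,5} {1,2,3,6} {1,4,5,7}) (1) + pterm (mono3 {2,3,4,5} {1,2,3,7} {1,4,5,6}) (-1)"
    by (simp add: wick_relation_4 pmult_pterm_add pmult_pterm_mono1_mono2 add.assoc del: One_nat_def)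
  show ?thesis
    unfolding e1 e2 e3 e4 fano_poly_def
    by (simp add: mono3_swap two neg algebra_simps del: One_nat_def)
qed

lemma fano_poly_in_gen_ideal:
  assumes "7 \<le> n" shows "fano_poly \<in> gen_ideal n (wick_rels n)"
proof -
  let ?C = "[pterm (mono1 {1,2,3,4}) (1),
    pterm (mono1 {1,2,3,4}) (-1),
    pterm (mono1 {1,4,5,6}) (1),
    pterm (mono1 {2,3,4,5}) (-1)]"
  let ?G = "[wick [3,4,5] [1,2,5,6,7], wick [3,5,7] [1,2,4,5,6], wick [1,2,3] [2,3,4,5,7], wick [1,2,3] [1,4,5,6,7]]"
  have eq: "fano_poly = (\<Sum>i<4. pmult (?C ! i) (?G ! i))"
    unfolding fano_poly_eq by (simp add: numeral_eq_Suc add.assoc)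
  have "?C ! i \<in> polys n \<and> ?G ! i \<in> wick_rels n" if "i < 4" for i
  proof -
    have "i = 0 \<or> i = 1 \<or> i = 2 \<or> i = 3" using that by auto
    moreover have "pterm (mono1 A) z \<in> polys n" if "A \<subseteq> {1..n}" for A z
      by (rule polys_pterm) (use that in \<open>auto simp: mono1_def split: if_splits\<close>)
    moreover have "wick \<sigma> \<tau> \<in> wick_rels n" if "set \<sigma> \<subseteq> {1..n}" "set \<tau> \<subseteq> {1..n}" for \<sigma> \<tau>
      using that by (auto simp: wick_rels_def)
    ultimately show ?thesis using assms by (elim disjE) simp_all
  qed
  then show ?thesis unfolding gen_ideal_def eq by blast
qed

text \<open>Every other monomial contains a set of \<open>fano\<close> or a set whose size is not 4,
  and no coordinate is negative.\<close>

lemma paving_fano_not_in_trop_hyp: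
  assumes "7 \<le> n" shows "paving n fano \<notin> trop_hyp n fano_poly"
  unfolding fano_poly_def
proof (rule unique_minimum_not_in_trop_hyp)
  have ge0: "0 \<le> paving n fano A" for A by (simp add: paving_def)
  have pos: "0 < trop_mon n (paving n fano) (mono3 A B C)"
    if "A \<subseteq> {1..7}" "B \<subseteq> {1..7}" "C \<subseteq> {1..7}"
      "0 < paving n fano A \<or> 0 < paving n fano B \<or> 0 < paving n fano C" for A B C
  proof -
    have "{1..7} \<subseteq> {1..n}" using assms by auto
    then have sub: "A \<subseteq> {1..n}" "B \<subseteq> {1..n}" "C \<subseteq> {1..n}" using that by blast+
    have "0 < paving n fano A + (paving n fano B + paving n fano C)"
      using that(4) ge0[of A] ge0[of B] ge0[of C]
      by (metis add_nonneg_pos add_pos_nonneg add_nonneg_nonneg)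
    then show ?thesis by (simp only: trop_mon_mono3[OF sub])
  qed
  have p1: "0 < paving n fano A" if "A \<in> fano \<or> card A \<noteq> 4" for A
    using that by (auto simp: paving_def field_simps add_pos_nonneg add_nonneg_pos dest: fano_card)
  show "trop_mon n (paving n fano) (mono3 {1,2,3,4} {1,5,6,7} {2,3,4,5}) = 0"
    using assms by (subst trop_mon_mono3) (auto simp: paving_def fano_def set_eq_subset)
  have fm: "{3,5,6,7} \<in> fano" "{1,4,6,7} \<in> fano" "{1,2,5,7} \<in> fano" "{1,2,3,6} \<in> fano" "{2,3,4,7} \<in> fano" "{1,3,4,5} \<in> fano" "{2,4,5,6} \<in> fano"
    by (simp_all add: fano_def)
  have r0: "0 < trop_mon n (paving n fano) (mono3 {1,2,3,4} {1,3,4,5} {2,5,6,7})"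
    by (rule pos) (simp_all add: p1 fm del: One_nat_def)
  have r1: "0 < trop_mon n (paving n fano) (mono3 {1,2,3,4} {1,2,3,5,6,7} {4,5})"
    by (rule pos) (simp_all add: p1 fm del: One_nat_def)
  have r2: "0 < trop_mon n (paving n fano) (mono3 {1,2,3,4} {1,2,4,5,6,7} {3,5})"
    by (rule pos) (simp_all add: p1 fm del: One_nat_def)
  have r3: "0 < trop_mon n (paving n fano) (mono3 {1,2,3,4} {1,2,5,7} {3,4,5,6})"
    by (rule pos) (simp_all add: p1 fm del: One_nat_def)
  have r4: "0 < trop_mon n (paving n fano) (mono3 {1,2,3,4} {1,3,5,7} {2,4,5,6})"
    by (rule pos) (simp_all add: p1 fm del: One_nat_def)
  have r5: "0 < trop_mon n (paving n fano) (mono3 {1,2,3,4} {1,2,3,4,5,6} {5,7})"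
    by (rule pos) (simp_all add: p1 fm del: One_nat_def)
  have r6: "0 < trop_mon n (paving n fano) (mono3 {1,2,3,4} {1,2,4,5} {3,5,6,7})"
    by (rule pos) (simp_all add: p1 fm del: One_nat_def)
  have r7: "0 < trop_mon n (paving n fano) (mono3 {1,2,3,4} {1,2,4,5,6,7} {3,5})"
    by (rule pos) (simp_all add: p1 fm del: One_nat_def)
  have r8: "0 < trop_mon n (paving n fano) (mono3 {1,2,3,4,5,7} {1,4,5,6} {2,3})"
    by (rule pos) (simp_all add: p1 fm del: One_nat_def)
  have r9: "0 < trop_mon n (paving n fano) (mono3 {1,2,3,5} {1,4,5,6} {2,3,4,7})"
    by (rule pos) (simp_all add: p1 fm del: One_nat_def)
  have r10: "0 < trop_mon n (paving n fano) (mono3 {1,2,4,5,6,7} {1,3} {2,3,4,5})"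
    by (rule pos) (simp_all add: p1 fm del: One_nat_def)
  have r11: "0 < trop_mon n (paving n fano) (mono3 {1,2} {1,3,4,5,6,7} {2,3,4,5})"
    by (rule pos) (simp_all add: p1 fm del: One_nat_def)
  have r12: "0 < trop_mon n (paving n fano) (mono3 {1,2,3,5} {1,4,6,7} {2,3,4,5})"
    by (rule pos) (simp_all add: p1 fm del: One_nat_def)
  have r13: "0 < trop_mon n (paving n fano) (mono3 {1,2,3,6} {1,4,5,7} {2,3,4,5})"
    by (rule pos) (simp_all add: p1 fm del: One_nat_def)
  show "0 < trop_mon n (paving n fano) a" if "a \<in> fst ` set [(mono3 {1,2,3,4} {1,3,4,5} {2,5,6,7}, -1),
    (mono3 {1,2,3,4} {1,2,3,5,6,7} {4,5}, -1),
    (mono3 {1,2,3,4} {1,2,4,5,6,7} {3,5}, 1),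
    (mono3 {1,2,3,4} {1,2,5,7} {3,4,5,6}, -1),
    (mono3 {1,2,3,4} {1,3,5,7} {2,4,5,6}, 1),
    (mono3 {1,2,3,4} {1,2,3,4,5,6} {5,7}, 1),
    (mono3 {1,2,3,4} {1,2,4,5} {3,5,6,7}, 1),
    (mono3 {1,2,3,4} {1,2,4,5,6,7} {3,5}, -1),
    (mono3 {1,2,3,4,5,7} {1,4,5,6} {2,3}, -1),
    (mono3 {1,2,3,5} {1,4,5,6} {2,3,4,7}, -1),
    (mono3 {1,2,4,5,6,7} {1,3} {2,3,4,5}, 1),
    (mono3 {1,2} {1,3,4,5,6,7} {2,3,4,5}, -1),
    (mono3 {1,2,3,5} {1,4,6,7} {2,3,4,5}, -1),
    (mono3 {1,2,3,6} {1,4,5,7} {2,3,4,5}, 1)]" for a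
    using that r0 r1 r2 r3 r4 r5 r6 r7 r8 r9 r10 r11 r12 r13 by (auto simp del: One_nat_def)
qed simp

lemma paving_fano_properties:
  assumes "7 \<le> n"
  shows "paving n fano \<in> DDr_plus n" "tsupp (paving n fano) = {S. S \<subseteq> {1..n} \<and> even (card S)}"
    "paving n fano \<notin> TSpin_plus n" "paving n fano \<notin> TSpin_pm n"
proof -
  show "tsupp (paving n fano) = {S. S \<subseteq> {1..n} \<and> even (card S)}"
    by (auto simp: tsupp_def paving_def)
  then show "paving n fano \<in> DDr_plus n"
    using paving_fano_in_DDr by (simp add: DDr_plus_def)
  show "paving n fano \<notin> TSpin_pm n" "paving n fano \<notin> TSpin_plus n"
    using paving_fano_not_in_trop_hyp[OF assms] fano_poly_in_gen_ideal[OF assms]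
      gen_ideal_subset_vanish_ideal[of n]
    unfolding TSpin_pm_def TSpin_plus_def trop_var_def by blast+
qed

section \<open>Lifting with at most two cancelling Pfaffians\<close>

text \<open>Stated as the absence of a strict minimum, which includes the case of four infinite
  entries and is insensitive to their order.\<close>

definition tropical_zero4 :: "ereal \<Rightarrow> ereal \<Rightarrow> ereal \<Rightarrow> ereal \<Rightarrow> bool" where
  "tropical_zero4 a b c d \<longleftrightarrow> \<not> (a < b \<and> a < c \<and> a < d) \<and> \<not> (b < a \<and> b < c \<and> b < d) \<and>
     \<not> (c < a \<and> c < b \<and> c < d) \<and> \<not> (d < a \<and> d < b \<and> d < c)"

lemma min_twice_tropical_zero4:
  assumes "min_twice f {a, b, c, d}"
  shows "tropical_zero4 (f a) (f b) (f c) (f d)"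
  using assms unfolding min_twice_def tropical_zero4_def by (elim disjE bexE) (simp, auto simp: not_less)

text \<open>The coefficient \<open>x\<close> at \<open>t\<^sup>v\<close> may be 0 here, and is arbitrary if \<open>v = \<infinity>\<close>.\<close>
definition lead :: "nov \<Rightarrow> ereal \<Rightarrow> complex \<Rightarrow> bool" where
  "lead f v x \<longleftrightarrow> v = \<infinity> \<and> f = 0 \<or> (\<exists>r. v = ereal r \<and> coef f r = x \<and> (\<forall>y<r. coef f y = 0))"

lemma lead_infinity [simp]: "lead f \<infinity> x \<longleftrightarrow> f = 0"
  by (auto simp: lead_def)

lemma lead_ereal [simp]: "lead f (ereal r) x \<longleftrightarrow> coef f r = x \<and> (\<forall>y<r. coef f y = 0)"
  by (auto simp: lead_def)

lemma lead_not_MInf [simp]: "\<not> lead f (-\<infinity>) x"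
  by (auto simp: lead_def)

lemma lead_hasval: "lead f v x \<Longrightarrow> x \<noteq> 0 \<Longrightarrow> hasval f v"
  by (cases v) auto

lemma lead_mult:
  assumes "lead f v x" "lead g w y" shows "lead (f * g) (v + w) (x * y)"
proof (cases "v = \<infinity> \<or> w = \<infinity>")
  case True
  moreover have "v + w = \<infinity>" using calculation assms by (cases v; cases w) auto
  ultimately show ?thesis using assms by auto
next
  case False
  then obtain r s where "v = ereal r" "w = ereal s" using assms by (cases v; cases w) auto
  then show ?thesis using assms coef_mult_lowest[of r f s g] by simp
qed

lemma lead_uminus: "lead f v x \<Longrightarrow> lead (- f) v (- x)"
  by (cases v) auto

lemma lead_coef:
  assumes "lead f v x" "ereal r \<le> v"
  shows "coef f r = (if v = ereal r then x else 0)" "\<forall>y<r. coef f y = 0"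
  using assms by (cases v; auto)+

definition tpow :: "ereal \<Rightarrow> complex \<Rightarrow> nov" where
  "tpow v x = (if v = \<infinity> then 0 else tmono (real_of_ereal v) x)"

lemma lead_tpow: "v \<noteq> -\<infinity> \<Longrightarrow> lead (tpow v x) v x"
  by (cases v) (auto simp: tpow_def coef_tmono delta_def)

lemma hasval_sum3:
  assumes "lead f A a" "lead g B b" "lead h C c"
    and "m = min A (min B C)"
    and "m \<noteq> \<infinity> \<Longrightarrow> (if A = m then a else 0) + (if B = m then b else 0) + (if C = m then c else 0) \<noteq> 0"
  shows "hasval (f + g + h) m"
proof (cases "m = \<infinity>")
  case True
  then have "A = \<infinity>" "B = \<infinity>" "C = \<infinity>" using assms(4) by (auto simp: min_def split: if_splits)
  then show ?thesis using assms True by simp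
next
  case False
  then obtain r where r: "m = ereal r"
    using assms by (cases m) (auto simp: min_def split: if_splits)
  have "ereal r \<le> A" "ereal r \<le> B" "ereal r \<le> C" using assms(4) r by (auto simp: min_def split: if_splits)
  then show ?thesis
    using lead_coef[OF assms(1), of r] lead_coef[OF assms(2), of r] lead_coef[OF assms(3), of r] assms(5) r
    by simp
qed

text \<open>Solves \<open>u \<cdot> v = t\<^sup>\<alpha>\<close> for the coordinate of \<open>v\<close> in which the minimum is attained; the
  prescribed leading coefficients are consistent with this because they cancel.\<close>
lemma lift_dot_product_aux:
  assumes ni: "U0 \<noteq> -\<infinity>" "U1 \<noteq> -\<infinity>" "U2 \<noteq> -\<infinity>" "V0 \<noteq> -\<infinity>" "V1 \<noteq> -\<infinity>" "V2 \<noteq> -\<infinity>" "\<alpha> \<noteq> -\<infinity>"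
    and m: "m = U0 + V0" "m \<le> U1 + V1" "m \<le> U2 + V2" "m < \<alpha>"
    and s: "x0 + (if U1 + V1 = m then x1 else 0) + (if U2 + V2 = m then x2 else 0) = 0"
  shows "\<exists>v0 v1 v2. lead v0 V0 x0 \<and> lead v1 V1 x1 \<and> lead v2 V2 x2 \<and>
    hasval (tpow U0 1 * v0 + tpow U1 1 * v1 + tpow U2 1 * v2) \<alpha>"
proof -
  obtain a b where ab: "U0 = ereal a" "V0 = ereal b" using ni m by (cases U0; cases V0) auto
  have r: "m = ereal (a + b)" using m ab by simp
  define g where "g = tpow \<alpha> 1 - tpow U1 1 * tpow V1 x1 - tpow U2 1 * tpow V2 x2"
  \<comment> \<open>The entry \<open>u0\<close> is a monomial, hence a unit: dividing by it only
    shifts exponents. Since \<open>m < \<alpha>\<close>, the target \<open>tpow \<alpha> 1\<close>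
    does not disturb the coefficient of \<open>g\<close> at \<open>m\<close>.\<close>
  define v0 where "v0 = tmono (- a) 1 * g"
  have A: "lead (tpow \<alpha> 1) \<alpha> 1" using ni by (simp add: lead_tpow)
  have B: "lead (tpow U1 1 * tpow V1 x1) (U1 + V1) x1" "lead (tpow U2 1 * tpow V2 x2) (U2 + V2) x2"
    using lead_mult[OF lead_tpow lead_tpow, of U1 V1 1 x1] lead_mult[OF lead_tpow lead_tpow, of U2 V2 1 x2] ni by simp_all
  have "lead g m x0"
    unfolding g_def r lead_ereal
    using lead_coef[OF A, of "a + b"] lead_coef[OF B(1), of "a + b"] lead_coef[OF B(2), of "a + b"] m s r
    by (auto simp: add_eq_0_iff2 algebra_simps split: if_splits)
  then have "lead v0 V0 x0"
    unfolding v0_def r ab by (auto simp: coef_tmono_mult add.commute)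
  moreover have "tpow U0 1 * v0 + tpow U1 1 * tpow V1 x1 + tpow U2 1 * tpow V2 x2 = tpow \<alpha> 1"
  proof -
    have "tpow U0 1 * v0 = (tmono a 1 * tmono (- a) 1) * g" by (simp add: tpow_def ab v0_def mult.assoc)
    also have "\<dots> = g" by (simp add: tmono_mult tmono_0_1)
    finally show ?thesis by (simp add: g_def)
  qed
  moreover have "lead (tpow V1 x1) V1 x1" "lead (tpow V2 x2) V2 x2" using ni by (simp_all add: lead_tpow)
  ultimately show ?thesis using lead_hasval[OF A] by (metis zero_neq_one)
qed

text \<open>\<open>c\<close> says that the initial terms must cancel, \<open>n\<^sub>i\<close> that the \<open>i\<close>-th term attains the minimum.\<close>
definition good_coeffs :: "bool \<Rightarrow> bool \<Rightarrow> bool \<Rightarrow> bool \<Rightarrow> int \<Rightarrow> int \<Rightarrow> int \<Rightarrow> bool" where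
  "good_coeffs c n0 n1 n2 x0 x1 x2 \<longleftrightarrow> x0 \<noteq> 0 \<and> x1 \<noteq> 0 \<and> x2 \<noteq> 0 \<and>
     (if c then (if n0 then x0 else 0) + (if n1 then x1 else 0) + (if n2 then x2 else 0) = 0
      else (n0 \<or> n1 \<or> n2 \<longrightarrow> (if n0 then x0 else 0) + (if n1 then x1 else 0) + (if n2 then x2 else 0) \<noteq> 0))"

text \<open>If \<open>\<alpha>\<close> is the minimum \<open>m\<close>, monomials with
  non-cancelling coefficients suffice. If \<open>m < \<alpha>\<close>, a coordinate attaining
  \<open>m\<close> serves as pivot; this includes \<open>\<alpha> = \<infinity>\<close>, where the
  dot product must be zero.\<close>

lemma lift_dot_product:
  fixes x0 x1 x2 :: int
  assumes ni: "U0 \<noteq> -\<infinity>" "U1 \<noteq> -\<infinity>" "U2 \<noteq> -\<infinity>" "V0 \<noteq> -\<infinity>" "V1 \<noteq> -\<infinity>" "V2 \<noteq> -\<infinity>" "\<alpha> \<noteq> -\<infinity>"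
    and tz: "tropical_zero4 \<alpha> (U0 + V0) (U1 + V1) (U2 + V2)"
    and m: "m = min (U0 + V0) (min (U1 + V1) (U2 + V2))"
    and good: "good_coeffs (m < \<alpha>) (U0 + V0 = m) (U1 + V1 = m) (U2 + V2 = m) x0 x1 x2"
  shows "\<exists>v0 v1 v2. lead v0 V0 (of_int x0) \<and> lead v1 V1 (of_int x1) \<and> lead v2 V2 (of_int x2) \<and>
    hasval (tpow U0 1 * v0 + tpow U1 1 * v1 + tpow U2 1 * v2) \<alpha>"
proof (cases "m < \<alpha>")
  case False
  have "\<alpha> = m" using False tz unfolding tropical_zero4_def m by (auto simp: min_def not_less split: if_splits)
  have L: "lead (tpow V0 (of_int x0)) V0 (of_int x0)" "lead (tpow V1 (of_int x1)) V1 (of_int x1)"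
    "lead (tpow V2 (of_int x2)) V2 (of_int x2)" using ni by (simp_all add: lead_tpow)
  have P: "lead (tpow U0 1 * tpow V0 (of_int x0)) (U0 + V0) (of_int x0)"
    "lead (tpow U1 1 * tpow V1 (of_int x1)) (U1 + V1) (of_int x1)"
    "lead (tpow U2 1 * tpow V2 (of_int x2)) (U2 + V2) (of_int x2)"
    using lead_mult[OF lead_tpow L(1), of U0 1] lead_mult[OF lead_tpow L(2), of U1 1]
      lead_mult[OF lead_tpow L(3), of U2 1] ni by simp_all
  have "(if U0 + V0 = m then of_int x0 else 0) + (if U1 + V1 = m then of_int x1 else 0) + (if U2 + V2 = m then of_int x2 else (0::complex))
     = of_int ((if U0 + V0 = m then x0 else 0) + (if U1 + V1 = m then x1 else 0) + (if U2 + V2 = m then x2 else 0))"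
    by simp
  also have "\<dots> \<noteq> 0"
  proof -
    have "U0 + V0 = m \<or> U1 + V1 = m \<or> U2 + V2 = m" unfolding m by (auto simp: min_def)
    then show ?thesis using good False unfolding good_coeffs_def of_int_eq_0_iff by auto
  qed
  finally have "hasval (tpow U0 1 * tpow V0 (of_int x0) + tpow U1 1 * tpow V1 (of_int x1) + tpow U2 1 * tpow V2 (of_int x2)) m"
    by (intro hasval_sum3[OF P m]) 
  then show ?thesis using L \<open>\<alpha> = m\<close> by blast
next
  case True
  have sum: "(if U0 + V0 = m then x0 else 0) + (if U1 + V1 = m then x1 else 0) + (if U2 + V2 = m then x2 else 0) = 0"
    using good True by (simp add: good_coeffs_def)
  then have "of_int ((if U0 + V0 = m then x0 else 0) + (if U1 + V1 = m then x1 else 0) + (if U2 + V2 = m then x2 else 0)) = (0::complex)"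
    by simp
  then have sumc: "(if U0 + V0 = m then of_int x0 else 0) + (if U1 + V1 = m then of_int x1 else 0) + (if U2 + V2 = m then of_int x2 else (0::complex)) = 0"
    by (simp only: of_int_add if_distrib[of of_int] of_int_0)
  have le: "m \<le> U0 + V0" "m \<le> U1 + V1" "m \<le> U2 + V2" unfolding m by (auto simp: min_le_iff_disj)
  consider "U0 + V0 = m" | "U1 + V1 = m" | "U2 + V2 = m" unfolding m by (metis min_def)
  then show ?thesis
  proof cases
    case 1
    then show ?thesis
      using lift_dot_product_aux[of U0 U1 U2 V0 V1 V2 \<alpha> m "of_int x0" "of_int x1" "of_int x2"] ni le True sumc by simp
  next
    case 2
    have "\<exists>v1 v0 v2. lead v1 V1 (of_int x1) \<and> lead v0 V0 (of_int x0) \<and> lead v2 V2 (of_int x2) \<and>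
       hasval (tpow U1 1 * v1 + tpow U0 1 * v0 + tpow U2 1 * v2) \<alpha>"
      using lift_dot_product_aux[of U1 U0 U2 V1 V0 V2 \<alpha> m "of_int x1" "of_int x0" "of_int x2"] ni le True sumc 2
      by (simp add: add_ac)
    then show ?thesis by (metis add.commute)
  next
    case 3
    have "\<exists>v2 v1 v0. lead v2 V2 (of_int x2) \<and> lead v1 V1 (of_int x1) \<and> lead v0 V0 (of_int x0) \<and>
       hasval (tpow U2 1 * v2 + tpow U1 1 * v1 + tpow U0 1 * v0) \<alpha>"
      using lift_dot_product_aux[of U2 U1 U0 V2 V1 V0 \<alpha> m "of_int x2" "of_int x1" "of_int x0"] ni le True sumc 3
      by (simp add: add_ac)
    then show ?thesis by (metis add.commute add.assoc)
  qed
qed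

text \<open>The bound leaves room for a third generic coefficient, taken to be 1000 below.\<close>
lemma generic_coeffs:
  assumes "c \<Longrightarrow> (n0 \<and> n1) \<or> (n0 \<and> n2) \<or> (n1 \<and> n2)" "d \<Longrightarrow> (k0 \<and> k1) \<or> (k0 \<and> k2) \<or> (k1 \<and> k2)"
  obtains x0 x1 x2 y0 y1 y2 :: int where "good_coeffs c n0 n1 n2 x0 x1 x2" "good_coeffs d k0 k1 k2 y0 y1 y2"
    "x0 * y1 = x1 * y0 \<longrightarrow> c \<and> n0 \<and> n1 \<and> \<not> n2 \<and> d \<and> k0 \<and> k1 \<and> \<not> k2"
    "x1 * y2 = x2 * y1 \<longrightarrow> c \<and> n1 \<and> n2 \<and> \<not> n0 \<and> d \<and> k1 \<and> k2 \<and> \<not> k0"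
    "x2 * y0 = x0 * y2 \<longrightarrow> c \<and> n2 \<and> n0 \<and> \<not> n1 \<and> d \<and> k2 \<and> k0 \<and> \<not> k1"
    "\<forall>x\<in>{x0, x1, x2}. \<forall>y\<in>{y0, y1, y2}. \<bar>x * y\<bar> \<le> 245"
proof -
  \<comment> \<open>Positive entries cannot cancel; three cancelling terms sum to zero; two
    cancelling terms are forced to be 1 and -1, the third being free. The values are such that
    corresponding ratios of \<open>x\<close> and \<open>y\<close> agree only at -1, which occurs
    only in the forced case. The largest product is \<open>5 * 49 = 245\<close>.\<close>
  define x :: "int \<times> int \<times> int" where "x = (if \<not> c then (1, 2, 4) else if n0 \<and> n1 \<and> n2 then (1, 2, -3)
     else if n0 \<and> n1 then (1, -1, 5) else if n0 \<and> n2 then (1, 5, -1) else (5, 1, -1))"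
  define y :: "int \<times> int \<times> int" where "y = (if \<not> d then (1, 7, 49) else if k0 \<and> k1 \<and> k2 then (1, 3, -4)
     else if k0 \<and> k1 then (1, -1, 8) else if k0 \<and> k2 then (1, 8, -1) else (8, 1, -1))"
  obtain x0 x1 x2 where x': "x = (x0, x1, x2)" by (cases x)
  obtain y0 y1 y2 where y': "y = (y0, y1, y2)" by (cases y)
  have gx: "good_coeffs c n0 n1 n2 x0 x1 x2"
    using x' assms(1) unfolding x_def good_coeffs_def by (cases c; cases n0; cases n1; cases n2; auto)
  have gy: "good_coeffs d k0 k1 k2 y0 y1 y2"
    using y' assms(2) unfolding y_def good_coeffs_def by (cases d; cases k0; cases k1; cases k2; auto)
  have cx: "x0 = 1 \<and> x1 = 2 \<and> x2 = 4 \<or> x0 = 1 \<and> x1 = 2 \<and> x2 = -3 \<or>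
    c \<and> n0 \<and> n1 \<and> \<not> n2 \<and> x0 = 1 \<and> x1 = -1 \<and> x2 = 5 \<or>
    c \<and> n0 \<and> n2 \<and> \<not> n1 \<and> x0 = 1 \<and> x1 = 5 \<and> x2 = -1 \<or>
    c \<and> n1 \<and> n2 \<and> \<not> n0 \<and> x0 = 5 \<and> x1 = 1 \<and> x2 = -1"
    using x' assms(1) unfolding x_def by (cases c; cases n0; cases n1; cases n2; simp)
  have cy: "y0 = 1 \<and> y1 = 7 \<and> y2 = 49 \<or> y0 = 1 \<and> y1 = 3 \<and> y2 = -4 \<or>
    d \<and> k0 \<and> k1 \<and> \<not> k2 \<and> y0 = 1 \<and> y1 = -1 \<and> y2 = 8 \<or>
    d \<and> k0 \<and> k2 \<and> \<not> k1 \<and> y0 = 1 \<and> y1 = 8 \<and> y2 = -1 \<or>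
    d \<and> k1 \<and> k2 \<and> \<not> k0 \<and> y0 = 8 \<and> y1 = 1 \<and> y2 = -1"
    using y' assms(2) unfolding y_def by (cases d; cases k0; cases k1; cases k2; simp)
  have "(x0 * y1 = x1 * y0 \<longrightarrow> c \<and> n0 \<and> n1 \<and> \<not> n2 \<and> d \<and> k0 \<and> k1 \<and> \<not> k2) \<and>
    (x1 * y2 = x2 * y1 \<longrightarrow> c \<and> n1 \<and> n2 \<and> \<not> n0 \<and> d \<and> k1 \<and> k2 \<and> \<not> k0) \<and>
    (x2 * y0 = x0 * y2 \<longrightarrow> c \<and> n2 \<and> n0 \<and> \<not> n1 \<and> d \<and> k2 \<and> k0 \<and> \<not> k1) \<and>
    (\<forall>x\<in>{x0, x1, x2}. \<forall>y\<in>{y0, y1, y2}. \<bar>x * y\<bar> \<le> 245)"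
    using cx cy by (elim disjE conjE) simp_all
  then show ?thesis by (intro that[OF gx gy]) blast+
qed

text \<open>The coefficient 1000 outweighs two products of size at most 245, so nothing cancels when
  the term with \<open>s\<close> attains the minimum. Otherwise only the two terms of the minor
  compete.\<close>

lemma hasval_minor:
  fixes x0 x1 y0 y1 :: int
  assumes "lead s \<sigma> 1000" "lead v0 V0 (of_int x0)" "lead v1 V1 (of_int x1)" "lead w0 W0 (of_int y0)" "lead w1 W1 (of_int y1)"
    and "U \<noteq> -\<infinity>" and nz: "x0 \<noteq> 0" "x1 \<noteq> 0" "y0 \<noteq> 0" "y1 \<noteq> 0" and bound: "\<bar>x0 * y1\<bar> \<le> 245" "\<bar>x1 * y0\<bar> \<le> 245"
    and Q: "Q = min (\<sigma> + U) (min (V0 + W1) (V1 + W0))"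
    and ne: "V0 + W1 = V1 + W0 \<Longrightarrow> V0 + W1 < \<sigma> + U \<Longrightarrow> x0 * y1 \<noteq> x1 * y0"
  shows "hasval (s * tpow U 1 - v0 * w1 + v1 * w0) Q"
proof -
  have L: "lead (s * tpow U 1) (\<sigma> + U) (of_int 1000)" "lead (- (v0 * w1)) (V0 + W1) (of_int (- (x0 * y1)))"
    "lead (v1 * w0) (V1 + W0) (of_int (x1 * y0))"
    using lead_mult[OF assms(1) lead_tpow[of U 1]] lead_uminus[OF lead_mult[OF assms(2,5)]] lead_mult[OF assms(3,4)] assms(6)
    by simp_all
  have "(if \<sigma> + U = Q then 1000 else 0) + (if V0 + W1 = Q then - (x0 * y1) else 0) + (if V1 + W0 = Q then x1 * y0 else 0) \<noteq> 0"
  proof (cases "\<sigma> + U = Q")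
    case True then show ?thesis using bound by auto
  next
    case False
    then have "Q < \<sigma> + U" unfolding Q by (auto simp: min_def split: if_splits)
    then show ?thesis using nz ne False unfolding Q by (auto simp: min_def split: if_splits)
  qed
  then have "of_int ((if \<sigma> + U = Q then 1000 else 0) + (if V0 + W1 = Q then - (x0 * y1) else 0) + (if V1 + W0 = Q then x1 * y0 else 0)) \<noteq> (0::complex)"
    unfolding of_int_eq_0_iff .
  then have "(if \<sigma> + U = Q then of_int 1000 else 0) + (if V0 + W1 = Q then of_int (- (x0 * y1)) else 0) + (if V1 + W0 = Q then of_int (x1 * y0) else 0) \<noteq> (0::complex)"
    by (simp only: of_int_add if_distrib[of of_int] of_int_0 not_False_eq_True simp_thms)
  note ne = this
  have "hasval (s * tpow U 1 + - (v0 * w1) + v1 * w0) Q" by (rule hasval_sum3[OF L Q]) (rule ne)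
  then show ?thesis by simp
qed

lemma ereal_sum_finite:
  fixes a b c :: ereal
  shows "a + b < c \<Longrightarrow> a \<noteq> -\<infinity> \<Longrightarrow> b \<noteq> -\<infinity> \<Longrightarrow> \<exists>x y. a = ereal x \<and> b = ereal y"
  by (cases a; cases b; auto)

text \<open>If the leading coefficients of \<open>(v0, v1)\<close> and \<open>(w0, w1)\<close> are both forced to be proportional
  to \<open>(u1, -u0)\<close>, then the minor \<open>v0 w1 - v1 w0\<close> cannot have the expected valuation; the last
  hypothesis, a tropical Wick relation, excludes this.\<close>
lemma forced_contradiction:
  fixes U0 :: ereal
  assumes ni: "U0 \<noteq> -\<infinity>" "U1 \<noteq> -\<infinity>" "U2 \<noteq> -\<infinity>" "V0 \<noteq> -\<infinity>" "V1 \<noteq> -\<infinity>" "V2 \<noteq> -\<infinity>"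
      "W0 \<noteq> -\<infinity>" "W1 \<noteq> -\<infinity>" "W2 \<noteq> -\<infinity>" "\<sigma> \<noteq> -\<infinity>" "\<alpha> \<noteq> -\<infinity>" "\<beta> \<noteq> -\<infinity>"
    and v: "U0 + V0 = m" "U1 + V1 = m" "m < U2 + V2" "m < \<alpha>"
    and w: "U0 + W0 = k" "U1 + W1 = k" "k < U2 + W2" "k < \<beta>"
    and lt: "V0 + W1 < \<sigma> + U2"
    and Q2: "Q2 = min (\<sigma> + U2) (min (V0 + W1) (V1 + W0))"
    and Q1: "Q1 = min (\<sigma> + U1) (min (V2 + W0) (V0 + W2))"
    and tz: "tropical_zero4 (U1 + Q2) (U2 + Q1) (\<alpha> + W0) (\<beta> + V0)"
  shows False
proof -
  obtain u0 v0 u1 v1 w0 w1 where r: "U0 = ereal u0" "V0 = ereal v0" "U1 = ereal u1" "V1 = ereal v1"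
    "W0 = ereal w0" "W1 = ereal w1"
    using ereal_sum_finite[of U0 V0 \<alpha>] ereal_sum_finite[of U1 V1 \<alpha>] ereal_sum_finite[of U0 W0 \<beta>]
      ereal_sum_finite[of U1 W1 \<beta>] v w ni by auto
  \<comment> \<open>Both terms of the minor have the same valuation, and it equals \<open>Q2\<close>
    because the term with \<open>\<sigma>\<close> lies higher. The first entry of \<open>tz\<close>
    is therefore \<open>u1 + v0 + w1\<close>, and the strict hypotheses push the other three above
    it.\<close>
  have "U1 + Q2 < U2 + Q1 \<and> U1 + Q2 < \<alpha> + W0 \<and> U1 + Q2 < \<beta> + V0"
  proof -
    have mk: "m = ereal (u0 + v0)" "k = ereal (u0 + w0)" "u1 + v1 = u0 + v0" "u1 + w1 = u0 + w0"
      using v w r by auto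
    have eq: "V0 + W1 = ereal (v0 + w1)" "V1 + W0 = ereal (v0 + w1)" using r mk by simp_all
    have Q2': "Q2 = ereal (v0 + w1)" unfolding Q2 eq using lt r by (auto simp: min_def dest: leD)
    have 1: "ereal (u1 + (v0 + w1)) < \<alpha> + W0" "ereal (u1 + (v0 + w1)) < \<beta> + V0"
      using v(4) w(4) mk r ni by (cases \<alpha>; cases \<beta>; auto)+
    have "ereal (u1 + (v0 + w1)) < U2 + (\<sigma> + U1)"
      using lt ni r by (cases U2; cases \<sigma>; auto)
    moreover have "ereal (u1 + (v0 + w1)) < U2 + (V2 + W0)"
      using v(3) mk ni r by (cases U2; cases V2; auto)
    moreover have "ereal (u1 + (v0 + w1)) < U2 + (V0 + W2)"
      using w(3) mk ni r by (cases U2; cases W2; auto)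
    ultimately have "ereal (u1 + (v0 + w1)) < U2 + Q1" unfolding Q1 by (auto simp: min_def)
    then show ?thesis using 1 Q2' r by simp
  qed
  then show False using tz unfolding tropical_zero4_def by blast
qed

text \<open>The two equations are solved separately and interact only through leading coefficients
  in the minors. The hypotheses are invariant under rotating the indices 0, 1, 2, so
  \<open>forced_contradiction\<close> treats each minor with the matching relation
  \<open>r0\<close>, \<open>r1\<close> or \<open>r2\<close>.\<close>

lemma lift_core:
  assumes ni: "U0 \<noteq> -\<infinity>" "U1 \<noteq> -\<infinity>" "U2 \<noteq> -\<infinity>" "V0 \<noteq> -\<infinity>" "V1 \<noteq> -\<infinity>" "V2 \<noteq> -\<infinity>"
      "W0 \<noteq> -\<infinity>" "W1 \<noteq> -\<infinity>" "W2 \<noteq> -\<infinity>" "\<sigma> \<noteq> -\<infinity>" "\<alpha> \<noteq> -\<infinity>" "\<beta> \<noteq> -\<infinity>"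
    and tzv: "tropical_zero4 \<alpha> (U0 + V0) (U1 + V1) (U2 + V2)" and tzw: "tropical_zero4 \<beta> (U0 + W0) (U1 + W1) (U2 + W2)"
    and Q0: "Q0 = min (\<sigma> + U0) (min (V1 + W2) (V2 + W1))"
    and Q1: "Q1 = min (\<sigma> + U1) (min (V2 + W0) (V0 + W2))"
    and Q2: "Q2 = min (\<sigma> + U2) (min (V0 + W1) (V1 + W0))"
    and r0: "tropical_zero4 (U1 + Q2) (U2 + Q1) (\<alpha> + W0) (\<beta> + V0)"
    and r1: "tropical_zero4 (U2 + Q0) (U0 + Q2) (\<alpha> + W1) (\<beta> + V1)"
    and r2: "tropical_zero4 (U0 + Q1) (U1 + Q0) (\<alpha> + W2) (\<beta> + V2)"
  shows "\<exists>u0 u1 u2 v0 v1 v2 w0 w1 w2 s. hasval u0 U0 \<and> hasval u1 U1 \<and> hasval u2 U2 \<and>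
    hasval v0 V0 \<and> hasval v1 V1 \<and> hasval v2 V2 \<and> hasval w0 W0 \<and> hasval w1 W1 \<and> hasval w2 W2 \<and> hasval s \<sigma> \<and>
    hasval (u0 * v0 + u1 * v1 + u2 * v2) \<alpha> \<and> hasval (u0 * w0 + u1 * w1 + u2 * w2) \<beta> \<and>
    hasval (s * u0 - v1 * w2 + v2 * w1) Q0 \<and> hasval (s * u1 - v2 * w0 + v0 * w2) Q1 \<and>
    hasval (s * u2 - v0 * w1 + v1 * w0) Q2"
proof -
  define m where "m = min (U0 + V0) (min (U1 + V1) (U2 + V2))"
  define k where "k = min (U0 + W0) (min (U1 + W1) (U2 + W2))"
  have mle: "m \<le> U0 + V0" "m \<le> U1 + V1" "m \<le> U2 + V2" by (auto simp: m_def min_le_iff_disj)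
  have kle: "k \<le> U0 + W0" "k \<le> U1 + W1" "k \<le> U2 + W2" by (auto simp: k_def min_le_iff_disj)
  have cm: "(U0 + V0 = m \<and> U1 + V1 = m) \<or> (U0 + V0 = m \<and> U2 + V2 = m) \<or> (U1 + V1 = m \<and> U2 + V2 = m)" if "m < \<alpha>"
    using tzv that unfolding tropical_zero4_def m_def by (auto simp: min_def not_less split: if_splits)
  have ck: "(U0 + W0 = k \<and> U1 + W1 = k) \<or> (U0 + W0 = k \<and> U2 + W2 = k) \<or> (U1 + W1 = k \<and> U2 + W2 = k)" if "k < \<beta>"
    using tzw that unfolding tropical_zero4_def k_def by (auto simp: min_def not_less split: if_splits)
  obtain x0 x1 x2 y0 y1 y2 where
    gx: "good_coeffs (m < \<alpha>) (U0 + V0 = m) (U1 + V1 = m) (U2 + V2 = m) x0 x1 x2" and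
    gy: "good_coeffs (k < \<beta>) (U0 + W0 = k) (U1 + W1 = k) (U2 + W2 = k) y0 y1 y2" and
    f2: "x0 * y1 = x1 * y0 \<longrightarrow> m < \<alpha> \<and> U0 + V0 = m \<and> U1 + V1 = m \<and> U2 + V2 \<noteq> m \<and>
      k < \<beta> \<and> U0 + W0 = k \<and> U1 + W1 = k \<and> U2 + W2 \<noteq> k" and
    f0: "x1 * y2 = x2 * y1 \<longrightarrow> m < \<alpha> \<and> U1 + V1 = m \<and> U2 + V2 = m \<and> U0 + V0 \<noteq> m \<and>
      k < \<beta> \<and> U1 + W1 = k \<and> U2 + W2 = k \<and> U0 + W0 \<noteq> k" and
    f1: "x2 * y0 = x0 * y2 \<longrightarrow> m < \<alpha> \<and> U2 + V2 = m \<and> U0 + V0 = m \<and> U1 + V1 \<noteq> m \<and>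
      k < \<beta> \<and> U2 + W2 = k \<and> U0 + W0 = k \<and> U1 + W1 \<noteq> k" and
    bound: "\<forall>x\<in>{x0, x1, x2}. \<forall>y\<in>{y0, y1, y2}. \<bar>x * y\<bar> \<le> 245"
    by (rule generic_coeffs[of "m < \<alpha>" "U0 + V0 = m" "U1 + V1 = m" "U2 + V2 = m"
        "k < \<beta>" "U0 + W0 = k" "U1 + W1 = k" "U2 + W2 = k"]; (erule cm | erule ck | (rule that; assumption)))
  have nz: "x0 \<noteq> 0" "x1 \<noteq> 0" "x2 \<noteq> 0" "y0 \<noteq> 0" "y1 \<noteq> 0" "y2 \<noteq> 0"
    using gx gy by (auto simp: good_coeffs_def)
  obtain v0 v1 v2 where v: "lead v0 V0 (of_int x0)" "lead v1 V1 (of_int x1)" "lead v2 V2 (of_int x2)"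
    "hasval (tpow U0 1 * v0 + tpow U1 1 * v1 + tpow U2 1 * v2) \<alpha>"
    using lift_dot_product[OF ni(1-6,11) tzv m_def gx] by blast
  obtain w0 w1 w2 where w: "lead w0 W0 (of_int y0)" "lead w1 W1 (of_int y1)" "lead w2 W2 (of_int y2)"
    "hasval (tpow U0 1 * w0 + tpow U1 1 * w1 + tpow U2 1 * w2) \<beta>"
    using lift_dot_product[OF ni(1-3,7-9,12) tzw k_def gy] by blast
  define s where "s = tpow \<sigma> 1000"
  have s: "lead s \<sigma> 1000" using ni by (simp add: s_def lead_tpow)
  have n2: "x0 * y1 \<noteq> x1 * y0" if "V0 + W1 < \<sigma> + U2"
  proof
    assume "x0 * y1 = x1 * y0"
    with f2 have f: "m < \<alpha>" "U0 + V0 = m" "U1 + V1 = m" "U2 + V2 \<noteq> m" "k < \<beta>" "U0 + W0 = k" "U1 + W1 = k" "U2 + W2 \<noteq> k"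
      by blast+
    have "m < U2 + V2" "k < U2 + W2" using f mle kle by simp_all
    with forced_contradiction[OF ni f(2,3) _ f(1) f(6,7) _ f(5) that Q2 Q1 r0] show False by blast
  qed
  have n0: "x1 * y2 \<noteq> x2 * y1" if "V1 + W2 < \<sigma> + U0"
  proof
    assume "x1 * y2 = x2 * y1"
    with f0 have f: "m < \<alpha>" "U1 + V1 = m" "U2 + V2 = m" "U0 + V0 \<noteq> m" "k < \<beta>" "U1 + W1 = k" "U2 + W2 = k" "U0 + W0 \<noteq> k"
      by blast+
    have "m < U0 + V0" "k < U0 + W0" using f mle kle by simp_all
    with forced_contradiction[OF ni(2,3,1,5,6,4,8,9,7,10-12) f(2,3) _ f(1) f(6,7) _ f(5) that Q0 Q2 r1] show False by blast
  qed
  have n1: "x2 * y0 \<noteq> x0 * y2" if "V2 + W0 < \<sigma> + U1"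
  proof
    assume "x2 * y0 = x0 * y2"
    with f1 have f: "m < \<alpha>" "U2 + V2 = m" "U0 + V0 = m" "U1 + V1 \<noteq> m" "k < \<beta>" "U2 + W2 = k" "U0 + W0 = k" "U1 + W1 \<noteq> k"
      by blast+
    have "m < U1 + V1" "k < U1 + W1" using f mle kle by simp_all
    with forced_contradiction[OF ni(3,1,2,6,4,5,9,7,8,10-12) f(2,3) _ f(1) f(6,7) _ f(5) that Q1 Q0 r2] show False by blast
  qed
  have "hasval (s * tpow U0 1 - v1 * w2 + v2 * w1) Q0"
    by (rule hasval_minor[OF s v(2,3) w(2,3) ni(1) nz(2,3,5,6) _ _ Q0]) (use bound n0 in auto)
  moreover have "hasval (s * tpow U1 1 - v2 * w0 + v0 * w2) Q1"
    by (rule hasval_minor[OF s v(3,1) w(3,1) ni(2) nz(3,1,6,4) _ _ Q1]) (use bound n1 in auto)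
  moreover have "hasval (s * tpow U2 1 - v0 * w1 + v1 * w0) Q2"
    by (rule hasval_minor[OF s v(1,2) w(1,2) ni(3) nz(1,2,4,5) _ _ Q2]) (use bound n2 in auto)
  moreover have "hasval (tpow U0 1) U0" "hasval (tpow U1 1) U1" "hasval (tpow U2 1) U2" "hasval s \<sigma>"
    using ni s by (auto intro: lead_hasval lead_tpow)
  moreover have "hasval v0 V0" "hasval v1 V1" "hasval v2 V2" "hasval w0 W0" "hasval w1 W1" "hasval w2 W2"
    using v w nz by (auto intro: lead_hasval)
  ultimately show ?thesis using v(4) w(4) by blast
qed

section \<open>Pfaffians satisfy the Wick relations\<close>

text \<open>Five indices admit nonzero Pfaffians of size 0, 2 and 4 only; the last clause supplies
  the zeros for odd length.\<close>

fun pf :: "(nat \<Rightarrow> nat \<Rightarrow> nov) \<Rightarrow> nat list \<Rightarrow> nov" where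
  "pf A [] = 1"
| "pf A [i, j] = A i j"
| "pf A [i, j, k, l] = A i j * A k l - A i k * A j l + A i l * A j k"
| "pf A _ = 0"

definition pfW :: "(nat \<Rightarrow> nat \<Rightarrow> nov) \<Rightarrow> nat set \<Rightarrow> nov" where
  "pfW A S = pf A (filter (\<lambda>i. i \<in> S) [1, 2, 3, 4, 5])"

lemma symd_filter:
  assumes "S \<subseteq> {1..5}" "T \<subseteq> {1..5}"
  shows "symd S T = set (filter (\<lambda>i. i \<in> S \<longleftrightarrow> i \<notin> T) [1, 2, 3, 4, 5])"
proof -
  have "set [1, 2, 3, 4, 5] = {1..5::nat}" by auto
  moreover have "symd S T = {i \<in> {1..5}. i \<in> S \<longleftrightarrow> i \<notin> T}"
    using assms by (auto simp: symd_def)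
  ultimately show ?thesis by (simp only: set_filter)
qed

lemma wick_coeff_filter:
  assumes "S \<subseteq> {1..5}" "T \<subseteq> {1..5}"
  shows "wick_coeff S T i = (-1) ^ length (filter (\<lambda>j. (j \<in> S \<longleftrightarrow> j \<notin> T) \<and> j < i) [1, 2, 3, 4, 5])"
proof -
  have "{j \<in> symd S T. j < i} = set (filter (\<lambda>j. (j \<in> S \<longleftrightarrow> j \<notin> T) \<and> j < i) [1, 2, 3, 4, 5])"
    unfolding symd_filter[OF assms] by (simp only: set_filter mem_Collect_eq) blast
  also have "card \<dots> = length (filter (\<lambda>j. (j \<in> S \<longleftrightarrow> j \<notin> T) \<and> j < i) [1, 2, 3, 4, 5])"
    by (rule distinct_card) simp
  finally show ?thesis by (simp only: wick_coeff_def)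
qed

definition pf_bits :: "(nat \<Rightarrow> nat \<Rightarrow> nov) \<Rightarrow> bool \<Rightarrow> bool \<Rightarrow> bool \<Rightarrow> bool \<Rightarrow> bool \<Rightarrow> nov" where
  "pf_bits A s1 s2 s3 s4 s5 = pf A ((if s1 then [1] else []) @ (if s2 then [2] else []) @ (if s3 then [3] else [])
     @ (if s4 then [4] else []) @ (if s5 then [5] else []))"

lemma pfW_pf_bits: "pfW A S = pf_bits A (1 \<in> S) (2 \<in> S) (3 \<in> S) (4 \<in> S) (5 \<in> S)"
  unfolding pfW_def pf_bits_def by (rule arg_cong[where f = "pf A"]) simp

lemma pf_bits_simps:
  "pf_bits A False False False False False = 1"
  "pf_bits A False False False False True = 0"
  "pf_bits A False False False True False = 0"
  "pf_bits A False False False True True = A 4 5"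
  "pf_bits A False False True False False = 0"
  "pf_bits A False False True False True = A 3 5"
  "pf_bits A False False True True False = A 3 4"
  "pf_bits A False False True True True = 0"
  "pf_bits A False True False False False = 0"
  "pf_bits A False True False False True = A 2 5"
  "pf_bits A False True False True False = A 2 4"
  "pf_bits A False True False True True = 0"
  "pf_bits A False True True False False = A 2 3"
  "pf_bits A False True True False True = 0"
  "pf_bits A False True True True False = 0"
  "pf_bits A False True True True True = A 2 3 * A 4 5 - A 2 4 * A 3 5 + A 2 5 * A 3 4"
  "pf_bits A True False False False False = 0"
  "pf_bits A True False False False True = A 1 5"
  "pf_bits A True False False True False = A 1 4"
  "pf_bits A True False False True True = 0"
  "pf_bits A True False True False False = A 1 3"
  "pf_bits A True False True False True = 0"
  "pf_bits A True False True True False = 0"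
  "pf_bits A True False True True True = A 1 3 * A 4 5 - A 1 4 * A 3 5 + A 1 5 * A 3 4"
  "pf_bits A True True False False False = A 1 2"
  "pf_bits A True True False False True = 0"
  "pf_bits A True True False True False = 0"
  "pf_bits A True True False True True = A 1 2 * A 4 5 - A 1 4 * A 2 5 + A 1 5 * A 2 4"
  "pf_bits A True True True False False = 0"
  "pf_bits A True True True False True = A 1 2 * A 3 5 - A 1 3 * A 2 5 + A 1 5 * A 2 3"
  "pf_bits A True True True True False = A 1 2 * A 3 4 - A 1 3 * A 2 4 + A 1 4 * A 2 3"
  "pf_bits A True True True True True = 0"
  by (simp_all add: pf_bits_def del: One_nat_def)

text \<open>The sign of a term is a product of one factor -1 for each smaller index in the symmetric
  difference, which gives the relation a nested Horner form. Each of the \<open>2 ^ 10\<close>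
  choices of membership bits is a polynomial identity in the entries above the diagonal.\<close>

lemma pf_bits_wick:
  "(if s1 = (\<not> t1) then pf_bits A (\<not> s1) s2 s3 s4 s5 * pf_bits A (\<not> t1) t2 t3 t4 t5 else 0) +
   (if s1 = (\<not> t1) then -1 else 1) * ((if s2 = (\<not> t2) then pf_bits A s1 (\<not> s2) s3 s4 s5 * pf_bits A t1 (\<not> t2) t3 t4 t5 else 0) +
   (if s2 = (\<not> t2) then -1 else 1) * ((if s3 = (\<not> t3) then pf_bits A s1 s2 (\<not> s3) s4 s5 * pf_bits A t1 t2 (\<not> t3) t4 t5 else 0) +
   (if s3 = (\<not> t3) then -1 else 1) * ((if s4 = (\<not> t4) then pf_bits A s1 s2 s3 (\<not> s4) s5 * pf_bits A t1 t2 t3 (\<not> t4) t5 else 0) +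
   (if s4 = (\<not> t4) then -1 else 1) * (if s5 = (\<not> t5) then pf_bits A s1 s2 s3 s4 (\<not> s5) * pf_bits A t1 t2 t3 t4 (\<not> t5) else 0)))) = 0"
  by (cases s1; (cases s2; (cases s3; (cases s4; (cases s5; (cases t1; (cases t2; (cases t3; (cases t4; (cases t5;
      (simp only: simp_thms if_True if_False; simp add: pf_bits_simps algebra_simps del: One_nat_def)))))))))))

lemma set_wick_pfW: "set_wick 5 (pfW A)"
  unfolding set_wick_def
proof (intro allI impI)
  fix S T :: "nat set" assume ST: "S \<subseteq> {1..5}" "T \<subseteq> {1..5}"
  let ?X = "\<lambda>i. pfW A (symd S {i}) * pfW A (symd T {i})"
  let ?d = "\<lambda>i. (i \<in> S) = (i \<notin> T)"
  let ?e = "\<lambda>i. if ?d i then -1 else (1::nov)"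
  have five: "{1..5} = {1, 2, 3, 4, 5::nat}" by auto
  have "symd S T = {i \<in> {1..5}. ?d i}" using ST by (auto simp: symd_def)
  then have "(\<Sum>i\<in>symd S T. of_int (wick_coeff S T i) * ?X i) =
      (\<Sum>i\<in>{1..5}. if ?d i then of_int (wick_coeff S T i) * ?X i else 0)"
    by (simp only: sum.inter_filter finite_atLeastAtMost)
  also have "\<dots> = (\<Sum>i\<in>{1, 2, 3, 4, 5}. of_int (wick_coeff S T i) * (if ?d i then ?X i else 0))"
    unfolding five by (rule sum.cong) simp_all
  also have "\<dots> = of_int (wick_coeff S T 1) * (if ?d 1 then ?X 1 else 0) + (of_int (wick_coeff S T 2) * (if ?d 2 then ?X 2 else 0)
     + (of_int (wick_coeff S T 3) * (if ?d 3 then ?X 3 else 0) + (of_int (wick_coeff S T 4) * (if ?d 4 then ?X 4 else 0)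
     + of_int (wick_coeff S T 5) * (if ?d 5 then ?X 5 else 0))))"
    by (simp del: One_nat_def)
  also have "\<dots> = (if ?d 1 then ?X 1 else 0) + ?e 1 * ((if ?d 2 then ?X 2 else 0) + ?e 2 * ((if ?d 3 then ?X 3 else 0)
     + ?e 3 * ((if ?d 4 then ?X 4 else 0) + ?e 4 * (if ?d 5 then ?X 5 else 0))))"
  proof -
    have c: "of_int (wick_coeff S T 1) = (1::nov)" "of_int (wick_coeff S T 2) = ?e 1"
      "of_int (wick_coeff S T 3) = ?e 1 * ?e 2" "of_int (wick_coeff S T 4) = ?e 1 * (?e 2 * ?e 3)"
      "of_int (wick_coeff S T 5) = ?e 1 * (?e 2 * (?e 3 * ?e 4))"
      unfolding wick_coeff_filter[OF ST] by (simp_all del: One_nat_def)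
    show ?thesis unfolding c by (simp only: distrib_left mult.assoc mult_1_left)
  qed
  also have "\<dots> = 0"
  proof -
    have "pfW A (symd U {1}) = pf_bits A (1 \<notin> U) (2 \<in> U) (3 \<in> U) (4 \<in> U) (5 \<in> U)"
      "pfW A (symd U {2}) = pf_bits A (1 \<in> U) (2 \<notin> U) (3 \<in> U) (4 \<in> U) (5 \<in> U)"
      "pfW A (symd U {3}) = pf_bits A (1 \<in> U) (2 \<in> U) (3 \<notin> U) (4 \<in> U) (5 \<in> U)"
      "pfW A (symd U {4}) = pf_bits A (1 \<in> U) (2 \<in> U) (3 \<in> U) (4 \<notin> U) (5 \<in> U)"
      "pfW A (symd U {5}) = pf_bits A (1 \<in> U) (2 \<in> U) (3 \<in> U) (4 \<in> U) (5 \<notin> U)" for U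
      by (simp_all add: pfW_pf_bits symd_simps del: One_nat_def)
    then show ?thesis by (simp only: pf_bits_wick)
  qed
  finally show "(\<Sum>i\<in>symd S T. of_int (wick_coeff S T i) * ?X i) = 0" .
qed

section \<open>Valuations of sub-Pfaffians\<close>

definition pf4 :: "(nat \<Rightarrow> nat \<Rightarrow> nov) \<Rightarrow> nat \<Rightarrow> nat \<Rightarrow> nat \<Rightarrow> nat \<Rightarrow> nov" where
  "pf4 A i j k l = A i j * A k l - A i k * A j l + A i l * A j k"

lemma hasval_uminus: "hasval (- f) v \<longleftrightarrow> hasval f v"
  by (cases v) auto

lemma set3_cases:
  assumes "{x, y, z} = {a, b, c}" "distinct [x, y, z]" "distinct [a, b, c]"
  shows "x = a \<and> (y = b \<and> z = c \<or> y = c \<and> z = b) \<or> x = b \<and> (y = a \<and> z = c \<or> y = c \<and> z = a) \<or>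
    x = c \<and> (y = a \<and> z = b \<or> y = b \<and> z = a)"
proof -
  have "{y, z} = {a, b, c} - {x}" using assms(1,2) by auto
  moreover have "x = a \<or> x = b \<or> x = c" using assms(1) by blast
  moreover have "{a, b, c} - {a} = {b, c}" "{a, b, c} - {b} = {a, c}" "{a, b, c} - {c} = {a, b}"
    using assms(3) by auto
  ultimately show ?thesis by (metis doubleton_eq_iff)
qed

lemma set4_cases:
  assumes "{w, x, y, z} = {a, b, c, d}" "distinct [w, x, y, z]" "distinct [a, b, c, d]"
  shows "w = a \<and> {x, y, z} = {b, c, d} \<or> w = b \<and> {x, y, z} = {a, c, d} \<or>
    w = c \<and> {x, y, z} = {a, b, d} \<or> w = d \<and> {x, y, z} = {a, b, c}"
proof -
  have "{x, y, z} = {a, b, c, d} - {w}" using assms(1,2) by auto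
  moreover have "w = a \<or> w = b \<or> w = c \<or> w = d" using assms(1) by blast
  moreover have "{a, b, c, d} - {a} = {b, c, d}" "{a, b, c, d} - {b} = {a, c, d}" "{a, b, c, d} - {c} = {a, b, d}"
    "{a, b, c, d} - {d} = {a, b, c}"
    using assms(3) by auto
  ultimately show ?thesis by metis
qed

text \<open>A permutation of the indices changes a Pfaffian at most by a sign, which valuations
  ignore. The lift is built along an arbitrary ordering of the five indices, whereas
  \<open>pfW\<close> uses the increasing one.\<close>

lemma hasval_pf4_perm:
  assumes skew: "\<And>x y. A y x = - A x y" and "distinct [i, j, k, l]" "distinct [i', j', k', l']"
    and eq: "{i', j', k', l'} = {i, j, k, l}" and v: "hasval (pf4 A i j k l) v"
  shows "hasval (pf4 A i' j' k' l') v"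
proof -
  note sk = skew[of i j] skew[of i k] skew[of i l] skew[of j k] skew[of j l] skew[of k l]
  have "distinct [j', k', l']" "distinct [j, k, l]" "distinct [i, k, l]" "distinct [i, j, l]" "distinct [i, j, k]"
    using assms(2,3) by auto
  note three = set3_cases[OF _ this(1) this(2)] set3_cases[OF _ this(1) this(3)]
    set3_cases[OF _ this(1) this(4)] set3_cases[OF _ this(1) this(5)]
  have "pf4 A i' j' k' l' = pf4 A i j k l \<or> pf4 A i' j' k' l' = - pf4 A i j k l"
    using set4_cases[OF eq assms(3,2)]
  proof (elim disjE conjE)
    assume "i' = i" "{j', k', l'} = {j, k, l}"
    from three(1)[OF this(2)] this(1) show ?thesis using sk unfolding pf4_def by (elim disjE conjE) (simp_all add: algebra_simps)
  next
    assume "i' = j" "{j', k', l'} = {i, k, l}"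
    from three(2)[OF this(2)] this(1) show ?thesis using sk unfolding pf4_def by (elim disjE conjE) (simp_all add: algebra_simps)
  next
    assume "i' = k" "{j', k', l'} = {i, j, l}"
    from three(3)[OF this(2)] this(1) show ?thesis using sk unfolding pf4_def by (elim disjE conjE) (simp_all add: algebra_simps)
  next
    assume "i' = l" "{j', k', l'} = {i, j, k}"
    from three(4)[OF this(2)] this(1) show ?thesis using sk unfolding pf4_def by (elim disjE conjE) (simp_all add: algebra_simps)
  qed
  then show ?thesis using v by (auto simp: hasval_uminus)
qed

lemma hasval_pfW:
  assumes "S \<subseteq> {1..5}" and q0: "q {} = 0"
    and hA: "\<And>i j. i \<in> {1..5} \<Longrightarrow> j \<in> {1..5} \<Longrightarrow> i \<noteq> j \<Longrightarrow> hasval (A i j) (q {i, j})"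
    and hP: "\<And>i j k l. {i, j, k, l} \<subseteq> {1..5} \<Longrightarrow> distinct [i, j, k, l] \<Longrightarrow> hasval (pf4 A i j k l) (q {i, j, k, l})"
    and odd: "\<And>S. S \<subseteq> {1..5} \<Longrightarrow> odd (card S) \<Longrightarrow> q S = \<infinity>"
  shows "hasval (pfW A S) (q S)"
proof -
  define L where "L = filter (\<lambda>i. i \<in> S) [1, 2, 3, 4, 5]"
  have "set [1, 2, 3, 4, 5] = {1..5::nat}" by auto
  then have S: "S = set L"
    unfolding L_def set_filter using assms(1) by blast
  have pL: "pfW A S = pf A L" by (simp add: pfW_def L_def)
  have dL: "distinct L" by (simp add: L_def)
  have cL: "card S = length L" unfolding S by (rule distinct_card[OF dL])
  have sub: "set L \<subseteq> {1..5}" using S assms(1) by simp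
  have "length L \<le> 5" unfolding L_def by (rule order_trans[OF length_filter_le]) simp
  then have "odd (length L) \<or> length L = 0 \<or> length L = 2 \<or> length L = 4" by presburger
  then consider "odd (length L)" | "length L = 0 \<or> length L = 2 \<or> length L = 4" by blast
  then have "hasval (pf A L) (q (set L))"
  proof cases
    case 1
    moreover have "pf A xs = 0" if "odd (length xs)" for xs
      using that by (induction A xs rule: pf.induct) auto
    ultimately show ?thesis using odd[OF assms(1)] cL S by simp
  next
    case 2
    then show ?thesis
    proof (elim disjE)
      assume "length L = 0" then show ?thesis by (simp add: q0 hasval_one)
    next
      assume "length L = 2"
      then obtain i j where "L = [i, j]" by (auto simp: length_Suc_conv numeral_eq_Suc)
      then show ?thesis using hA[of i j] sub dL by simp
    next
      assume "length L = 4"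
      then obtain i j k l where "L = [i, j, k, l]" by (auto simp: length_Suc_conv numeral_eq_Suc)
      then show ?thesis using hP[of i j k l] sub dL by (simp add: pf4_def)
    qed
  qed
  then show ?thesis by (simp only: pL S[symmetric])
qed

lemma tropical_zero4_eq_min: "tropical_zero4 a b c d \<Longrightarrow> a \<le> b \<Longrightarrow> a \<le> c \<Longrightarrow> a \<le> d \<Longrightarrow> a = min b (min c d)"
  unfolding tropical_zero4_def by (auto simp: min_def)

text \<open>The Pfaffians avoiding \<open>e\<close> or \<open>f\<close> may have to cancel; those
  avoiding \<open>a\<close>, \<open>b\<close> or \<open>c\<close> need not, by \<open>good\<close>.
  The skew block on \<open>a, b, c\<close> is read as the vector
  \<open>u = (A b c, A c a, A a b)\<close>, the columns \<open>e\<close> and \<open>f\<close> as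
  \<open>v\<close> and \<open>w\<close>, and \<open>s = A e f\<close>. The Pfaffian avoiding
  \<open>f\<close> is then \<open>u . v\<close>, and the one avoiding \<open>e\<close> is
  \<open>u . w\<close>.\<close>

lemma pfaffian_lift:
  fixes q :: "nat set \<Rightarrow> ereal"
  assumes q0: "q {} = 0" and qn: "\<And>S. q S \<noteq> -\<infinity>"
    and odd: "\<And>S. S \<subseteq> {1..5} \<Longrightarrow> odd (card S) \<Longrightarrow> q S = \<infinity>"
    and H: "\<And>S T. S \<subseteq> {1..5} \<Longrightarrow> T \<subseteq> {1..5} \<Longrightarrow>
      min_twice (\<lambda>i. q (symd S {i}) + q (symd T {i})) (symd S T)"
    and elems: "distinct [a, b, c, e, f]" "{a, b, c, e, f} = {1..5}"
    and good: "\<And>r d1 d2 d3 d4. r \<in> {a, b, c} \<Longrightarrow> distinct [r, d1, d2, d3, d4] \<Longrightarrow> {r, d1, d2, d3, d4} = {1..5} \<Longrightarrow>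
      q ({1..5} - {r}) \<le> q {d1, d2} + q {d3, d4}"
  shows "\<exists>A. \<forall>S\<subseteq>{1..5}. hasval (pfW A S) (q S)"
proof -
  \<comment> \<open>The relation of \<open>{d1}\<close> and \<open>{d2, d3, d4}\<close>: index
    \<open>d1\<close> contributes \<open>q {} = 0\<close> plus the value on the 4-set, the other
    indices the three terms of its Pfaffian.\<close>
  have C: "tropical_zero4 (q ({1..5} - {r})) (q {d1, d2} + q {d3, d4}) (q {d1, d3} + q {d2, d4}) (q {d1, d4} + q {d2, d3})"
    if d: "distinct [r, d1, d2, d3, d4]" "{r, d1, d2, d3, d4} = {1..5}" for r d1 d2 d3 d4
  proof -
    have "symd {d1} {d2, d3, d4} = {d1, d2, d3, d4}" using d(1) by (auto simp: symd_def)
    moreover have "{d1} \<subseteq> {1..5}" "{d2, d3, d4} \<subseteq> {1..5}" using d(2) by auto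
    ultimately have "min_twice (\<lambda>i. q (symd {d1} {i}) + q (symd {d2, d3, d4} {i})) {d1, d2, d3, d4}"
      using H[of "{d1}" "{d2, d3, d4}"] by simp
    then have "tropical_zero4 (q (symd {d1} {d1}) + q (symd {d2, d3, d4} {d1})) (q (symd {d1} {d2}) + q (symd {d2, d3, d4} {d2}))
      (q (symd {d1} {d3}) + q (symd {d2, d3, d4} {d3})) (q (symd {d1} {d4}) + q (symd {d2, d3, d4} {d4}))"
      by (rule min_twice_tropical_zero4)
    moreover have "symd {d1} {d1} = {}" "symd {d2, d3, d4} {d1} = {1..5} - {r}"
      "symd {d1} {d2} = {d1, d2}" "symd {d2, d3, d4} {d2} = {d3, d4}"
      "symd {d1} {d3} = {d1, d3}" "symd {d2, d3, d4} {d3} = {d2, d4}"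
      "symd {d1} {d4} = {d1, d4}" "symd {d2, d3, d4} {d4} = {d2, d3}"
      unfolding d(2)[symmetric] using d(1) by (auto simp: symd_def)
    ultimately show ?thesis by (simp only: q0 add_0_left)
  qed
  \<comment> \<open>The relation of \<open>{r}\<close> and the full set links 4-sets to the pairs
    through \<open>r\<close>; for \<open>r\<close> among \<open>a, b, c\<close> it yields
    \<open>r0\<close>, \<open>r1\<close>, \<open>r2\<close> of \<open>lift_core\<close>.\<close>
  have R: "tropical_zero4 (q {r, d1} + q ({1..5} - {d1})) (q {r, d2} + q ({1..5} - {d2}))
      (q {r, d3} + q ({1..5} - {d3})) (q {r, d4} + q ({1..5} - {d4}))"
    if d: "distinct [r, d1, d2, d3, d4]" "{r, d1, d2, d3, d4} = {1..5}" for r d1 d2 d3 d4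
  proof -
    have "symd {r} {1..5} = {d1, d2, d3, d4}" unfolding d(2)[symmetric] using d(1) by (auto simp: symd_def)
    moreover have "{r} \<subseteq> {1..5}" using d(2) by auto
    ultimately have "min_twice (\<lambda>i. q (symd {r} {i}) + q (symd {1..5} {i})) {d1, d2, d3, d4}"
      using H[of "{r}" "{1..5}"] by simp
    then have "tropical_zero4 (q (symd {r} {d1}) + q (symd {1..5} {d1})) (q (symd {r} {d2}) + q (symd {1..5} {d2}))
      (q (symd {r} {d3}) + q (symd {1..5} {d3})) (q (symd {r} {d4}) + q (symd {1..5} {d4}))"
      by (rule min_twice_tropical_zero4)
    moreover have "symd {r} {d} = {r, d}" "symd {1..5} {d} = {1..5} - {d}" if "d \<in> {d1, d2, d3, d4}" for d
      unfolding d(2)[symmetric] using d(1) that by (auto simp: symd_def)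
    ultimately show ?thesis by simp
  qed
  have ne: "a \<noteq> b" "a \<noteq> c" "a \<noteq> e" "a \<noteq> f" "b \<noteq> c" "b \<noteq> e" "b \<noteq> f" "c \<noteq> e" "c \<noteq> f" "e \<noteq> f"
    using elems(1) by auto
  note ne' = ne ne[symmetric]
  have perm: "{x1, x2, x3, x4, x5} = {1..5}" if "{x1, x2, x3, x4, x5} = {a, b, c, e, f}" for x1 x2 x3 x4 x5
    using that elems(2) by simp
  have comm: "q {b, a} = q {a, b}" "q {c, a} = q {a, c}" "q {c, b} = q {b, c}" "q {e, a} = q {a, e}" "q {e, b} = q {b, e}"
    "q {e, c} = q {c, e}" "q {f, a} = q {a, f}" "q {f, b} = q {b, f}" "q {f, c} = q {c, f}" "q {f, e} = q {e, f}"
    by (simp_all add: insert_commute)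
  have Cf: "tropical_zero4 (q ({1..5} - {f})) (q {b, c} + q {a, e}) (q {a, c} + q {b, e}) (q {a, b} + q {c, e})"
    using C[of f e a b c, OF _ perm] ne' by (simp add: comm add.commute insert_commute)
  have Ce: "tropical_zero4 (q ({1..5} - {e})) (q {b, c} + q {a, f}) (q {a, c} + q {b, f}) (q {a, b} + q {c, f})"
    using C[of e f a b c, OF _ perm] ne' by (simp add: comm add.commute insert_commute)
  have M: "q ({1..5} - {r}) = min (q {d1, d2} + q {d3, d4}) (min (q {d1, d3} + q {d2, d4}) (q {d1, d4} + q {d2, d3}))"
    if "distinct [r, d1, d2, d3, d4]" "{r, d1, d2, d3, d4} = {a, b, c, e, f}" "r \<in> {a, b, c}" for r d1 d2 d3 d4
  proof (rule tropical_zero4_eq_min[OF C[OF that(1) perm[OF that(2)]]])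
    show "q ({1..5} - {r}) \<le> q {d1, d2} + q {d3, d4}"
      by (rule good[OF that(3,1) perm[OF that(2)]])
    have x: "distinct [r, d1, d3, d2, d4]" "{r, d1, d3, d2, d4} = {a, b, c, e, f}"
      using that(1,2) by (auto simp: insert_commute)
    show "q ({1..5} - {r}) \<le> q {d1, d3} + q {d2, d4}"
      by (rule good[OF that(3) x(1) perm[OF x(2)]])
    have x: "distinct [r, d1, d4, d2, d3]" "{r, d1, d4, d2, d3} = {a, b, c, e, f}"
      using that(1,2) by (auto simp: insert_commute)
    show "q ({1..5} - {r}) \<le> q {d1, d4} + q {d2, d3}"
      by (rule good[OF that(3) x(1) perm[OF x(2)]])
  qed
  have Ma: "q ({1..5} - {a}) = min (q {e, f} + q {b, c}) (min (q {b, e} + q {c, f}) (q {c, e} + q {b, f}))"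
    using M[of a e f b c] ne' by (simp add: comm insert_commute)
  have Mb: "q ({1..5} - {b}) = min (q {e, f} + q {a, c}) (min (q {c, e} + q {a, f}) (q {a, e} + q {c, f}))"
    using M[of b e f c a] ne' by (simp add: comm insert_commute)
  have Mc: "q ({1..5} - {c}) = min (q {e, f} + q {a, b}) (min (q {a, e} + q {b, f}) (q {b, e} + q {a, f}))"
    using M[of c e f a b] ne' by (simp add: comm insert_commute)
  have Ra: "tropical_zero4 (q {a, c} + q ({1..5} - {c})) (q {a, b} + q ({1..5} - {b})) (q ({1..5} - {f}) + q {a, f}) (q ({1..5} - {e}) + q {a, e})"
    using R[of a c b f e, OF _ perm] ne' by (simp add: comm add.commute insert_commute)
  have Rb: "tropical_zero4 (q {a, b} + q ({1..5} - {a})) (q {b, c} + q ({1..5} - {c})) (q ({1..5} - {f}) + q {b, f}) (q ({1..5} - {e}) + q {b, e})"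
    using R[of b a c f e, OF _ perm] ne' by (simp add: comm add.commute insert_commute)
  have Rc: "tropical_zero4 (q {b, c} + q ({1..5} - {b})) (q {a, c} + q ({1..5} - {a})) (q ({1..5} - {f}) + q {c, f}) (q ({1..5} - {e}) + q {c, e})"
    using R[of c b a f e, OF _ perm] ne' by (simp add: comm add.commute insert_commute)
  obtain u0 u1 u2 v0 v1 v2 w0 w1 w2 s where
    u: "hasval u0 (q {b, c})" "hasval u1 (q {a, c})" "hasval u2 (q {a, b})" and
    v: "hasval v0 (q {a, e})" "hasval v1 (q {b, e})" "hasval v2 (q {c, e})" and
    w: "hasval w0 (q {a, f})" "hasval w1 (q {b, f})" "hasval w2 (q {c, f})" and s: "hasval s (q {e, f})" and
    P: "hasval (u0 * v0 + u1 * v1 + u2 * v2) (q ({1..5} - {f}))" "hasval (u0 * w0 + u1 * w1 + u2 * w2) (q ({1..5} - {e}))"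
      "hasval (s * u0 - v1 * w2 + v2 * w1) (q ({1..5} - {a}))" "hasval (s * u1 - v2 * w0 + v0 * w2) (q ({1..5} - {b}))"
      "hasval (s * u2 - v0 * w1 + v1 * w0) (q ({1..5} - {c}))"
    using lift_core[OF qn qn qn qn qn qn qn qn qn qn qn qn Cf Ce Ma Mb Mc Ra Rb Rc] by auto
  \<comment> \<open>Each pair is stored in one orientation; \<open>(c, a)\<close> in place of
    \<open>(a, c)\<close> gives the signs of the cross product.\<close>
  define B where "B i j = (if i = b \<and> j = c then u0 else if i = c \<and> j = a then u1 else if i = a \<and> j = b then u2
    else if i = a \<and> j = e then v0 else if i = b \<and> j = e then v1 else if i = c \<and> j = e then v2
    else if i = a \<and> j = f then w0 else if i = b \<and> j = f then w1 else if i = c \<and> j = f then w2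
    else if i = e \<and> j = f then s else 0)" for i j
  define A where "A i j = B i j - B j i" for i j
  have skew: "A y x = - A x y" for x y by (simp add: A_def)
  have vals: "A b c = u0" "A c a = u1" "A a b = u2" "A a e = v0" "A b e = v1" "A c e = v2"
    "A a f = w0" "A b f = w1" "A c f = w2" "A e f = s"
    unfolding A_def B_def using ne' by simp_all
  have vals': "A c b = - u0" "A a c = - u1" "A b a = - u2" "A e a = - v0" "A e b = - v1" "A e c = - v2"
    "A f a = - w0" "A f b = - w1" "A f c = - w2" "A f e = - s"
    unfolding vals[symmetric] by (rule skew)+
  have hA: "hasval (A i j) (q {i, j})" if "i \<in> {1..5}" "j \<in> {1..5}" "i \<noteq> j" for i j
  proof -
    have "i \<in> {a, b, c, e, f}" "j \<in> {a, b, c, e, f}" using that elems(2) by simp_all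
    then show ?thesis using that(3) u v w s unfolding insert_iff empty_iff
      by (elim disjE) (simp_all add: vals vals' comm hasval_uminus)
  qed
  have hP: "hasval (pf4 A i j k l) (q {i, j, k, l})" if sub: "{i, j, k, l} \<subseteq> {1..5}" and d: "distinct [i, j, k, l]" for i j k l
  proof -
    have c4: "card {i, j, k, l} = 4" using d by simp
    have "card ({1..5} - {i, j, k, l}) = 1" using sub c4 by (simp add: card_Diff_subset)
    then obtain m where m: "{1..5} - {i, j, k, l} = {m}" by (auto simp: card_1_singleton_iff)
    then have ijkl: "{i, j, k, l} = {1..5} - {m}" using sub by blast
    have mm: "m \<in> {a, b, c, e, f}" using m elems(2) by blast
    have 5: "{1..5} - {f} = {a, b, c, e}" "{1..5} - {e} = {a, b, c, f}" "{1..5} - {a} = {b, c, e, f}"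
      "{1..5} - {b} = {c, a, e, f}" "{1..5} - {c} = {a, b, e, f}"
      unfolding elems(2)[symmetric] using ne' by auto
    have p: "pf4 A a b c e = u0 * v0 + u1 * v1 + u2 * v2" "pf4 A a b c f = u0 * w0 + u1 * w1 + u2 * w2"
      "pf4 A b c e f = s * u0 - v1 * w2 + v2 * w1" "pf4 A c a e f = s * u1 - v2 * w0 + v0 * w2"
      "pf4 A a b e f = s * u2 - v0 * w1 + v1 * w0"
      unfolding pf4_def vals vals' by (simp_all add: algebra_simps)
    note hp = hasval_pf4_perm[of A, OF skew _ d]
    from mm show ?thesis
      unfolding insert_iff empty_iff
    proof (elim disjE)
      assume "m = a"
      then have "{i, j, k, l} = {1..5} - {a}" using ijkl by simp
      then show ?thesis using hp[of b c e f] ne' P(3) p 5 by simp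
    next
      assume "m = b"
      then have "{i, j, k, l} = {1..5} - {b}" using ijkl by simp
      then show ?thesis using hp[of c a e f] ne' P(4) p 5 by simp
    next
      assume "m = c"
      then have "{i, j, k, l} = {1..5} - {c}" using ijkl by simp
      then show ?thesis using hp[of a b e f] ne' P(5) p 5 by simp
    next
      assume "m = e"
      then have "{i, j, k, l} = {1..5} - {e}" using ijkl by simp
      then show ?thesis using hp[of a b c f] ne' P(2) p 5 by simp
    next
      assume "m = f"
      then have "{i, j, k, l} = {1..5} - {f}" using ijkl by simp
      then show ?thesis using hp[of a b c e] ne' P(1) p 5 by simp
    qed simp
  qed
  have "hasval (pfW A S) (q S)" if "S \<subseteq> {1..5}" for S
    by (rule hasval_pfW[OF that q0 hA hP odd])
  then show ?thesis by blast
qed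

section \<open>Choice of the base vertex\<close>

lemma DDr_tvec: "p \<in> DDr n \<Longrightarrow> p \<in> tvec n"
  by (simp add: DDr_def)

lemma DDrD:
  "p \<in> DDr n \<Longrightarrow> S \<subseteq> {1..n} \<Longrightarrow> T \<subseteq> {1..n} \<Longrightarrow>
     min_twice (\<lambda>i. p (symd S {i}) + p (symd T {i})) (symd S T)"
  by (simp add: DDr_def)

lemma tvec_not_MInf: "p \<in> tvec n \<Longrightarrow> p S \<noteq> -\<infinity>"
  by (cases "S \<subseteq> {1..n}") (auto simp: tvec_def)

lemma tvec_outside: "p \<in> tvec n \<Longrightarrow> \<not> S \<subseteq> {1..n} \<Longrightarrow> p S = \<infinity>"
  by (simp add: tvec_def)

lemma symd_assoc: "symd (symd A B) C = symd A (symd B C)"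
  by (auto simp: symd_def)

lemma symd_self [simp]: "symd A A = {}" and symd_empty [simp]: "symd A {} = A" "symd {} A = A"
  by (auto simp: symd_def)

lemma symd_commute: "symd A B = symd B A"
  by (auto simp: symd_def)

lemma symd_left_commute: "symd A (symd B C) = symd B (symd A C)"
  by (auto simp: symd_def)

lemma symd_left_self [simp]: "symd A (symd A B) = B"
  by (auto simp: symd_def)

lemma symd_left_cancel [simp]: "symd A B = symd A C \<longleftrightarrow> B = C"
  by (metis symd_left_self)

lemma ereal_add_eq_PInf: "(a::ereal) + b = \<infinity> \<longleftrightarrow> a = \<infinity> \<or> b = \<infinity>"
  by (cases a; cases b; simp)

text \<open>A minimal pair of support sets at odd distance could be moved closer together by exchange.\<close>
lemma DDr_parity:
  assumes p: "p \<in> DDr n"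
  shows "p A \<noteq> \<infinity> \<Longrightarrow> p B \<noteq> \<infinity> \<Longrightarrow> even (card (symd A B))"
proof (induction "card (symd A B)" arbitrary: A rule: less_induct)
  case less
  have AB: "A \<subseteq> {1..n}" "B \<subseteq> {1..n}"
    using less.prems tvec_outside[OF DDr_tvec[OF p]] by blast+
  have fin: "finite (symd A B)" using AB finite_subset[of _ "{1..n}"] by simp
  show ?case
  proof (rule ccontr)
    assume odd: "odd (card (symd A B))"
    then have "symd A B \<noteq> {}" by (intro notI) simp
    then obtain i where i: "i \<in> symd A B" by blast
    let ?S = "symd A {i}" and ?T = "symd B {i}"
    let ?f = "\<lambda>j. p (symd ?S {j}) + p (symd ?T {j})"
    have sub: "?S \<subseteq> {1..n}" "?T \<subseteq> {1..n}" using AB i by (auto simp: symd_def)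
    have ST: "symd ?S ?T = symd A B" by (auto simp: symd_def)
    have fi: "?f i = p A + p B" by (simp add: symd_assoc)
    have "min_twice ?f (symd A B)" using DDrD[OF p sub] by (simp only: ST)
    moreover have "?f i \<noteq> \<infinity>" using less.prems by (simp only: fi ereal_add_eq_PInf) simp
    ultimately obtain j k where jk: "j \<in> symd A B" "k \<in> symd A B" "j \<noteq> k" "?f j = ?f k" "?f j \<le> ?f i"
      unfolding min_twice_def using i by blast
    define l where "l = (if j = i then k else j)"
    have l: "l \<in> symd A B" "l \<noteq> i" "?f l = ?f j" using jk by (auto simp: l_def)
    have "?f l \<noteq> \<infinity>" using l(3) jk(5) \<open>?f i \<noteq> \<infinity>\<close> by auto
    then have A': "p (symd ?S {l}) \<noteq> \<infinity>" by (simp add: ereal_add_eq_PInf)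
    have eq: "symd (symd ?S {l}) B = symd A B - {i, l}" using i l by (auto simp: symd_def)
    have "card {i, l} = 2" using l(2) by simp
    then have card: "card (symd A B) = card (symd A B - {i, l}) + 2"
      using card_Diff_subset[of "{i, l}" "symd A B"] card_mono[of "symd A B" "{i, l}"] fin i l(1) by simp
    have "even (card (symd (symd ?S {l}) B))"
      by (rule less.hyps[OF _ A' less.prems(2)]) (simp only: eq, use card in simp)
    then show False using odd card by (simp only: eq) simp
  qed
qed

text \<open>Given the coordinate \<open>r\<close>, three more coordinates determine the vertex: the last one is recovered
  from the parity.\<close>
lemma card_half_facet:
  fixes r :: nat
  assumes "r \<in> {1..5}"
  shows "card {Y. Y \<subseteq> {1..5} \<and> (r \<in> Y \<longleftrightarrow> \<epsilon>) \<and> (even (card Y) \<longleftrightarrow> \<pi>)} \<le> 8"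
proof -
  let ?F = "{Y. Y \<subseteq> {1..5} \<and> (r \<in> Y \<longleftrightarrow> \<epsilon>) \<and> (even (card Y) \<longleftrightarrow> \<pi>)}"
  have "card ({1..5::nat} - {r}) = 4" using assms by simp
  then have "{1..5} - {r} \<noteq> {}" by (metis card.empty zero_neq_numeral)
  then obtain d where d: "d \<in> {1..5} - {r}" by blast
  let ?E = "{1..5} - {r, d}"
  have cE: "card ?E = 3" using assms d by (subst card_Diff_subset) auto
  have "inj_on (\<lambda>Y. Y \<inter> ?E) ?F"
  proof (rule inj_onI)
    fix Y Z assume Y: "Y \<in> ?F" and Z: "Z \<in> ?F" and eq: "Y \<inter> ?E = Z \<inter> ?E"
    have sub: "symd Y Z \<subseteq> {d}" using Y Z eq by (auto simp: symd_def)
    have "finite Y" "finite Z" using Y Z finite_subset[of _ "{1..5::nat}"] by auto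
    then have "even (card (symd Y Z))" using Y Z by (auto simp: card_symd_parity)
    moreover have "symd Y Z = {} \<or> symd Y Z = {d}" using sub by blast
    ultimately have "symd Y Z = {}" by auto
    then show "Y = Z" by (auto simp: symd_def)
  qed
  then have "card ?F = card ((\<lambda>Y. Y \<inter> ?E) ` ?F)" by (rule card_image[symmetric])
  also have "\<dots> \<le> card (Pow ?E)" by (rule card_mono) auto
  also have "\<dots> = 8" by (simp only: card_Pow finite_Diff finite_atLeastAtMost cE) simp
  finally show ?thesis .
qed

text \<open>The facet \<open>{Y. r \<in> Y \<longleftrightarrow> r \<in> X}\<close> carries one Wick relation on the vertices of the parity of
  \<open>X\<close>; its terms pair antipodal vertices, and \<open>X\<close> is bad if its pair does not attain the minimum.\<close>
definition facet_sum :: "(nat set \<Rightarrow> ereal) \<Rightarrow> nat \<Rightarrow> nat set \<Rightarrow> ereal" where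
  "facet_sum p r X = p X + p (symd X ({1..5} - {r}))"

definition bad :: "(nat set \<Rightarrow> ereal) \<Rightarrow> nat \<Rightarrow> nat set \<Rightarrow> bool" where
  "bad p r X \<longleftrightarrow> (\<exists>Z\<subseteq>{1..5} - {r}. even (card Z) \<and> facet_sum p r (symd X Z) < facet_sum p r X)"

text \<open>Badness of \<open>X\<close> makes the minimum over the facet finite. The Wick relation
  of the facet attains it at two antipodal pairs, hence at four vertices, and these lie in the
  support because the minimum is finite.\<close>

lemma four_good:
  assumes p: "p \<in> DDr 5" and r: "r \<in> {1..5}" and X: "X \<subseteq> {1..5}" "bad p r X"
  shows "\<exists>G \<subseteq> {Y. Y \<subseteq> {1..5} \<and> (r \<in> Y \<longleftrightarrow> r \<in> X) \<and> (even (card Y) \<longleftrightarrow> even (card X))}.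
    card G = 4 \<and> (\<forall>Y\<in>G. p Y \<noteq> \<infinity> \<and> \<not> bad p r Y)"
proof -
  let ?F = "{Y. Y \<subseteq> {1..5} \<and> (r \<in> Y \<longleftrightarrow> r \<in> X) \<and> (even (card Y) \<longleftrightarrow> even (card X))}"
  let ?D = "{1..5} - {r}"
  let ?s = "facet_sum p r"
  have finF: "finite ?F" by (rule finite_subset[of _ "Pow {1..5}"]) auto
  have finD: "finite ?D" by simp
  have cD: "card ?D = 4" using r by simp
  have closed: "symd Y Z \<in> ?F" if "Y \<in> ?F" "Z \<subseteq> ?D" "even (card Z)" for Y Z
  proof -
    have "finite Y" "finite Z" using that finite_subset[of _ "{1..5::nat}"] by auto
    moreover have "symd Y Z \<subseteq> {1..5}" using that by (auto simp: symd_def)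
    ultimately show ?thesis using that card_symd_parity[of Y Z] by (auto simp: symd_simps)
  qed
  have XF: "X \<in> ?F" using X by simp
  then have neF: "?F \<noteq> {}" by (intro notI) (simp only: empty_iff)
  have "\<exists>Y. is_arg_min ?s (\<lambda>Y. Y \<in> ?F) Y" by (rule ex_is_arg_min_if_finite[OF finF neF])
  then obtain Y where "Y \<in> ?F \<and> (\<forall>Y'. Y' \<in> ?F \<longrightarrow> ?s Y \<le> ?s Y')"
    unfolding is_arg_min_linorder by (elim exE) (rule that)
  then have Y: "Y \<in> ?F" "\<And>Y'. Y' \<in> ?F \<Longrightarrow> ?s Y \<le> ?s Y'" by (simp_all only: simp_thms)
  obtain Z where "Z \<subseteq> ?D" "even (card Z)" "?s (symd X Z) < ?s X" using X(2) by (auto simp: bad_def)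
  then have "?s Y < ?s X" using Y(2)[OF closed[OF XF]] by (meson order.strict_trans1)
  then have Yfin: "?s Y \<noteq> \<infinity>" by auto
  have good: "p Y' \<noteq> \<infinity> \<and> p (symd Y' ?D) \<noteq> \<infinity> \<and> \<not> bad p r Y'" if Y': "Y' \<in> ?F" "?s Y' = ?s Y" for Y'
  proof -
    have "?s Y' \<le> ?s (symd Y' Z)" if "Z \<subseteq> ?D" "even (card Z)" for Z
      using Y(2)[OF closed[OF Y'(1) that]] Y'(2) by simp
    then have "\<not> bad p r Y'" unfolding bad_def by (meson not_le)
    moreover have "?s Y' \<noteq> \<infinity>" using Y'(2) Yfin by simp
    ultimately show ?thesis unfolding facet_sum_def ereal_add_eq_PInf by blast
  qed
  have sD: "?s (symd Y' ?D) = ?s Y'" for Y'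
    by (simp add: facet_sum_def symd_assoc add.commute)
  have Dne: "?D \<noteq> {}" using cD by (metis card.empty zero_neq_numeral)
  then obtain d where d: "d \<in> ?D" by blast
  \<comment> \<open>Twisting both ends by \<open>d\<close> makes index \<open>d\<close> reproduce
    the minimal pair of \<open>Y\<close>; any other index \<open>i\<close> gives the pair of
    \<open>symd Y {d, i}\<close>.\<close>
  let ?S = "symd Y {d}" and ?T = "symd (symd Y ?D) {d}"
  let ?f = "\<lambda>j. p (symd ?S {j}) + p (symd ?T {j})"
  have YS: "Y \<subseteq> {1..5}" using Y(1) by simp
  have sub: "?S \<subseteq> {1..5}" "?T \<subseteq> {1..5}" using YS d by (auto simp: symd_def)
  have ST: "symd ?S ?T = ?D" by (auto simp: symd_def)
  have f: "?f i = ?s (symd Y (symd {d} {i}))" for i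
  proof -
    have "symd ?T {i} = symd (symd Y (symd {d} {i})) ?D" by (simp only: symd_assoc symd_commute[of _ ?D] symd_left_commute[of _ ?D])
    then show ?thesis by (simp only: facet_sum_def symd_assoc)
  qed
  have fd: "?f d = ?s Y" by (simp only: f symd_self symd_empty)
  have "min_twice ?f ?D" using DDrD[OF p sub] by (simp only: ST)
  then obtain j k where jk: "j \<in> ?D" "k \<in> ?D" "j \<noteq> k" "?f j = ?f k" "?f j \<le> ?f d"
    unfolding min_twice_def using d Yfin fd by metis
  define l where "l = (if j = d then k else j)"
  have l: "l \<in> ?D" "l \<noteq> d" "?f l \<le> ?s Y" using jk fd by (auto simp: l_def)
  let ?P = "{d, l}"
  have P: "symd {d} {l} = ?P" using l(2) by (auto simp: symd_def)
  have PD: "?P \<subseteq> ?D" "card ?P = 2" using d l by auto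
  have Y2: "symd Y ?P \<in> ?F" by (rule closed[OF Y(1) PD(1)]) (use PD in simp)
  have sY2: "?s (symd Y ?P) = ?s Y"
    using l(3) Y(2)[OF Y2] unfolding f P by (rule antisym)
  let ?I = "{{}, ?D, ?P, symd ?P ?D}"
  have DPs: "symd ?P ?D = ?D - ?P" using PD by (auto simp: symd_def)
  have cDP: "card (?D - ?P) = 2" using card_Diff_subset[of ?P ?D] PD cD by simp
  have ne: "?D \<noteq> {}" "?P \<noteq> {}" "?P \<noteq> ?D" "symd ?P ?D \<noteq> {}" "symd ?P ?D \<noteq> ?D" "symd ?P ?D \<noteq> ?P"
  proof -
    show "?D \<noteq> {}" by (rule Dne)
    have "card ?P \<noteq> card ?D" using cD PD(2) by linarith
    then show "?P \<noteq> ?D" by metis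
    have "?D - ?P \<noteq> {}"
    proof
      assume "?D - ?P = {}"
      with cDP show False by (simp only: card.empty)
    qed
    then show "symd ?P ?D \<noteq> {}" by (simp only: DPs not_False_eq_True)
    show "symd ?P ?D \<noteq> ?D" "symd ?P ?D \<noteq> ?P" unfolding DPs using d by blast+
  qed simp
  have cI: "card ?I = 4"
    using ne by (simp add: eq_commute[of "{}"] eq_commute[of "?D"] eq_commute[of "?P"] del: Diff_eq_empty_iff)
  let ?G = "symd Y ` ?I"
  have "card ?G = 4" using cI by (subst card_image) (simp_all add: inj_on_def)
  moreover have GF: "?G \<subseteq> ?F"
  proof (rule image_subsetI)
    fix Z assume Z: "Z \<in> ?I"
    have "even (card (?D - ?P))" "even (card ?P)" "even (card ?D)" using cDP PD(2) cD by simp_all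
    then have "Z \<subseteq> ?D \<and> even (card Z)"
      using Z PD(1) unfolding DPs by (elim insertE emptyE) (simp_all only: card.empty even_zero, simp_all)
    then show "symd Y Z \<in> ?F" by (elim conjE) (rule closed[OF Y(1)])
  qed
  moreover have "p Z \<noteq> \<infinity> \<and> \<not> bad p r Z" if "Z \<in> ?G" for Z
  proof -
    have "Z = Y \<or> Z = symd Y ?D \<or> Z = symd Y ?P \<or> Z = symd (symd Y ?P) ?D"
      using that by (simp only: image_insert image_empty symd_empty symd_assoc insert_iff empty_iff simp_thms)
    then have "?s Z = ?s Y" by (elim disjE) (simp_all only: sD sY2)
    with subsetD[OF GF that] good[of Z] show ?thesis by (simp only: simp_thms)
  qed
  ultimately show ?thesis
    by (intro exI[of _ ?G] conjI ballI) (assumption | erule meta_allE, erule (1) meta_impE, (elim conjE, assumption))+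
qed

text \<open>The two facets in direction \<open>r\<close> are treated separately. By
  \<open>DDr_parity\<close> the support meets each in one parity class, of at most 8 vertices; a bad
  vertex there brings four that are not bad, leaving at most four bad ones.\<close>

lemma bad_le_good:
  assumes p: "p \<in> DDr 5" and r: "r \<in> {1..5}"
  defines "supp \<equiv> {X. X \<subseteq> {1..5} \<and> p X \<noteq> \<infinity>}"
  shows "card {X \<in> supp. bad p r X} \<le> card {X \<in> supp. \<not> bad p r X}"
proof -
  have fin: "finite supp" unfolding supp_def by (rule finite_subset[of _ "Pow {1..5}"]) auto
  have half: "card {X \<in> supp. bad p r X \<and> (r \<in> X \<longleftrightarrow> \<epsilon>)} \<le> card {X \<in> supp. \<not> bad p r X \<and> (r \<in> X \<longleftrightarrow> \<epsilon>)}" for \<epsilon>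
  proof (cases "{X \<in> supp. bad p r X \<and> (r \<in> X \<longleftrightarrow> \<epsilon>)} = {}")
    case False
    then obtain X where X: "X \<in> supp" "bad p r X" "r \<in> X \<longleftrightarrow> \<epsilon>" by blast
    let ?F = "{Y. Y \<subseteq> {1..5} \<and> (r \<in> Y \<longleftrightarrow> \<epsilon>) \<and> (even (card Y) \<longleftrightarrow> even (card X))}"
    have X5: "X \<subseteq> {1..5}" using X(1) by (simp add: supp_def)
    obtain G where G: "G \<subseteq> ?F" "card G = 4" "\<And>Y. Y \<in> G \<Longrightarrow> p Y \<noteq> \<infinity> \<and> \<not> bad p r Y"
      using four_good[OF p r X5 X(2)] X(3) by auto
    have finF: "finite ?F" by (rule finite_subset[of _ "Pow {1..5}"]) auto
    have "{X \<in> supp. bad p r X \<and> (r \<in> X \<longleftrightarrow> \<epsilon>)} \<subseteq> ?F - G"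
    proof
      fix Y assume Y: "Y \<in> {X \<in> supp. bad p r X \<and> (r \<in> X \<longleftrightarrow> \<epsilon>)}"
      then have "finite X" "finite Y" "p Y \<noteq> \<infinity>" "p X \<noteq> \<infinity>" using X finite_subset[of _ "{1..5::nat}"] by (auto simp: supp_def)
      then have "even (card Y) \<longleftrightarrow> even (card X)" using DDr_parity[OF p, of Y X] card_symd_parity[of Y X] by auto
      then show "Y \<in> ?F - G" using Y G(3) by (auto simp: supp_def)
    qed
    then have "card {X \<in> supp. bad p r X \<and> (r \<in> X \<longleftrightarrow> \<epsilon>)} \<le> card (?F - G)"
      using finF by (intro card_mono) auto
    also have "\<dots> = card ?F - card G" by (rule card_Diff_subset) (use G(1) finite_subset[OF G(1) finF] in auto)
    also have "\<dots> \<le> card G" using card_half_facet[OF r, of \<epsilon> "even (card X)"] G(2) by simp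
    also have "\<dots> \<le> card {X \<in> supp. \<not> bad p r X \<and> (r \<in> X \<longleftrightarrow> \<epsilon>)}"
      by (rule card_mono) (use fin G in \<open>auto simp: supp_def\<close>)
    finally show ?thesis .
  qed (simp only: card.empty le0)
  have split: "card {X \<in> supp. Q X} = card {X \<in> supp. Q X \<and> (r \<in> X \<longleftrightarrow> True)} + card {X \<in> supp. Q X \<and> (r \<in> X \<longleftrightarrow> False)}" for Q
    by (subst card_Un_disjoint[symmetric]) (use fin in \<open>auto intro!: arg_cong[where f = card]\<close>)
  show ?thesis unfolding split[of "bad p r"] split[of "\<lambda>X. \<not> bad p r X"] by (rule add_mono[OF half half])
qed

text \<open>Averaging over the support: a vertex lies in five facets, and in each facet at least half of
  the support is not bad, so some support vertex is bad in at most two of them.\<close>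
lemma exists_nearly_good:
  assumes p: "p \<in> DDr 5" and ne: "p X0 \<noteq> \<infinity>"
  shows "\<exists>X\<subseteq>{1..5}. p X \<noteq> \<infinity> \<and> card {r \<in> {1..5}. bad p r X} \<le> 2"
proof (rule ccontr)
  let ?supp = "{X. X \<subseteq> {1..5} \<and> p X \<noteq> \<infinity>}"
  assume "\<not> ?thesis"
  then have three: "3 \<le> card {r \<in> {1..5}. bad p r X}" if "X \<in> ?supp" for X
    using that by (auto simp: not_le Suc_le_eq numeral_3_eq_3 numeral_2_eq_2)
  have fin: "finite ?supp" by (rule finite_subset[of _ "Pow {1..5}"]) auto
  have X0: "X0 \<in> ?supp" using ne tvec_outside[OF DDr_tvec[OF p]] by blast
  have cnt: "card {x \<in> A. Q x} = (\<Sum>x\<in>A. if Q x then 1 else 0)" if "finite A" for A :: "'z set" and Q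
    using that by (simp add: sum.If_cases Int_def)
  have half: "2 * card {X \<in> ?supp. bad p r X} \<le> card ?supp" if "r \<in> {1..5}" for r
  proof -
    have "card ?supp = card {X \<in> ?supp. bad p r X} + card {X \<in> ?supp. \<not> bad p r X}"
      by (subst card_Un_disjoint[symmetric]) (use fin in \<open>auto intro!: arg_cong[where f = card]\<close>)
    then show ?thesis using bad_le_good[OF p that] by simp
  qed
  have "3 * card ?supp = (\<Sum>X\<in>?supp. 3)" by simp
  also have "\<dots> \<le> (\<Sum>X\<in>?supp. card {r \<in> {1..5}. bad p r X})" by (rule sum_mono) (rule three)
  also have "\<dots> = (\<Sum>X\<in>?supp. \<Sum>r\<in>{1..5}. if bad p r X then 1 else 0)"
    by (simp only: cnt finite_atLeastAtMost)
  also have "\<dots> = (\<Sum>r\<in>{1..5}. \<Sum>X\<in>?supp. if bad p r X then 1 else 0)" by (rule sum.swap)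
  also have "\<dots> = (\<Sum>r\<in>{1..5}. card {X \<in> ?supp. bad p r X})" by (simp only: cnt fin)
  finally have "2 * (3 * card ?supp) \<le> (\<Sum>r\<in>{1..5}. 2 * card {X \<in> ?supp. bad p r X})"
    by (simp only: sum_distrib_left[symmetric])
  also have "\<dots> \<le> (\<Sum>r\<in>{1..5::nat}. card ?supp)" by (rule sum_mono) (rule half)
  also have "\<dots> = 5 * card ?supp" by simp
  finally have "card ?supp = 0" by simp
  then show False using X0 fin by auto
qed

text \<open>The twist preserves \<open>symd S T\<close> and with it all signs; the scalar enters
  every term as \<open>c * c\<close>.\<close>

lemma set_wick_twist:
  assumes "set_wick n W" "X \<subseteq> {1..n}"
  shows "set_wick n (\<lambda>S. c * W (symd S X))"
  unfolding set_wick_def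
proof (intro allI impI)
  fix S T assume "S \<subseteq> {1..n}" "T \<subseteq> {1..n}"
  then have sub: "symd S X \<subseteq> {1..n}" "symd T X \<subseteq> {1..n}" using assms(2) by (simp_all only: symd_subset)
  have D: "symd (symd S X) (symd T X) = symd S T" by (auto simp: symd_def)
  have co: "wick_coeff (symd S X) (symd T X) i = wick_coeff S T i" for i by (simp only: wick_coeff_def D)
  have sw: "symd (symd U {i}) X = symd (symd U X) {i}" for U i by (metis symd_assoc symd_commute)
  have "(\<Sum>i\<in>symd S T. of_int (wick_coeff S T i) * (c * W (symd (symd S {i}) X) * (c * W (symd (symd T {i}) X))))
    = c * c * (\<Sum>i\<in>symd (symd S X) (symd T X). of_int (wick_coeff (symd S X) (symd T X) i) *
        (W (symd (symd S X) {i}) * W (symd (symd T X) {i})))"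
    unfolding D co sw sum_distrib_left by (rule sum.cong) (simp_all add: mult_ac)
  also have "\<dots> = 0" using assms(1) sub by (simp add: set_wick_def)
  finally show "(\<Sum>i\<in>symd S T. of_int (wick_coeff S T i) * (c * W (symd (symd S {i}) X) * (c * W (symd (symd T {i}) X)))) = 0" .
qed

lemma min_twice_shift:
  fixes c :: real
  assumes "min_twice f A" shows "min_twice (\<lambda>i. f i + ereal c) A"
proof -
  have 1: "f i + ereal c \<le> f j + ereal c" if "f i \<le> f j" for i j using that by (rule add_right_mono)
  show ?thesis using assms 1 unfolding min_twice_def by (auto simp: ereal_add_eq_PInf) metis
qed

lemma DDr_5_lift:
  assumes p: "p \<in> DDr 5"
  shows "\<exists>W. set_wick 5 W \<and> (\<forall>S\<subseteq>{1..5}. hasval (W S) (p S))"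
proof (cases "\<forall>S. p S = \<infinity>")
  case True
  then have "set_wick 5 (\<lambda>_. 0)" "\<forall>S\<subseteq>{1..5}. hasval ((\<lambda>_. 0) S) (p S)" by (simp_all add: set_wick_def)
  then show ?thesis by blast
next
  case False
  note tv = DDr_tvec[OF p]
  obtain X where X: "X \<subseteq> {1..5}" "p X \<noteq> \<infinity>" "card {r \<in> {1..5}. bad p r X} \<le> 2"
    using exists_nearly_good[OF p] False by blast
  obtain x where x: "p X = ereal x" using X(2) tvec_not_MInf[OF tv, of X] by (cases "p X") auto
  \<comment> \<open>Moves \<open>X\<close> to the empty set and normalises its value to 0, the
    valuation of the empty Pfaffian 1.\<close>
  define q where "q S = p (symd S X) + ereal (- x)" for S
  have q0: "q {} = 0" by (simp add: q_def x)
  have qn: "q S \<noteq> -\<infinity>" for S using tvec_not_MInf[OF tv, of "symd S X"] by (cases "p (symd S X)") (auto simp: q_def)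
  have odd: "q S = \<infinity>" if "S \<subseteq> {1..5}" "odd (card S)" for S
  proof (rule ccontr)
    assume "q S \<noteq> \<infinity>"
    then have "p (symd S X) \<noteq> \<infinity>" by (auto simp: q_def)
    from DDr_parity[OF p this X(2)] that(2) show False by (simp add: symd_assoc)
  qed
  have H: "min_twice (\<lambda>i. q (symd S {i}) + q (symd T {i})) (symd S T)" if ST: "S \<subseteq> {1..5}" "T \<subseteq> {1..5}" for S T
  proof -
    have sub: "symd S X \<subseteq> {1..5}" "symd T X \<subseteq> {1..5}" using ST X(1) by (simp_all only: symd_subset)
    have D: "symd (symd S X) (symd T X) = symd S T" by (auto simp: symd_def)
    have sw: "symd (symd U {i}) X = symd (symd U X) {i}" for U i by (metis symd_assoc symd_commute)
    have "q (symd S {i}) + q (symd T {i}) = p (symd (symd S X) {i}) + p (symd (symd T X) {i}) + ereal (- 2 * x)" for i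
      unfolding q_def sw using tvec_not_MInf[OF tv, of "symd (symd S X) {i}"] tvec_not_MInf[OF tv, of "symd (symd T X) {i}"]
      by (cases "p (symd (symd S X) {i})"; cases "p (symd (symd T X) {i})") auto
    then show ?thesis using min_twice_shift[OF DDrD[OF p sub], of "- 2 * x"] by (simp only: D)
  qed
  \<comment> \<open>The bad directions are padded to exactly two, which leaves three directions
    \<open>a\<close>, \<open>b\<close>, \<open>c\<close> without cancellation.\<close>
  have "\<exists>E. {r \<in> {1..5}. bad p r X} \<subseteq> E \<and> E \<subseteq> {1..5} \<and> card E = 2"
    using obtain_subset_with_card_n[of "2 - card {r \<in> {1..5}. bad p r X}" "{1..5} - {r \<in> {1..5}. bad p r X}"]
  proof -
    let ?B = "{r \<in> {1..5}. bad p r X}"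
    have "card ({1..5} - ?B) = 5 - card ?B" by (subst card_Diff_subset) auto
    then have "2 - card ?B \<le> card ({1..5} - ?B)" by simp
    then obtain E' where E': "E' \<subseteq> {1..5} - ?B" "card E' = 2 - card ?B" "finite E'"
      by (rule obtain_subset_with_card_n)
    have "card (?B \<union> E') = card ?B + card E'" by (rule card_Un_disjoint) (use E' in auto)
    then have "card (?B \<union> E') = 2" using E'(2) X(3) by simp
    then show ?thesis using E'(1) by (intro exI[of _ "?B \<union> E'"]) auto
  qed
  then obtain E where E: "{r \<in> {1..5}. bad p r X} \<subseteq> E" "E \<subseteq> {1..5}" "card E = 2" by blast
  obtain e f where ef: "E = {e, f}" "e \<noteq> f" using E(3) by (meson card_2_iff)
  have "card ({1..5} - E) = 3" using E by (subst card_Diff_subset) (auto intro: finite_subset)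
  then obtain a b c where abc: "{1..5} - E = {a, b, c}" "a \<noteq> b" "b \<noteq> c" "a \<noteq> c" by (meson card_3_iff)
  have elems: "distinct [a, b, c, e, f]" "{a, b, c, e, f} = {1..5}"
  proof -
    have "a \<notin> E" "b \<notin> E" "c \<notin> E" using abc(1) by blast+
    then show "distinct [a, b, c, e, f]" using abc ef by auto
    show "{a, b, c, e, f} = {1..5}" using abc(1) E(2) ef(1) by blast
  qed
  have good: "q ({1..5} - {r}) \<le> q {d1, d2} + q {d3, d4}"
    if r: "r \<in> {a, b, c}" and d: "distinct [r, d1, d2, d3, d4]" and s: "{r, d1, d2, d3, d4} = {1..5}" for r d1 d2 d3 d4
  proof -
    have D: "{1..5} - {r} = {d1, d2, d3, d4}" unfolding s[symmetric] using d by auto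
    have "\<not> bad p r X" using r abc(1) E(1) by blast
    moreover have "{d1, d2} \<subseteq> {1..5} - {r}" "even (card {d1, d2})" unfolding D using d by auto
    ultimately have "facet_sum p r X \<le> facet_sum p r (symd X {d1, d2})" unfolding bad_def by (meson not_le)
    then have le: "p X + p (symd X {d1, d2, d3, d4}) \<le> p (symd X {d1, d2}) + p (symd (symd X {d1, d2}) {d1, d2, d3, d4})"
      unfolding facet_sum_def D .
    \<comment> \<open>In the facet, the antipode of \<open>symd X {d1, d2}\<close> is
      \<open>symd X {d3, d4}\<close>, so the facet sum there is a term of the Pfaffian.\<close>
    have "symd {d1, d2} {d1, d2, d3, d4} = {d3, d4}" using d by (auto simp: symd_def)
    with le have le': "p X + p (symd {d1, d2, d3, d4} X) \<le> p (symd {d1, d2} X) + p (symd {d3, d4} X)"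
      by (simp add: symd_assoc) (simp add: symd_commute)
    show ?thesis unfolding D q_def
      using le' x tvec_not_MInf[OF tv, of "symd {d1, d2} X"] tvec_not_MInf[OF tv, of "symd {d3, d4} X"]
        tvec_not_MInf[OF tv, of "symd {d1, d2, d3, d4} X"]
      by (cases "p (symd {d1, d2} X)"; cases "p (symd {d3, d4} X)"; cases "p (symd {d1, d2, d3, d4} X)") auto
  qed
  obtain A where A: "\<And>S. S \<subseteq> {1..5} \<Longrightarrow> hasval (pfW A S) (q S)"
    using pfaffian_lift[OF q0 qn odd H elems good] by blast
  \<comment> \<open>Undoes the normalisation of \<open>q\<close>.\<close>
  define W where "W S = tmono x 1 * pfW A (symd S X)" for S
  have "set_wick 5 W" unfolding W_def[abs_def] by (rule set_wick_twist[OF set_wick_pfW X(1)])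
  moreover have "hasval (W S) (p S)" if "S \<subseteq> {1..5}" for S
  proof -
    have "hasval (tmono x 1) (ereal x)" by (simp add: coef_tmono delta_def)
    moreover have "hasval (pfW A (symd S X)) (q (symd S X))" by (rule A) (rule symd_subset[OF that X(1)])
    ultimately have "hasval (W S) (ereal x + q (symd S X))" unfolding W_def by (rule hasval_mult)
    moreover have "ereal x + q (symd S X) = p S"
      by (cases "p S") (simp_all add: q_def symd_assoc)
    ultimately show ?thesis by simp
  qed
  ultimately show ?thesis by blast
qed

text \<open>Coordinates outside \<open>{1..n}\<close> are infinite, so a relation with a finite term
  already has \<open>S\<close> and \<open>T\<close> inside \<open>{1..n}\<close>. This reduces every
  \<open>n \<le> 5\<close> to \<open>n = 5\<close>.\<close>

lemma DDr_mono:
  assumes "n \<le> m" shows "DDr n \<subseteq> DDr m"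
proof
  fix p assume p: "p \<in> DDr n"
  note tv = DDr_tvec[OF p]
  have nm: "{1..n} \<subseteq> {1..m}" using assms by auto
  have "p \<in> tvec m"
    unfolding tvec_def
  proof (intro CollectI conjI allI impI tvec_not_MInf[OF tv])
    show "p S = \<infinity>" if "\<not> S \<subseteq> {1..m}" for S
      by (rule tvec_outside[OF tv]) (use that nm in blast)
  qed
  moreover have "min_twice (\<lambda>i. p (symd S {i}) + p (symd T {i})) (symd S T)" for S T
  proof (cases "\<forall>i\<in>symd S T. p (symd S {i}) + p (symd T {i}) = \<infinity>")
    case True
    then show ?thesis by (simp add: min_twice_def)
  next
    case False
    then obtain i where i: "i \<in> symd S T" "p (symd S {i}) \<noteq> \<infinity>" "p (symd T {i}) \<noteq> \<infinity>"
      by (auto simp: ereal_add_eq_PInf)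
    then have sub: "symd S {i} \<subseteq> {1..n}" "symd T {i} \<subseteq> {1..n}" using tvec_outside[OF tv] by blast+
    moreover have "i \<in> symd S {i} \<or> i \<in> symd T {i}" using i(1) by (auto simp: symd_simps)
    ultimately have "{i} \<subseteq> {1..n}" by blast
    then have "symd (symd S {i}) {i} \<subseteq> {1..n}" "symd (symd T {i}) {i} \<subseteq> {1..n}"
      using sub by (simp_all only: symd_subset)
    then have "S \<subseteq> {1..n}" "T \<subseteq> {1..n}" by (simp_all only: symd_assoc symd_self symd_empty)
    then show ?thesis by (rule DDrD[OF p])
  qed
  ultimately show "p \<in> DDr m" by (simp add: DDr_def)
qed

lemma set_wick_mono:
  assumes "n \<le> m" "set_wick m W" shows "set_wick n W"
  unfolding set_wick_def
proof (intro allI impI)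
  fix S T assume ST: "S \<subseteq> {1..n}" "T \<subseteq> {1..n}"
  have "{1..n} \<subseteq> {1..m}" using assms(1) by auto
  with ST have "S \<subseteq> {1..m}" "T \<subseteq> {1..m}" by blast+
  then show "(\<Sum>i\<in>symd S T. of_int (wick_coeff S T i) * (W (symd S {i}) * W (symd T {i}))) = 0"
    using assms(2) unfolding set_wick_def by simp
qed

lemma DDr_subset_TSpin_pm:
  assumes "n \<le> 5" shows "DDr n \<subseteq> TSpin_pm n"
proof
  fix p assume p: "p \<in> DDr n"
  then have "p \<in> DDr 5" using DDr_mono[OF assms] by blast
  then obtain W where W: "set_wick 5 W" "\<And>S. S \<subseteq> {1..5} \<Longrightarrow> hasval (W S) (p S)" using DDr_5_lift by blast
  have "{1..n} \<subseteq> {1..5}" using assms by auto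
  then have "hasval (W S) (p S)" if "S \<subseteq> {1..n}" for S using W(2)[of S] that by blast
  then show "p \<in> TSpin_pm n"
    by (rule trop_var_of_lift[OF DDr_tvec[OF p] _ set_wick_mono[OF assms W(1)]])
qed

theorem theorem4p6:
  shows "(\<forall>n. 1 \<le> n \<and> n \<le> 5 \<longrightarrow> TSpin_pm n = DDr n) \<and>
         (\<forall>n. 7 \<le> n \<longrightarrow>
            TSpin_pm n \<subset> DDr n \<and>
            (\<exists>p \<in> DDr_plus n. tsupp p = {S. S \<subseteq> {1..n} \<and> even (card S)} \<and>
                              p \<notin> TSpin_plus n))"
proof (intro conjI allI impI)
  fix n :: nat assume "1 \<le> n \<and> n \<le> 5"
  then show "TSpin_pm n = DDr n" using TSpin_pm_subset_DDr DDr_subset_TSpin_pm by blast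
next
  fix n :: nat assume n: "7 \<le> n"
  show "TSpin_pm n \<subset> DDr n"
    using TSpin_pm_subset_DDr[of n] paving_fano_in_DDr[of n] paving_fano_properties(4)[OF n] by blast
  show "\<exists>p \<in> DDr_plus n. tsupp p = {S. S \<subseteq> {1..n} \<and> even (card S)} \<and> p \<notin> TSpin_plus n"
    using paving_fano_properties[OF n] by blast
qed

end
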